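(* Let $q$ be a prime power. Let $ss_A(n,q)$ (resp. $ss_{GL}(n,q)$) be the probability that a uniform element of $A(n,q)$ (resp. $GL(n,q)$) is semisimple, $SS_A(u,q)=\sum_{n\ge0}ss_A(n,q)u^n$, $SS_{GL}(u,q)=\sum_{n\ge0}ss_{GL}(n,q)u^n$. Then as formal power series \[ SS_A(u,q)=\Bigl(\sum_{k\ge0}\frac{u^k}{q^{k^2+k}(\frac1q)_k}\Bigr)\prod_{d\ge1}\Bigl(\sum_{k\ge0}\frac{u^{kd}}{q^{k^2d}(\frac1{q^d})_k}\Bigr)^{N'(d,q)}=\frac{\sum_{k\ge0}\frac{u^k}{q^{k^2+k}(\frac1q)_k}}{\sum_{k\ge0}\frac{u^k}{q^{k^2}(\frac1q)_k}}\,SS_{GL}(u,q). \]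
   Context: $A(n,q)$ is the group of matrices $x\in GL(n+1,q)$ with $x_{11}=1$ and $x_{j1}=0$ for $j\ge2$, viewed in $GL(n+1,q)$. A matrix is semisimple if it is diagonalizable over the algebraic closure of $\mathbb{F}_q$. $GL(0,q)$ is trivial. $(x)_k=\prod_{j=1}^k(1-x^j)$, $(x)_0=1$. $N(d,q)$ is the number of monic irreducible polynomials of degree $d$ over $\mathbb{F}_q$; $N'(d,q)=N(d,q)$ for $d>1$ and $N'(1,q)=q-2$. *)

theory Defs
  imports "Jordan_Normal_Form.Matrix"
    "HOL-Algebra.Algebraic_Closure_Type"
    "HOL-Computational_Algebra.Computational_Algebra"
begin

text \<open>Matrices are Jordan_Normal_Form matrices, 0-indexed: the paper's entry x_{ij}
  is x $$ (i-1, j-1).\<close>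

definition GL_set :: "'a::{finite,field} itself \<Rightarrow> nat \<Rightarrow> 'a mat set" where
  "GL_set T n = {M \<in> carrier_mat n n. invertible_mat M}"

definition A_set :: "'a::{finite,field} itself \<Rightarrow> nat \<Rightarrow> 'a mat set" where
  "A_set T n = {x \<in> GL_set T (n+1). x $$ (0,0) = 1 \<and> (\<forall>j\<in>{1..n}. x $$ (j,0) = 0)}"

definition semisimple :: "'a::field mat \<Rightarrow> bool" where
  "semisimple M \<longleftrightarrow> (\<exists>D :: 'a alg_closure mat. diagonal_mat D \<and> similar_mat (map_mat to_ac M) D)"

definition ss_A :: "'a::{finite,field} itself \<Rightarrow> nat \<Rightarrow> real" where
  "ss_A T n = real (card {x \<in> A_set T n. semisimple x}) / real (card (A_set T n))"

definition ss_GL :: "'a::{finite,field} itself \<Rightarrow> nat \<Rightarrow> real" where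
  "ss_GL T n = real (card {x \<in> GL_set T n. semisimple x}) / real (card (GL_set T n))"

definition SS_A :: "'a::{finite,field} itself \<Rightarrow> real fps" where
  "SS_A T = Abs_fps (ss_A T)"

definition SS_GL :: "'a::{finite,field} itself \<Rightarrow> real fps" where
  "SS_GL T = Abs_fps (ss_GL T)"

definition qpoch :: "real \<Rightarrow> nat \<Rightarrow> real" where
  "qpoch x k = (\<Prod>j\<in>{1..k}. 1 - x ^ j)"

definition N_irr :: "'a::{finite,field} itself \<Rightarrow> nat \<Rightarrow> nat" where
  "N_irr T d = card {p :: 'a poly. lead_coeff p = 1 \<and> Factorial_Ring.irreducible p \<and> degree p = d}"

definition N' :: "'a::{finite,field} itself \<Rightarrow> nat \<Rightarrow> nat" where
  "N' T d = (if d = 1 then card (UNIV :: 'a set) - 2 else N_irr T d)"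

definition EA :: "real \<Rightarrow> real fps" where
  "EA q = Abs_fps (\<lambda>k. 1 / (q ^ (k^2 + k) * qpoch (1/q) k))"

definition EB :: "real \<Rightarrow> real fps" where
  "EB q = Abs_fps (\<lambda>k. 1 / (q ^ (k^2) * qpoch (1/q) k))"

definition Fd :: "real \<Rightarrow> nat \<Rightarrow> real fps" where
  "Fd q d = Abs_fps (\<lambda>n. if d dvd n then 1 / (q ^ ((n div d)^2 * d) * qpoch (1 / q ^ d) (n div d)) else 0)"

end

theory Submission
  imports Defs "Jordan_Normal_Form.Char_Poly"
begin

text \<open>
  Over a finite field \<open>F\<close> with \<open>q\<close> elements, a matrix is semisimple iff it is annihilated by a product of distinct
  monic irreducible polynomials; both conditions say that it is annihilated by \<open>x\<^bsup>N\<^esup> - x\<close> for some power \<open>N\<close> of the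
  characteristic. If \<open>f\<close> and \<open>g\<close> are coprime and \<open>(fg)(M) = 0\<close>, then \<open>M\<close> is conjugate to a block diagonal matrix
  \<open>diag(A, B)\<close> with \<open>f(A) = 0\<close>, \<open>g(B) = 0\<close>, and the conjugating matrix is unique up to block diagonal matrices. Hence
  the numbers \<open>#{M \<in> Mat\<^sub>n : f(M) = 0} / |GL\<^sub>n|\<close> have generating functions that are multiplicative in \<open>f\<close>.
  For an irreducible \<open>f\<close> of degree \<open>d\<close>, the pairs of a matrix \<open>M\<close> with \<open>f(M) = 0\<close> and a basis of the resulting vector space over
  \<open>F[x]/(f)\<close> correspond to the \<open>F\<close>-bases \<open>M\<^bsup>i\<^esup> v\<^sub>j\<close>, so this number is \<open>1 / |GL(k, q\<^sup>d)|\<close> when \<open>n = k d\<close> and \<open>0\<close> otherwise.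
  A semisimple element of \<open>A(n, q)\<close> is conjugate within \<open>A(n, q)\<close> to \<open>diag(1, B)\<close> with \<open>B\<close> free of the eigenvalue \<open>1\<close>, and
  the same count with \<open>|A(k, q)| = q\<^sup>k |GL(k, q)|\<close> replacing \<open>|GL(k, q)|\<close> changes only the factor of \<open>x - 1\<close>.
\<close>

section \<open>Matrices and polynomials evaluated at matrices\<close>

text \<open>The residue field \<open>F[x]/(f)\<close> is never built: its linear algebra is carried
  by Krylov matrices over the base field, whose column spaces are stable because \<open>M\<close>
  acts on them through copies of the companion matrix of \<open>f\<close>. The polynomial
  \<open>x^N - x\<close> is chosen because its derivative is \<open>-1\<close> when \<open>N\<close>
  is a positive power of the characteristic: it is squarefree over \<open>F\<close> and over the
  closure at once, has the same coefficients in both, and for suitable \<open>N\<close> vanishes on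
  any given finite set of algebraic elements. The projection onto one block is a polynomial in the
  matrix, by a Bezout identity, so its centralizer governs the conjugation count. Two linear
  polynomials are set apart: \<open>x\<close>, since the matrices are invertible, and
  \<open>x - 1\<close>, whose block contains the fixed vector of an element of
  \<open>A(n, q)\<close>; this explains \<open>q - 2\<close>. That block has size
  \<open>k + 1\<close> and contributes \<open>1/|A(k, q)|\<close>. The infinite product is
  approached through the irreducibles of degree at most \<open>m\<close>: a factor of larger degree
  cannot affect a matrix of size at most \<open>m\<close>, so each coefficient becomes
  stationary.\<close>

definition inv_mat :: "'a::field mat \<Rightarrow> 'a mat" where
  "inv_mat A = (SOME B. B \<in> carrier_mat (dim_row A) (dim_row A) \<and>
     A * B = 1\<^sub>m (dim_row A) \<and> B * A = 1\<^sub>m (dim_row A))"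

lemma invertible_matI:
  fixes A B :: "'a::field mat"
  assumes "A \<in> carrier_mat n n" "B \<in> carrier_mat n n" "A * B = 1\<^sub>m n"
  shows "invertible_mat A"
proof -
  have "B * A = 1\<^sub>m n" using mat_mult_left_right_inverse assms by blast
  then show ?thesis using assms unfolding invertible_mat_def inverts_mat_def by auto
qed

lemma inv_mat:
  fixes A :: "'a::field mat"
  assumes A: "A \<in> carrier_mat n n" and inv: "invertible_mat A"
  shows "inv_mat A \<in> carrier_mat n n" "A * inv_mat A = 1\<^sub>m n" "inv_mat A * A = 1\<^sub>m n"
proof -
  obtain B where B: "A * B = 1\<^sub>m n" "B * A = 1\<^sub>m (dim_row B)"
    using A inv unfolding invertible_mat_def inverts_mat_def by auto
  have "dim_col B = n" using B(1) by (metis index_mult_mat(3) index_one_mat(3))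
  moreover have "dim_row B = n" using B(2) A by (metis carrier_matD(2) index_mult_mat(3) index_one_mat(3))
  ultimately have "\<exists>B. B \<in> carrier_mat (dim_row A) (dim_row A) \<and>
     A * B = 1\<^sub>m (dim_row A) \<and> B * A = 1\<^sub>m (dim_row A)" using A B by auto
  from someI_ex[OF this, folded inv_mat_def] A
  show "inv_mat A \<in> carrier_mat n n" "A * inv_mat A = 1\<^sub>m n" "inv_mat A * A = 1\<^sub>m n" by auto
qed

lemma invertible_inv_mat:
  fixes A :: "'a::field mat"
  assumes "A \<in> carrier_mat n n" "invertible_mat A"
  shows "invertible_mat (inv_mat A)"
  using inv_mat[OF assms] assms by (intro invertible_matI[of _ n A])

lemma inv_mat_unique:
  fixes A :: "'a::field mat"
  assumes A: "A \<in> carrier_mat n n" and B: "B \<in> carrier_mat n n" and AB: "A * B = 1\<^sub>m n"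
  shows "inv_mat A = B"
proof -
  note i = inv_mat[OF A invertible_matI[OF A B AB]]
  have "inv_mat A = inv_mat A * (A * B)" using i AB by simp
  also have "\<dots> = inv_mat A * A * B" by (rule assoc_mult_mat[symmetric, OF i(1) A B])
  finally show ?thesis using i B by simp
qed

lemma invertible_mult_mat:
  fixes A B :: "'a::field mat"
  assumes A: "A \<in> carrier_mat n n" "invertible_mat A" and B: "B \<in> carrier_mat n n" "invertible_mat B"
  shows "invertible_mat (A * B)" "inv_mat (A * B) = inv_mat B * inv_mat A"
proof -
  note i = inv_mat[OF A] inv_mat[OF B]
  have "A * B * (inv_mat B * inv_mat A) = A * (B * inv_mat B) * inv_mat A"
    using A B i(1,4) by (simp add: assoc_mult_mat[of _ n n _ n _ n])
  then have *: "A * B * (inv_mat B * inv_mat A) = 1\<^sub>m n" using i A by simp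
  show "invertible_mat (A * B)" by (rule invertible_matI[OF _ _ *]) (use A B i in auto)
  show "inv_mat (A * B) = inv_mat B * inv_mat A"
    by (rule inv_mat_unique[OF _ _ *]) (use A B i in auto)
qed

lemma invertible_mat_if_inj:
  fixes A :: "'a::field mat"
  assumes A: "A \<in> carrier_mat n n"
    and inj: "\<And>v. v \<in> carrier_vec n \<Longrightarrow> A *\<^sub>v v = 0\<^sub>v n \<Longrightarrow> v = 0\<^sub>v n"
  shows "invertible_mat A"
proof -
  have "det A \<noteq> 0" using det_0_iff_vec_prod_zero_field[OF A] inj by blast
  from det_non_zero_imp_unit[OF A this, of n] show ?thesis
    unfolding Units_def by (auto simp: ring_mat_simps intro: invertible_matI[OF A])
qed

lemma mult_mat_cancel_left:
  assumes "P \<in> carrier_mat n n" "Q \<in> carrier_mat n n" "P * Q = 1\<^sub>m n" "Y \<in> carrier_mat n m"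
  shows "P * (Q * Y) = (Y :: 'a::field mat)"
  by (subst assoc_mult_mat[symmetric, of P n n Q n Y m]) (use assms in auto)

lemma mult_mat_vec_cancel:
  assumes "P \<in> carrier_mat n n" "Q \<in> carrier_mat n n" "P * Q = 1\<^sub>m n" "x \<in> carrier_vec n"
  shows "P *\<^sub>v (Q *\<^sub>v x) = (x :: 'a::field vec)"
  by (subst assoc_mult_mat_vec[symmetric, of P n n Q n x]) (use assms in auto)

text \<open>Take \<open>v\<close> together with all unit vectors except the one at an index
  \<open>i\<close> with \<open>v $ i \<noteq> 0\<close>. The lemma serves to split off fixed vectors
  and to show transitivity on nonzero vectors.\<close>

lemma exists_invertible_mat_first_column:
  fixes v :: "'a::field vec"
  assumes v: "v \<in> carrier_vec n" and v0: "v \<noteq> 0\<^sub>v n"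
  obtains Q where "Q \<in> carrier_mat n n" "invertible_mat Q" "Q *\<^sub>v unit_vec n 0 = v"
proof -
  obtain i where i: "i < n" "v $ i \<noteq> 0" using v v0
    by (metis carrier_vecD eq_vecI index_zero_vec(1) index_zero_vec(2))
  then have n: "0 < n" by simp
  \<comment> \<open>\<open>s\<close> is the transposition of \<open>0\<close> and \<open>i\<close>.
    Row \<open>i\<close> of \<open>Q\<close> then has its only nonzero entry in column
    \<open>0\<close>, which gives \<open>x $ 0 = 0\<close>; after that, row \<open>s c\<close> gives
    \<open>x $ c = 0\<close>.\<close>
  define s where "s = (\<lambda>r. if r = 0 then i else if r = i then 0 else r)"
  have s: "s r < n" if "r < n" for r using that i n by (auto simp: s_def)
  define Q where "Q = mat n n (\<lambda>(r,c). if c = 0 then v $ r else if c = s r then 1 else 0)"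
  have Q: "Q \<in> carrier_mat n n" by (simp add: Q_def)
  have Qx: "(Q *\<^sub>v x) $ r = v $ r * x $ 0 + (if s r = 0 then 0 else x $ s r)"
    if x: "x \<in> carrier_vec n" and r: "r < n" for x r
  proof -
    have "(Q *\<^sub>v x) $ r = (\<Sum>c\<in>{0..<n}. (if c = 0 then v $ r else if c = s r then 1 else 0) * x $ c)"
      using x r Q by (simp add: Q_def scalar_prod_def)
    also have "\<dots> = (\<Sum>c\<in>{0..<n}. (if c = 0 then v $ r * x $ 0 else 0) +
        (if c = s r then if s r = 0 then 0 else x $ s r else 0))"
      by (rule sum.cong) auto
    also have "\<dots> = v $ r * x $ 0 + (if s r = 0 then 0 else x $ s r)"
      using n s[OF r] by (subst sum.distrib) (simp add: sum.delta)
    finally show ?thesis .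
  qed
  have "invertible_mat Q"
  proof (rule invertible_mat_if_inj[OF Q])
    fix x assume x: "x \<in> carrier_vec n" and 0: "Q *\<^sub>v x = 0\<^sub>v n"
    have "v $ i * x $ 0 = 0" using Qx[OF x, of i] 0 i by (cases "i = 0") (simp_all add: s_def)
    then have x0: "x $ 0 = 0" using i by simp
    have "x $ c = 0" if "c < n" for c
    proof (cases "c = 0")
      case False
      have "s (s c) = c" by (auto simp: s_def)
      then show ?thesis using Qx[OF x s[OF that]] 0 s[OF that] x0 False by auto
    qed (simp add: x0)
    then show "x = 0\<^sub>v n" using x by auto
  qed
  moreover have "Q *\<^sub>v unit_vec n 0 = v"
  proof (rule eq_vecI)
    fix r assume "r < dim_vec v"
    then have r: "r < n" using v by simp
    show "(Q *\<^sub>v unit_vec n 0) $ r = v $ r"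
      using Qx[OF unit_vec_carrier r] n s[OF r] by simp
  qed (use v Q in auto)
  ultimately show ?thesis using that Q by blast
qed

text \<open>This is Horner's scheme. The fold starts from a zero matrix of the size of
  \<open>A\<close>, since the type does not carry the size.\<close>

definition poly_mat :: "'a::comm_ring_1 poly \<Rightarrow> 'a mat \<Rightarrow> 'a mat" where
  "poly_mat p A = fold_coeffs (\<lambda>a B. a \<cdot>\<^sub>m 1\<^sub>m (dim_row A) + A * B) p (0\<^sub>m (dim_row A) (dim_row A))"

lemma poly_mat_0 [simp]: "poly_mat 0 A = 0\<^sub>m (dim_row A) (dim_row A)"
  by (simp add: poly_mat_def)

lemma poly_mat_pCons:
  assumes "A \<in> carrier_mat n n"
  shows "poly_mat (pCons a p) A = a \<cdot>\<^sub>m 1\<^sub>m n + A * poly_mat p A"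
proof (cases "p = 0")
  case True
  show ?thesis
  proof (cases "a = 0")
    case False
    with True show ?thesis using assms
      by (simp add: poly_mat_def fold_coeffs_pCons_coeff_not_0_eq)
  qed (use True assms in auto)
next
  case False
  then show ?thesis using assms by (simp add: poly_mat_def fold_coeffs_pCons_not_0_0_eq)
qed

lemma poly_mat_carrier [simp, intro]:
  assumes "A \<in> carrier_mat n n" shows "poly_mat p A \<in> carrier_mat n n"
  using assms by (induction p) (auto simp: poly_mat_pCons)

lemma poly_mat_dim [simp]:
  "A \<in> carrier_mat n n \<Longrightarrow> dim_row (poly_mat p A) = n" "A \<in> carrier_mat n n \<Longrightarrow> dim_col (poly_mat p A) = n"
  using poly_mat_carrier by blast+

lemma poly_mat_const: "A \<in> carrier_mat n n \<Longrightarrow> poly_mat [:a:] A = a \<cdot>\<^sub>m 1\<^sub>m n"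
  by (auto simp: poly_mat_pCons)

lemma poly_mat_1 [simp]: "A \<in> carrier_mat n n \<Longrightarrow> poly_mat 1 A = 1\<^sub>m n"
  by (auto simp: one_pCons poly_mat_const)

lemma poly_mat_X [simp]: "A \<in> carrier_mat n n \<Longrightarrow> poly_mat [:0, 1:] A = A"
  by (auto simp: poly_mat_pCons)

lemma poly_mat_add:
  assumes A: "A \<in> carrier_mat n n"
  shows "poly_mat (p + q) A = poly_mat p A + poly_mat q A"
proof (induction p q rule: poly_induct2)
  case 0 show ?case using A by auto
next
  case (pCons a p b q)
  note c = A poly_mat_carrier[OF A]
  have "A * (poly_mat p A + poly_mat q A) = A * poly_mat p A + A * poly_mat q A"
    by (rule mult_add_distrib_mat) (rule c)+
  then show ?case using pCons c mult_carrier_mat[OF A c(2)]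
    by (intro eq_matI) (auto simp: poly_mat_pCons[OF A] algebra_simps)
qed

lemma poly_mat_smult:
  assumes A: "A \<in> carrier_mat n n"
  shows "poly_mat (smult c p) A = c \<cdot>\<^sub>m poly_mat p A"
proof (induction p)
  case 0 show ?case using A by auto
next
  case (pCons a p)
  have "A * (c \<cdot>\<^sub>m poly_mat p A) = c \<cdot>\<^sub>m (A * poly_mat p A)"
    by (rule mult_smult_distrib[OF A poly_mat_carrier[OF A]])
  then show ?case using pCons A mult_carrier_mat[OF A poly_mat_carrier[OF A]]
    by (intro eq_matI) (auto simp: poly_mat_pCons[OF A] algebra_simps)
qed

lemma poly_mat_diff:
  assumes A: "A \<in> carrier_mat n n"
  shows "poly_mat (p - q) A = poly_mat p A - poly_mat q A"
proof -
  have "p - q = p + smult (-1) q" by simp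
  then have "poly_mat (p - q) A = poly_mat p A + (-1) \<cdot>\<^sub>m poly_mat q A"
    by (simp only: poly_mat_add[OF A] poly_mat_smult[OF A])
  then show ?thesis using A poly_mat_carrier[OF A] by (intro eq_matI) auto
qed

lemma poly_mat_mult:
  assumes A: "A \<in> carrier_mat n n"
  shows "poly_mat (p * q) A = poly_mat p A * poly_mat q A"
proof (induction p)
  case 0 show ?case using A by auto
next
  case (pCons a p)
  note c = poly_mat_carrier[OF A]
  have z: "0 \<cdot>\<^sub>m 1\<^sub>m n + B = B" if "B \<in> carrier_mat n n" for B :: "'a mat"
    using that by (intro eq_matI) auto
  have "poly_mat (pCons a p * q) A = a \<cdot>\<^sub>m poly_mat q A + A * (poly_mat p A * poly_mat q A)"
    using pCons A c mult_carrier_mat[OF A c]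
    by (simp add: poly_mat_add[OF A] poly_mat_smult[OF A] poly_mat_pCons[OF A] mult_pCons_left
        z[OF mult_carrier_mat[OF A mult_carrier_mat[OF c c]]])
  moreover have "(a \<cdot>\<^sub>m 1\<^sub>m n + A * poly_mat p A) * poly_mat q A
      = a \<cdot>\<^sub>m 1\<^sub>m n * poly_mat q A + A * poly_mat p A * poly_mat q A"
    using A c by (intro add_mult_distrib_mat[of _ n n _ _ n]) auto
  moreover have "a \<cdot>\<^sub>m 1\<^sub>m n * poly_mat q A = a \<cdot>\<^sub>m poly_mat q A"
    using mult_smult_assoc_mat[OF one_carrier_mat c, of a] A by simp
  ultimately show ?case using A c
    by (simp add: poly_mat_pCons[OF A] assoc_mult_mat[OF A c c])
qed

text \<open>The relation \<open>A * Z = Z * B\<close> passes to powers and sums. \<open>Z\<close>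
  may be rectangular, as is needed for a Krylov matrix with fewer columns than rows; an invertible
  \<open>Z\<close> gives compatibility with conjugation.\<close>

lemma poly_mat_intertwine:
  assumes A: "A \<in> carrier_mat n n" and B: "B \<in> carrier_mat m m" and Z: "Z \<in> carrier_mat n m"
    and AZ: "A * Z = Z * B"
  shows "poly_mat p A * Z = Z * poly_mat p B"
proof (induction p)
  case 0 show ?case using assms by auto
next
  case (pCons a p)
  note c = poly_mat_carrier[OF A] poly_mat_carrier[OF B]
  have "poly_mat (pCons a p) A * Z = a \<cdot>\<^sub>m 1\<^sub>m n * Z + A * poly_mat p A * Z"
    using A Z c by (simp add: poly_mat_pCons[OF A] add_mult_distrib_mat[of _ n n _ _ m])
  also have "A * poly_mat p A * Z = A * (Z * poly_mat p B)"
    using assoc_mult_mat[OF A c(1) Z] pCons by simp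
  also have "\<dots> = Z * (B * poly_mat p B)"
    using assoc_mult_mat[OF A Z c(2)] assoc_mult_mat[OF Z B c(2)] AZ by simp
  also have "a \<cdot>\<^sub>m 1\<^sub>m n * Z = Z * (a \<cdot>\<^sub>m 1\<^sub>m m)"
    using mult_smult_assoc_mat[OF one_carrier_mat Z, of a] mult_smult_distrib[OF Z one_carrier_mat, of a] Z
    by simp
  also have "Z * (a \<cdot>\<^sub>m 1\<^sub>m m) + Z * (B * poly_mat p B) = Z * poly_mat (pCons a p) B"
    using Z B c by (simp add: poly_mat_pCons[OF B] mult_add_distrib_mat[of _ n m _ m])
  finally show ?case .
qed

lemma poly_mat_conj:
  fixes B :: "'a::field mat"
  assumes B: "B \<in> carrier_mat n n" and P: "P \<in> carrier_mat n n" and Q: "Q \<in> carrier_mat n n"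
    and PQ: "Q * P = 1\<^sub>m n"
  shows "poly_mat p (P * B * Q) = P * poly_mat p B * Q"
proof -
  have PQ': "P * Q = 1\<^sub>m n" using mat_mult_left_right_inverse[OF Q P PQ] .
  have A: "P * B * Q \<in> carrier_mat n n" using assms by auto
  have "P * B * Q * P = P * B * (Q * P)"
    using B P Q by (simp add: assoc_mult_mat[of _ n n _ n _ n])
  then have "P * B * Q * P = P * B" using B P PQ by simp
  from poly_mat_intertwine[OF A B P this, of p]
  have "poly_mat p (P * B * Q) * P * Q = P * poly_mat p B * Q" by simp
  moreover have "poly_mat p (P * B * Q) * P * Q = poly_mat p (P * B * Q)"
    using A P Q PQ' poly_mat_carrier[OF A, of p] by (simp add: assoc_mult_mat[of _ n n _ n _ n])
  ultimately show ?thesis by simp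
qed

section \<open>Block diagonal matrices\<close>

abbreviation diag2 :: "'a::zero mat \<Rightarrow> 'a mat \<Rightarrow> 'a mat" where
  "diag2 A B \<equiv> four_block_mat A (0\<^sub>m (dim_row A) (dim_col B)) (0\<^sub>m (dim_row B) (dim_col A)) B"

lemma diag2_mult:
  assumes "A \<in> carrier_mat k k" "A' \<in> carrier_mat k k" "B \<in> carrier_mat m m" "B' \<in> carrier_mat m m"
  shows "diag2 A B * diag2 A' B' = diag2 (A * A') (B * (B' :: 'a::comm_ring_1 mat))"
  using assms by (subst mult_four_block_mat[of _ k k _ m _ m _ _ k _ m]) (auto intro!: cong_four_block_mat)

lemma poly_mat_diag2:
  assumes A: "A \<in> carrier_mat k k" and B: "B \<in> carrier_mat m m"
  shows "poly_mat p (diag2 A B) = diag2 (poly_mat p A) (poly_mat p B)"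
proof (induction p)
  case 0 show ?case using A B by auto
next
  case (pCons a p)
  note c = poly_mat_carrier[OF A, of p] poly_mat_carrier[OF B, of p]
  have D: "diag2 A B \<in> carrier_mat (k + m) (k + m)" using A B by auto
  have "diag2 A B * poly_mat p (diag2 A B) = diag2 (A * poly_mat p A) (B * poly_mat p B)"
    unfolding pCons by (rule diag2_mult[OF A c(1) B c(2)])
  then show ?case using A B c
    unfolding poly_mat_pCons[OF D] poly_mat_pCons[OF A] poly_mat_pCons[OF B]
    by (intro eq_matI) auto
qed

section \<open>Splitting along coprime factors\<close>

lemma four_block_mat_inject:
  assumes eq: "four_block_mat A B C D = four_block_mat A' B' C' D'"
    and c: "A \<in> carrier_mat k l" "B \<in> carrier_mat k m" "C \<in> carrier_mat r l" "D \<in> carrier_mat r m"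
    and c': "A' \<in> carrier_mat k l" "B' \<in> carrier_mat k m" "C' \<in> carrier_mat r l" "D' \<in> carrier_mat r m"
  shows "A = A'" "B = B'" "C = C'" "D = D'"
proof -
  have e: "four_block_mat A B C D $$ (i, j) = four_block_mat A' B' C' D' $$ (i, j)" for i j
    using eq by simp
  show "A = A'" "B = B'" "C = C'" "D = D'"
  proof (rule_tac [!] eq_matI)
    fix i j assume "i < dim_row A'" "j < dim_col A'"
    then show "A $$ (i, j) = A' $$ (i, j)" using e[of i j] c c' by simp
  next
    fix i j assume "i < dim_row B'" "j < dim_col B'"
    then show "B $$ (i, j) = B' $$ (i, j)" using e[of i "l + j"] c c' by simp
  next
    fix i j assume "i < dim_row C'" "j < dim_col C'"
    then show "C $$ (i, j) = C' $$ (i, j)" using e[of "k + i" j] c c' by simp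
  next
    fix i j assume "i < dim_row D'" "j < dim_col D'"
    then show "D $$ (i, j) = D' $$ (i, j)" using e[of "k + i" "l + j"] c c' by simp
  qed (use c c' in auto)
qed

lemma exists_four_block_mat:
  assumes "M \<in> carrier_mat (k + m) (k + m)"
  obtains A B C D where "A \<in> carrier_mat k k" "B \<in> carrier_mat k m" "C \<in> carrier_mat m k"
    "D \<in> carrier_mat m m" "M = four_block_mat A B C D"
proof -
  obtain A B C D where s: "split_block M k k = (A, B, C, D)" by (metis prod_cases4)
  show ?thesis by (rule that) (use split_block[OF s, of m m] assms in auto)
qed

text \<open>Multiplying by the projection on the right erases the right block column of
  \<open>N\<close>, on the left the lower block row. Equality of the two products therefore kills
  both off-diagonal blocks.\<close>

lemma commute_projection_imp_diag2:
  fixes N :: "'a::field mat"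
  assumes N: "N \<in> carrier_mat (k + m) (k + m)"
    and comm: "N * diag2 (1\<^sub>m k) (0\<^sub>m m m) = diag2 (1\<^sub>m k) (0\<^sub>m m m) * N"
  obtains A B where "A \<in> carrier_mat k k" "B \<in> carrier_mat m m" "N = diag2 A B"
proof -
  obtain A B C D where c: "A \<in> carrier_mat k k" "B \<in> carrier_mat k m" "C \<in> carrier_mat m k"
    "D \<in> carrier_mat m m" and Neq: "N = four_block_mat A B C D"
    using exists_four_block_mat[OF N] by blast
  have "N * diag2 (1\<^sub>m k) (0\<^sub>m m m) = four_block_mat A (0\<^sub>m k m) C (0\<^sub>m m m)"
    unfolding Neq using c by (subst mult_four_block_mat[of _ k k _ m _ m _ _ k _ m]) auto
  moreover have "diag2 (1\<^sub>m k) (0\<^sub>m m m) * N = four_block_mat A B (0\<^sub>m m k) (0\<^sub>m m m)"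
    unfolding Neq using c by (subst mult_four_block_mat[of _ k k _ m _ m _ _ k _ m]) auto
  ultimately have "four_block_mat A (0\<^sub>m k m) C (0\<^sub>m m m) = four_block_mat A B (0\<^sub>m m k) (0\<^sub>m m m)"
    using comm by simp
  note i = four_block_mat_inject[OF this c(1) _ c(3) _ c(1) c(2)]
  have "B = 0\<^sub>m k m" "C = 0\<^sub>m m k" using i(2,3) by auto
  then show ?thesis using that[OF c(1,4)] Neq c by simp
qed

lemma mult_mat_unit_vec:
  "A \<in> carrier_mat r n \<Longrightarrow> j < n \<Longrightarrow> A *\<^sub>v unit_vec n j = col (A :: 'a::field mat) j"
  by (intro eq_vecI) auto

lemma similar_mat_conj:
  assumes "P \<in> carrier_mat n n" "Q \<in> carrier_mat n n" "P * Q = 1\<^sub>m n" "(M::'a::field mat) \<in> carrier_mat n n"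
  shows "similar_mat M (Q * M * P)"
proof (rule similar_matI[of _ _ P Q n])
  show "Q * P = 1\<^sub>m n" using mat_mult_left_right_inverse assms by blast
  have "P * (Q * M * P) * Q = P * (Q * (M * (P * Q)))"
    using assms(1,2,4) by (simp add: assoc_mult_mat[of _ n n _ n _ n])
  then show "M = P * (Q * M * P) * Q" using assms by (simp add: mult_mat_cancel_left)
qed (use assms in auto)

text \<open>Induction on the size: a nonzero column of \<open>E\<close> is a fixed vector of
  \<open>E\<close>. Moving it to the first unit vector leaves a row \<open>R\<close> and a smaller
  idempotent \<open>E'\<close>, and a shear removes \<open>R\<close>.\<close>

lemma idempotent_mat_similar:
  fixes E :: "'a::field mat"
  assumes "E \<in> carrier_mat n n" "E * E = E"
  shows "\<exists>k m. n = k + m \<and> similar_mat E (diag2 (1\<^sub>m k) (0\<^sub>m m m))"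
  using assms
proof (induction n arbitrary: E)
  case 0
  then have "E = diag2 (1\<^sub>m 0) (0\<^sub>m 0 0)" by (intro eq_matI) auto
  then show ?case using similar_mat_refl[of E 0] 0 by auto
next
  case (Suc n)
  show ?case
  proof (cases "E = 0\<^sub>m (Suc n) (Suc n)")
    case True
    then have "E = diag2 (1\<^sub>m 0) (0\<^sub>m (Suc n) (Suc n))" by (intro eq_matI) auto
    then show ?thesis using similar_mat_refl[OF Suc.prems(1)]
      by (intro exI[of _ 0] exI[of _ "Suc n"]) auto
  next
    case False
    then obtain i j where ij: "i < Suc n" "j < Suc n" "E $$ (i, j) \<noteq> 0"
      using Suc.prems(1) by (metis carrier_matD(1,2) eq_matI index_zero_mat)
    define v where "v = col E j"
    have v: "v \<in> carrier_vec (Suc n)" using Suc.prems ij by (auto simp: v_def)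
    have "v $ i \<noteq> 0" using ij Suc.prems by (simp add: v_def)
    then have v0: "v \<noteq> 0\<^sub>v (Suc n)" using ij by auto
    \<comment> \<open>\<open>v\<close> is a column of \<open>E\<close>, so this is one column of
      \<open>E * E = E\<close>.\<close>
    have Ev: "E *\<^sub>v v = v" using col_mult2[of E "Suc n" "Suc n" E "Suc n" j] Suc.prems ij
      by (simp add: v_def)
    obtain P where P: "P \<in> carrier_mat (Suc n) (Suc n)" "invertible_mat P" "P *\<^sub>v unit_vec (Suc n) 0 = v"
      using exists_invertible_mat_first_column[OF v v0] by blast
    define Q where "Q = inv_mat P"
    note Q = inv_mat[OF P(1,2), folded Q_def]
    define F where "F = Q * E * P"
    have F: "F \<in> carrier_mat (Suc n) (Suc n)" using P Q Suc.prems by (auto simp: F_def)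
    have simEF: "similar_mat E F" unfolding F_def using P Q Suc.prems by (intro similar_mat_conj)
    have "F * F = Q * (E * ((P * Q) * (E * P)))"
      unfolding F_def using P(1) Q(1) Suc.prems(1)
      by (simp add: assoc_mult_mat[of _ "Suc n" "Suc n" _ "Suc n" _ "Suc n"])
    also have "\<dots> = Q * (E * E * P)"
      using P(1) Q Suc.prems(1) by (simp add: assoc_mult_mat[of _ "Suc n" "Suc n" _ "Suc n" _ "Suc n"])
    also have "\<dots> = F" using P(1) Q(1) Suc.prems
      by (simp add: F_def assoc_mult_mat[of _ "Suc n" "Suc n" _ "Suc n" _ "Suc n"])
    finally have FF: "F * F = F" .
    have "F *\<^sub>v unit_vec (Suc n) 0 = Q *\<^sub>v (E *\<^sub>v (P *\<^sub>v unit_vec (Suc n) 0))"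
      unfolding F_def using P(1) Q(1) Suc.prems(1)
      by (simp add: assoc_mult_mat_vec[of _ "Suc n" "Suc n" _ "Suc n"])
    also have "\<dots> = Q *\<^sub>v (P *\<^sub>v unit_vec (Suc n) 0)" using Ev P by simp
    also have "\<dots> = unit_vec (Suc n) 0" using P Q by (intro mult_mat_vec_cancel) auto
    finally have Fe: "col F 0 = unit_vec (Suc n) 0" using F by (simp add: mult_mat_unit_vec[of F "Suc n"])
    obtain A R C E' where c: "A \<in> carrier_mat 1 1" "R \<in> carrier_mat 1 n" "C \<in> carrier_mat n 1"
      "E' \<in> carrier_mat n n" and Feq: "F = four_block_mat A R C E'"
      using exists_four_block_mat[of F 1 n] F unfolding plus_1_eq_Suc by blast
    have F0: "F $$ (i, 0) = (if i = 0 then 1 else 0)" if "i < Suc n" for i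
      using arg_cong[OF Fe, of "\<lambda>w. vec_index w i"] F that by simp
    have A: "A = 1\<^sub>m 1" using F0[of 0] c by (intro eq_matI) (auto simp: Feq)
    have C: "C = 0\<^sub>m n 1"
    proof (rule eq_matI)
      fix i j assume "i < dim_row (0\<^sub>m n 1 :: 'a mat)" "j < dim_col (0\<^sub>m n 1 :: 'a mat)"
      then show "C $$ (i, j) = 0\<^sub>m n 1 $$ (i, j)" using F0[of "Suc i"] c by (auto simp: Feq)
    qed (use c in auto)
    have "F * F = four_block_mat (1\<^sub>m 1) (R + R * E') (0\<^sub>m n 1) (E' * E')"
      unfolding Feq A C using c
      by (subst mult_four_block_mat[of _ 1 1 _ n _ n _ _ 1 _ n]) auto
    with FF have "four_block_mat (1\<^sub>m 1) (R + R * E') (0\<^sub>m n 1) (E' * E') = four_block_mat (1\<^sub>m 1) R (0\<^sub>m n 1) E'"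
      unfolding Feq A C by simp
    note inj = four_block_mat_inject[OF this, of 1 1 n n]
    have EE: "E' * E' = E'" and RE': "R + R * E' = R" using inj c by auto
    \<comment> \<open>The upper right block of \<open>F * F = F\<close> reads
      \<open>R + R * E' = R\<close>; this is what allows a shear by \<open>R\<close> itself to clear
      the row.\<close>
    have RE: "R * E' = 0\<^sub>m 1 n"
    proof (rule eq_matI)
      fix i j assume *: "i < dim_row (0\<^sub>m 1 n :: 'a mat)" "j < dim_col (0\<^sub>m 1 n :: 'a mat)"
      have "(R + R * E') $$ (i, j) = R $$ (i, j)" using RE' by simp
      then show "(R * E') $$ (i, j) = 0\<^sub>m 1 n $$ (i, j)" using * c by auto
    qed (use c in auto)
    \<comment> \<open>\<open>?P\<close> and \<open>?Q\<close> are inverse shears. Since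
      \<open>R * E' = 0\<close>, \<open>?P\<close> leaves \<open>?D\<close> unchanged from the left,
      while \<open>?Q\<close> restores the row \<open>R\<close> from the right.\<close>
    let ?P = "four_block_mat (1\<^sub>m 1) (- R) (0\<^sub>m n 1) (1\<^sub>m n)"
    let ?Q = "four_block_mat (1\<^sub>m 1) R (0\<^sub>m n 1) (1\<^sub>m n)"
    let ?D = "four_block_mat (1\<^sub>m 1) (0\<^sub>m 1 n) (0\<^sub>m n 1) E'"
    have nR: "- R \<in> carrier_mat 1 n" using c by simp
    have RR: "R + - R = 0\<^sub>m 1 n" "- R + R = 0\<^sub>m 1 n" "- 0\<^sub>m n n = (0\<^sub>m n n :: 'a mat)" using c by (auto intro!: eq_matI)
    have nRE: "- R * E' = 0\<^sub>m 1 n" using uminus_mult_left_mat[of R E'] RE c by auto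
    have s1: "similar_mat F ?D"
    proof (rule similar_matI[of _ _ ?P ?Q "1 + n"])
      show "?P * ?Q = 1\<^sub>m (1 + n)" unfolding four_block_one_mat[symmetric] using c nR RR
        by (subst mult_four_block_mat[of _ 1 1 _ n _ n _ _ 1 _ n]) auto
      show "?Q * ?P = 1\<^sub>m (1 + n)" unfolding four_block_one_mat[symmetric] using c nR RR
        by (subst mult_four_block_mat[of _ 1 1 _ n _ n _ _ 1 _ n]) auto
      have "?P * ?D = ?D" using c nR nRE
        by (subst mult_four_block_mat[of _ 1 1 _ n _ n _ _ 1 _ n]) auto
      moreover have "?D * ?Q = F" unfolding Feq A C using c
        by (subst mult_four_block_mat[of _ 1 1 _ n _ n _ _ 1 _ n]) auto
      ultimately show "F = ?P * ?D * ?Q" by simp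
    qed (use c F in auto)
    obtain k m where n: "n = k + m" and sim': "similar_mat E' (diag2 (1\<^sub>m k) (0\<^sub>m m m))"
      using Suc.IH[OF c(4) EE] by blast
    have s2: "similar_mat ?D (four_block_mat (1\<^sub>m 1) (0\<^sub>m 1 n) (0\<^sub>m n 1) (diag2 (1\<^sub>m k) (0\<^sub>m m m)))"
      by (rule similar_mat_four_block_0_0[OF similar_mat_refl[OF one_carrier_mat] sim' one_carrier_mat c(4)])
    have "four_block_mat (1\<^sub>m 1) (0\<^sub>m 1 n) (0\<^sub>m n 1) (diag2 (1\<^sub>m k) (0\<^sub>m m m))
        = diag2 (1\<^sub>m (Suc k)) (0\<^sub>m m m :: 'a mat)"
      unfolding n by (intro eq_matI) auto
    then have "similar_mat E (diag2 (1\<^sub>m (Suc k)) (0\<^sub>m m m))"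
      using similar_mat_trans[OF simEF similar_mat_trans[OF s1 s2]] by simp
    then show ?thesis using n by (intro exI[of _ "Suc k"] exI[of _ m]) auto
  qed
qed

text \<open>By the Bezout identity, \<open>b * g\<close> is \<open>1\<close> modulo \<open>f\<close>
  and \<open>0\<close> modulo \<open>g\<close>, hence idempotent modulo \<open>f * g\<close>. Its
  value at \<open>M\<close> is the projection onto the kernel of \<open>f(M)\<close> along that of
  \<open>g(M)\<close>; diagonalizing it splits every matrix that commutes with it, in particular
  \<open>M\<close>.\<close>

lemma coprime_block_decomposition:
  fixes M :: "'a::field mat"
  assumes M: "M \<in> carrier_mat n n" and bez: "a * f + b * g = 1"
    and ann: "poly_mat (f * g) M = 0\<^sub>m n n"
  obtains k m A B where "n = k + m" "A \<in> carrier_mat k k" "B \<in> carrier_mat m m"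
    "poly_mat f A = 0\<^sub>m k k" "poly_mat g B = 0\<^sub>m m m" "similar_mat M (diag2 A B)"
proof -
  define e where "e = b * g"
  define E where "E = poly_mat e M"
  have E: "E \<in> carrier_mat n n" using M by (auto simp: E_def)
  have ann': "poly_mat (c * (f * g)) M = 0\<^sub>m n n" for c
    using poly_mat_mult[OF M, of c] poly_mat_carrier[OF M, of c] by (simp add: ann)
  have "e * e = e - (a * b) * (f * g)"
    using arg_cong[OF bez, of "\<lambda>x. b * g * x"] by (simp add: e_def algebra_simps)
  then have "E * E = E" unfolding E_def
    using poly_mat_carrier[OF M, of e]
    by (auto simp: poly_mat_mult[OF M, symmetric] poly_mat_diff[OF M] ann' intro!: eq_matI)
  from idempotent_mat_similar[OF E this] obtain k m where n: "n = k + m"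
    and sim: "similar_mat E (diag2 (1\<^sub>m k) (0\<^sub>m m m))" by blast
  define J :: "'a mat" where "J = diag2 (1\<^sub>m k) (0\<^sub>m m m)"
  obtain P Q where PQ: "P \<in> carrier_mat n n" "Q \<in> carrier_mat n n" "P * Q = 1\<^sub>m n" "Q * P = 1\<^sub>m n"
    and EP: "E = P * J * Q" using similar_matD[OF sim, folded J_def] E by fastforce
  have J: "J \<in> carrier_mat n n" using n by (auto simp: J_def)
  define N where "N = Q * M * P"
  have N: "N \<in> carrier_mat n n" using PQ M by (auto simp: N_def)
  have polyN: "poly_mat p N = Q * poly_mat p M * P" for p
    unfolding N_def using PQ M by (intro poly_mat_conj)
  have eN: "poly_mat e N = J"
  proof -
    have "poly_mat e N = Q * (P * (J * (Q * P)))"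
      using PQ(1,2) J unfolding polyN E_def[symmetric] EP
      by (simp add: assoc_mult_mat[of _ n n _ n _ n])
    then show ?thesis using PQ J mult_mat_cancel_left[OF PQ(2,1,4) J] by simp
  qed
  \<comment> \<open>\<open>J\<close> is a polynomial in \<open>N\<close>, so commutation is
    commutativity of polynomial multiplication.\<close>
  have "N * J = poly_mat ([:0, 1:] * e) N"
    unfolding poly_mat_mult[OF N] eN poly_mat_X[OF N] ..
  also have "\<dots> = poly_mat (e * [:0, 1:]) N" by (simp only: mult.commute)
  also have "\<dots> = J * N" using N unfolding poly_mat_mult[OF N] eN poly_mat_X[OF N] by simp
  finally have "N * J = J * N" .
  then obtain A B where AB: "A \<in> carrier_mat k k" "B \<in> carrier_mat m m" "N = diag2 A B"
    using commute_projection_imp_diag2 N n unfolding J_def by metis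
  \<comment> \<open>Both \<open>f * e\<close> and \<open>g * (1 - e)\<close> are multiples of
    \<open>f * g\<close>, so they vanish at \<open>N\<close>. There \<open>J\<close> isolates the
    block \<open>f(A)\<close> of \<open>f(N)\<close>, and \<open>1 - J\<close> isolates the block
    \<open>g(B)\<close> of \<open>g(N)\<close>.\<close>
  have annN: "poly_mat (c * (f * g)) N = 0\<^sub>m n n" for c
    unfolding polyN ann' using PQ by simp
  note cf = poly_mat_carrier[OF AB(1), of f] poly_mat_carrier[OF AB(2), of f]
  note cg = poly_mat_carrier[OF AB(1), of g] poly_mat_carrier[OF AB(2), of g]
  have "0\<^sub>m n n = poly_mat (f * e) N" using annN[of b] by (simp add: e_def mult.left_commute)
  also have "\<dots> = diag2 (poly_mat f A) (poly_mat f B) * J"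
    unfolding poly_mat_mult[OF N, of f] eN unfolding AB(3) poly_mat_diag2[OF AB(1,2)] ..
  also have "\<dots> = diag2 (poly_mat f A) (0\<^sub>m m m)"
    unfolding J_def using cf by (subst diag2_mult[of _ k _ _ m]) auto
  finally have "diag2 (poly_mat f A) (0\<^sub>m m m) = diag2 (0\<^sub>m k k) (0\<^sub>m m m)"
    using n by simp
  then have 1: "poly_mat f A = 0\<^sub>m k k"
    by (rule four_block_mat_inject(1)[of _ _ _ _ _ _ _ _ k k m m]) (use cf in auto)
  have "g * (1 - e) = a * (f * g)" using arg_cong[OF bez, of "\<lambda>x. g * x"] by (simp add: e_def algebra_simps)
  then have "0\<^sub>m n n = poly_mat (g * (1 - e)) N" using annN[of a] by (simp only:)
  also have "\<dots> = diag2 (poly_mat g A) (poly_mat g B) * (1\<^sub>m n - J)"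
    unfolding poly_mat_mult[OF N, of g] poly_mat_diff[OF N] eN poly_mat_1[OF N]
    unfolding AB(3) poly_mat_diag2[OF AB(1,2)] ..
  also have "1\<^sub>m n - J = diag2 (0\<^sub>m k k) (1\<^sub>m m)" unfolding n J_def by (intro eq_matI) auto
  also have "diag2 (poly_mat g A) (poly_mat g B) * diag2 (0\<^sub>m k k) (1\<^sub>m m) = diag2 (0\<^sub>m k k) (poly_mat g B)"
    using cg by (subst diag2_mult[of _ k _ _ m]) auto
  finally have "diag2 (0\<^sub>m k k) (poly_mat g B) = diag2 (0\<^sub>m k k) (0\<^sub>m m m)"
    using n by simp
  then have 2: "poly_mat g B = 0\<^sub>m m m"
    by (rule four_block_mat_inject(4)[of _ _ _ _ _ _ _ _ k k m m]) (use cg in auto)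
  have "similar_mat M N" unfolding N_def using PQ M by (intro similar_mat_conj)
  then show ?thesis using that[OF n AB(1,2) 1 2] AB(3) by simp
qed

section \<open>Matrices annihilated by an irreducible polynomial\<close>

text \<open>A nonzero element \<open>r\<close> of least degree in the ideal generated by
  \<open>f\<close> and \<open>g\<close> divides both of them. As \<open>f\<close> does not divide
  \<open>g\<close>, it does not divide \<open>r\<close>, so irreducibility of \<open>f\<close> makes
  \<open>r\<close> a unit.\<close>

lemma irreducible_poly_bezout:
  fixes f g :: "'a::field poly"
  assumes irr: "Factorial_Ring.irreducible f" and ndvd: "\<not> f dvd g"
  obtains a b where "a * f + b * g = 1"
proof -
  define I where "I = {h. \<exists>a b. h = a * f + b * g}"
  have f0: "f \<noteq> 0" using irr by (simp add: comm_semiring_1_class.irreducible_def)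
  have fI: "f \<in> I" unfolding I_def by (rule CollectI, rule exI[of _ 1], rule exI[of _ 0]) simp
  have gI: "g \<in> I" unfolding I_def by (rule CollectI, rule exI[of _ 0], rule exI[of _ 1]) simp
  obtain r where r: "r \<in> I" "r \<noteq> 0" and min: "\<And>s. s \<in> I \<Longrightarrow> s \<noteq> 0 \<Longrightarrow> degree r \<le> degree s"
    using ex_has_least_nat[of "\<lambda>r. r \<in> I \<and> r \<noteq> 0" f degree] fI f0 by auto
  have rdvd: "r dvd s" if sI: "s \<in> I" for s
  proof (rule ccontr)
    assume nd: "\<not> r dvd s"
    then have m0: "s mod r \<noteq> 0" by (simp add: mod_eq_0_iff_dvd)
    obtain a b a' b' where ab: "s = a * f + b * g" "r = a' * f + b' * g"
      using sI r(1) unfolding I_def by blast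
    define t where "t = s div r"
    have "s mod r = s - t * r" unfolding t_def by (rule minus_div_mult_eq_mod[symmetric])
    also have "\<dots> = (a * f + b * g) - t * (a' * f + b' * g)" by (simp only: ab(1) ab(2)[symmetric])
    also have "\<dots> = (a - t * a') * f + (b - t * b') * g" by (simp add: algebra_simps)
    finally have eq: "s mod r = (a - t * a') * f + (b - t * b') * g" .
    have "s mod r \<in> I" unfolding I_def
      by (rule CollectI, rule exI[of _ "a - t * a'"], rule exI[of _ "b - t * b'"], rule eq)
    with min m0 have "degree r \<le> degree (s mod r)" by blast
    then show False using degree_mod_less[OF r(2), of s] m0 by simp
  qed
  have "\<not> f dvd r" using rdvd[OF gI] ndvd dvd_trans[of f r g] by auto
  then have "is_unit r" using irreducibleD'[OF irr rdvd[OF fI]] by simp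
  then obtain s where s: "1 = r * s" by (rule dvdE)
  obtain a b where r_eq: "r = a * f + b * g" using r(1) unfolding I_def by blast
  have "(s * a) * f + (s * b) * g = r * s" unfolding r_eq by (simp add: algebra_simps)
  also have "\<dots> = 1" using s by (rule sym)
  finally have "(s * a) * f + (s * b) * g = 1" .
  then show ?thesis using that by blast
qed

section \<open>Finite sets of vectors and matrices\<close>

lemma card_carrier_vec: "card (carrier_vec n :: 'a::finite vec set) = card (UNIV :: 'a set) ^ n"
  and finite_carrier_vec: "finite (carrier_vec n :: 'a::finite vec set)"
proof -
  let ?S = "{xs :: 'a list. set xs \<subseteq> UNIV \<and> length xs = n}"
  have inj: "inj_on vec_of_list ?S" by (rule inj_on_inverseI[of _ list_of_vec]) (rule list_vec)
  have img: "vec_of_list ` ?S = carrier_vec n"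
  proof
    show "carrier_vec n \<subseteq> vec_of_list ` ?S"
    proof
      fix v :: "'a vec" assume "v \<in> carrier_vec n"
      then have "list_of_vec v \<in> ?S" by simp
      then show "v \<in> vec_of_list ` ?S" by (rule image_eqI[of v vec_of_list "list_of_vec v", OF vec_list[symmetric]])
    qed
  qed (auto intro!: carrier_vecI)
  show "card (carrier_vec n :: 'a vec set) = card (UNIV :: 'a set) ^ n"
    unfolding img[symmetric] card_image[OF inj] by (rule card_lists_length_eq[OF finite])
  show "finite (carrier_vec n :: 'a vec set)"
    unfolding img[symmetric] by (rule finite_imageI[OF finite_lists_length_eq[OF finite]])
qed

lemma finite_carrier_mat: "finite (carrier_mat n m :: 'a::finite mat set)"
proof -
  have "carrier_mat n m \<subseteq> mat_of_rows m ` {xs :: 'a vec list. set xs \<subseteq> carrier_vec m \<and> length xs = n}"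
  proof
    fix M :: "'a mat" assume M: "M \<in> carrier_mat n m"
    then have "M = mat_of_rows m (rows M)" by auto
    moreover have "rows M \<in> {xs. set xs \<subseteq> carrier_vec m \<and> length xs = n}"
      using M by (auto simp: rows_def)
    ultimately show "M \<in> mat_of_rows m ` {xs. set xs \<subseteq> carrier_vec m \<and> length xs = n}" by blast
  qed
  then show ?thesis using finite_lists_length_eq[OF finite_carrier_vec] finite_surj by blast
qed

text \<open>The columns of \<open>krylov d M vs\<close> are \<open>v, M v, \<dots>, M\<^bsup>d-1\<^esup> v\<close> for the successive \<open>v\<close> in \<open>vs\<close>.
  When \<open>f(M) = 0\<close> for an irreducible \<open>f\<close> of degree \<open>d\<close>, injectivity of this matrix says that \<open>vs\<close> is linearly
  independent over the field \<open>F[x]/(f)\<close>.\<close>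

definition krylov :: "nat \<Rightarrow> 'a::field mat \<Rightarrow> 'a vec list \<Rightarrow> 'a mat" where
  "krylov d M vs = mat (dim_row M) (length vs * d)
     (\<lambda>(r, c). (poly_mat (monom 1 (c mod d)) M *\<^sub>v vs ! (c div d)) $ r)"

text \<open>When \<open>degree f\<close> divides \<open>N\<close>, this is the direct sum of copies
  of the companion matrix of \<open>f\<close>: a shift inside each block, with the negated
  coefficients of \<open>f\<close> in the last column of the block.\<close>

definition block_companion :: "'a::field poly \<Rightarrow> nat \<Rightarrow> 'a mat" where
  "block_companion f N = mat N N (\<lambda>(r, c).
     if Suc c mod degree f \<noteq> 0 then (if r = Suc c then 1 else 0)
     else if r div degree f = c div degree f then - coeff f (r mod degree f) else 0)"

lemma block_companion_carrier [simp]: "block_companion f N \<in> carrier_mat N N"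
  by (simp add: block_companion_def)

lemma krylov_carrier: "M \<in> carrier_mat n n \<Longrightarrow> krylov d M vs \<in> carrier_mat n (length vs * d)"
  by (simp add: krylov_def)

lemma poly_mat_mult_vec_sum:
  fixes M :: "'a::field mat"
  assumes M: "M \<in> carrier_mat n n" and v: "v \<in> carrier_vec n" and r: "r < n"
  shows "(poly_mat (\<Sum>i\<in>S. smult (c i) (p i)) M *\<^sub>v v) $ r = (\<Sum>i\<in>S. c i * (poly_mat (p i) M *\<^sub>v v) $ r)"
proof (induction S rule: infinite_finite_induct)
  case (insert x S)
  have "(poly_mat (p + q) M *\<^sub>v v) $ r = (poly_mat p M *\<^sub>v v) $ r + (poly_mat q M *\<^sub>v v) $ r" for p q
    using M v r add_mult_distrib_mat_vec[OF poly_mat_carrier[OF M] poly_mat_carrier[OF M] v]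
    by (simp add: poly_mat_add[OF M])
  moreover have "(poly_mat (smult a p) M *\<^sub>v v) $ r = a * (poly_mat p M *\<^sub>v v) $ r" for a p
    using M v r by (simp add: poly_mat_smult[OF M])
  ultimately show ?case using insert by simp
qed (use M v r in auto)

lemma poly_eq_sum_monoms_le:
  fixes f :: "'a::comm_ring_1 poly"
  assumes "degree f \<le> d"
  shows "f = (\<Sum>i\<le>d. smult (coeff f i) (monom 1 i))"
  using poly_as_sum_of_monoms'[OF assms] by (simp add: smult_monom)

lemma div_eq_iff_block:
  assumes "0 < d"
  shows "s div d = j \<longleftrightarrow> j * d \<le> s \<and> s < j * d + (d::nat)"
proof
  assume "s div d = j"
  then have "j * d + s mod d = s" using div_mult_mod_eq[of s d] by simp
  then show "j * d \<le> s \<and> s < j * d + d"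
    using mod_less_divisor[OF assms, of s] by linarith
next
  assume "j * d \<le> s \<and> s < j * d + d"
  then show "s div d = j" by (intro div_nat_eqI) (simp_all add: mult.commute)
qed

text \<open>\<open>M\<close> sends each column \<open>M^i v\<close> to the next one, and the last
  one of a block to \<open>M^d v\<close>, which \<open>f(M) v = 0\<close> rewrites in terms of the
  lower powers. In particular the column space of the Krylov matrix is stable under
  \<open>M\<close>.\<close>

lemma krylov_companion:
  fixes M :: "'a::field mat"
  assumes M: "M \<in> carrier_mat n n" and vs: "set vs \<subseteq> carrier_vec n"
    and f: "lead_coeff f = 1" "degree f = d" "0 < d" and ann: "poly_mat f M = 0\<^sub>m n n"
  shows "M * krylov d M vs = krylov d M vs * block_companion f (length vs * d)"
proof (rule eq_matI)
  let ?K = "krylov d M vs" and ?N = "length vs * d" and ?C = "block_companion f (length vs * d)"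
  note K = krylov_carrier[OF M, of d vs]
  fix r c assume "r < dim_row (?K * ?C)" "c < dim_col (?K * ?C)"
  then have r: "r < n" and c: "c < ?N" using K by (auto simp: block_companion_def)
  define j where "j = c div d"
  define i where "i = c mod d"
  have cji: "c = j * d + i" "i < d" using f by (auto simp: j_def i_def)
  have j: "j < length vs" using c f by (simp add: j_def less_mult_imp_div_less)
  then have vj: "vs ! j \<in> carrier_vec n" using vs by auto
  have jd: "j * d + d \<le> ?N" using mult_le_mono1[of "Suc j" "length vs" d] j by simp
  let ?L = "\<lambda>p. (poly_mat p M *\<^sub>v vs ! j) $ r"
  have Kc: "?K $$ (r, j * d + i') = ?L (monom 1 i')" if "i' < d" for i'
    using that r M jd by (simp add: krylov_def)
  have "col ?K c = poly_mat (monom 1 i) M *\<^sub>v vs ! j"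
    using M c poly_mat_carrier[OF M] by (intro eq_vecI) (auto simp: krylov_def i_def j_def)
  then have "(M * ?K) $$ (r, c) = (M *\<^sub>v (poly_mat (monom 1 i) M *\<^sub>v vs ! j)) $ r"
    using r c M K by (simp add: mult_mat_vec_def)
  also have "\<dots> = (poly_mat ([:0, 1:] * monom 1 i) M *\<^sub>v vs ! j) $ r"
    using M vj poly_mat_carrier[OF M] by (subst poly_mat_mult[OF M])
      (simp add: assoc_mult_mat_vec[of _ n n _ n])
  also have "[:0, 1:] * monom 1 i = (monom 1 (Suc i) :: 'a poly)" by (simp add: monom_Suc)
  finally have lhs: "(M * ?K) $$ (r, c) = ?L (monom 1 (Suc i))" .
  have rhs: "(?K * ?C) $$ (r, c) = (\<Sum>s\<in>{0..<?N}. ?K $$ (r, s) * ?C $$ (s, c))"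
    using r c K by (simp add: scalar_prod_def block_companion_def)
  show "(M * ?K) $$ (r, c) = (?K * ?C) $$ (r, c)"
  proof (cases "Suc i < d")
    case True
    then have "Suc c mod d \<noteq> 0" "Suc c < ?N" using cji jd by (auto simp: mod_Suc)
    then have "(?K * ?C) $$ (r, c) = (\<Sum>s\<in>{0..<?N}. if s = Suc c then ?K $$ (r, s) else 0)"
      unfolding rhs using c f by (intro sum.cong) (auto simp: block_companion_def)
    also have "\<dots> = ?K $$ (r, Suc c)" using \<open>Suc c < ?N\<close> by simp
    finally show ?thesis using lhs Kc[OF True] cji by simp
  next
    case False
    \<comment> \<open>This is the last column of block \<open>j\<close>: the product with the
      companion matrix involves only the columns of that block, and the result is compared with the
      expansion of \<open>f(M) v = 0\<close>.\<close>
    then have i: "Suc i = d" using cji by simp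
    then have mod: "Suc c mod d = 0" using cji by simp
    note blk = div_eq_iff_block[OF f(3)]
    have "(?K * ?C) $$ (r, c) = (\<Sum>s\<in>{0..<?N}. if s div d = j then ?K $$ (r, s) * - coeff f (s mod d) else 0)"
      unfolding rhs using c f mod by (intro sum.cong) (auto simp: block_companion_def j_def)
    also have "\<dots> = (\<Sum>s\<in>{j * d..<j * d + d}. ?K $$ (r, s) * - coeff f (s mod d))"
    proof (rule sum.mono_neutral_cong_right)
      show "\<forall>s\<in>{0..<?N} - {j * d..<j * d + d}. (if s div d = j then ?K $$ (r, s) * - coeff f (s mod d) else 0) = 0"
      proof
        fix s assume "s \<in> {0..<?N} - {j * d..<j * d + d}"
        then have "s div d \<noteq> j" unfolding blk by auto
        then show "(if s div d = j then ?K $$ (r, s) * - coeff f (s mod d) else 0) = 0" by simp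
      qed
      show "(if s div d = j then ?K $$ (r, s) * - coeff f (s mod d) else 0) = ?K $$ (r, s) * - coeff f (s mod d)"
        if "s \<in> {j * d..<j * d + d}" for s
        using that blk by auto
    qed (use jd in auto)
    also have "\<dots> = (\<Sum>s\<in>{0..<d}. ?K $$ (r, j * d + s) * - coeff f s)"
      using sum.shift_bounds_nat_ivl[of "\<lambda>s. ?K $$ (r, s) * - coeff f (s mod d)" 0 "j * d" d]
      by (simp add: add.commute)
    also have "\<dots> = - (\<Sum>s<d. coeff f s * ?L (monom 1 s))"
      unfolding sum_negf[symmetric] by (intro sum.cong) (auto simp: Kc)
    finally have R: "(?K * ?C) $$ (r, c) = - (\<Sum>s<d. coeff f s * ?L (monom 1 s))" .
    have "0 = ?L f" using r vj by (simp add: ann)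
    also have "\<dots> = ?L (\<Sum>i\<le>d. smult (coeff f i) (monom 1 i))"
      by (rule arg_cong[where f = ?L, OF poly_eq_sum_monoms_le]) (simp add: f)
    also have "\<dots> = (\<Sum>i\<le>d. coeff f i * ?L (monom 1 i))"
      by (rule poly_mat_mult_vec_sum[OF M vj r])
    also have "\<dots> = (\<Sum>s<d. coeff f s * ?L (monom 1 s)) + coeff f d * ?L (monom 1 d)"
      by (simp only: lessThan_Suc_atMost[symmetric] sum.lessThan_Suc)
    also have "coeff f d = 1" using f(1,2) by simp
    finally have "0 = (\<Sum>s<d. coeff f s * ?L (monom 1 s)) + ?L (monom 1 d)" by simp
    moreover have "y = - x" if "0 = x + y" for x y :: 'a using minus_unique[OF that[symmetric]] by (rule sym)
    ultimately have "?L (monom 1 d) = - (\<Sum>s<d. coeff f s * ?L (monom 1 s))" by blast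
    then show ?thesis unfolding R lhs i .
  qed
qed (use M krylov_carrier[OF M, of d vs] in \<open>auto simp: block_companion_def\<close>)

text \<open>The last \<open>d\<close> coordinates act as the coefficients of a polynomial of degree
  below \<open>d\<close>, that is, as a scalar of \<open>F[x]/(f)\<close> multiplying the new
  vector.\<close>

lemma krylov_append:
  fixes M :: "'a::field mat"
  assumes M: "M \<in> carrier_mat n n" and vs: "length vs = j" and v: "v \<in> carrier_vec n" and d: "0 < d"
    and x: "x \<in> carrier_vec (j * d)" and y: "y \<in> carrier_vec d"
  shows "krylov d M (vs @ [v]) *\<^sub>v (x @\<^sub>v y) =
    krylov d M vs *\<^sub>v x + poly_mat (\<Sum>i<d. smult (y $ i) (monom 1 i)) M *\<^sub>v v"
proof (rule eq_vecI)
  let ?K = "krylov d M (vs @ [v])" and ?K' = "krylov d M vs"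
  have K: "?K \<in> carrier_mat n (j * d + d)" using krylov_carrier[OF M, of d "vs @ [v]"] vs by (simp add: add.commute)
  have K': "?K' \<in> carrier_mat n (j * d)" using krylov_carrier[OF M, of d vs] vs by simp
  let ?q = "\<Sum>i<d. smult (y $ i) (monom 1 i)"
  fix r assume "r < dim_vec (?K' *\<^sub>v x + poly_mat ?q M *\<^sub>v v)"
  then have r: "r < n" using poly_mat_carrier[OF M, of ?q] by simp
  have "(?K *\<^sub>v (x @\<^sub>v y)) $ r = (\<Sum>c\<in>{0..<j * d + d}. ?K $$ (r, c) * (x @\<^sub>v y) $ c)"
    using r K x y by (simp add: scalar_prod_def)
  also have "\<dots> = (\<Sum>c\<in>{0..<j * d}. ?K $$ (r, c) * (x @\<^sub>v y) $ c)
      + (\<Sum>c\<in>{j * d..<j * d + d}. ?K $$ (r, c) * (x @\<^sub>v y) $ c)"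
    by (rule sum.atLeastLessThan_concat[symmetric]) auto
  also have "(\<Sum>c\<in>{0..<j * d}. ?K $$ (r, c) * (x @\<^sub>v y) $ c) = (\<Sum>c\<in>{0..<j * d}. ?K' $$ (r, c) * x $ c)"
  proof (rule sum.cong)
    fix c assume "c \<in> {0..<j * d}"
    then have c: "c < j * d" by simp
    then have "c div d < j" by (simp add: less_mult_imp_div_less)
    then show "?K $$ (r, c) * (x @\<^sub>v y) $ c = ?K' $$ (r, c) * x $ c"
      using c r M x y vs by (simp add: krylov_def nth_append)
  qed simp
  also have "\<dots> = (?K' *\<^sub>v x) $ r"
    using r K' x by (simp add: scalar_prod_def)
  also have "(\<Sum>c\<in>{j * d..<j * d + d}. ?K $$ (r, c) * (x @\<^sub>v y) $ c)
      = (\<Sum>i\<in>{0..<d}. ?K $$ (r, i + j * d) * (x @\<^sub>v y) $ (i + j * d))"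
    using sum.shift_bounds_nat_ivl[of "\<lambda>c. ?K $$ (r, c) * (x @\<^sub>v y) $ c" 0 "j * d" d]
    by (simp add: add.commute)
  also have "\<dots> = (\<Sum>i\<in>{0..<d}. y $ i * (poly_mat (monom 1 i) M *\<^sub>v v) $ r)"
  proof (rule sum.cong)
    fix i assume "i \<in> {0..<d}"
    then show "?K $$ (r, i + j * d) * (x @\<^sub>v y) $ (i + j * d) = y $ i * (poly_mat (monom 1 i) M *\<^sub>v v) $ r"
      using r M x y vs d by (simp add: krylov_def nth_append)
  qed simp
  also have "\<dots> = (poly_mat ?q M *\<^sub>v v) $ r"
    unfolding poly_mat_mult_vec_sum[OF M v r] atLeast0LessThan ..
  finally show "(?K *\<^sub>v (x @\<^sub>v y)) $ r = (?K' *\<^sub>v x + poly_mat ?q M *\<^sub>v v) $ r"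
    using r M poly_mat_carrier[OF M, of ?q] by simp
qed (use M krylov_carrier[OF M, of d "vs @ [v]"] in auto)

definition frames :: "nat \<Rightarrow> 'a::field mat \<Rightarrow> nat \<Rightarrow> 'a vec list set" where
  "frames d M j = {vs. length vs = j \<and> set vs \<subseteq> carrier_vec (dim_row M) \<and>
     (\<forall>x\<in>carrier_vec (j * d). krylov d M vs *\<^sub>v x = 0\<^sub>v (dim_row M) \<longrightarrow> x = 0\<^sub>v (j * d))}"

lemma frames_inj_on:
  fixes M :: "'a::field mat"
  assumes M: "M \<in> carrier_mat n n" and vs: "vs \<in> frames d M j"
  shows "inj_on (\<lambda>x. krylov d M vs *\<^sub>v x) (carrier_vec (j * d))"
proof (rule inj_onI)
  have K: "krylov d M vs \<in> carrier_mat n (j * d)" using krylov_carrier[OF M, of d vs] vs by (simp add: frames_def)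
  fix x y assume xy: "x \<in> carrier_vec (j * d)" "y \<in> carrier_vec (j * d)"
    "krylov d M vs *\<^sub>v x = krylov d M vs *\<^sub>v y"
  have "krylov d M vs *\<^sub>v (x - y) = krylov d M vs *\<^sub>v x - krylov d M vs *\<^sub>v y"
    using K xy by (intro mult_minus_distrib_mat_vec) auto
  also have "\<dots> = 0\<^sub>v n" using xy K by auto
  finally have 0: "x - y = 0\<^sub>v (j * d)" using vs xy M unfolding frames_def by auto
  show "x = y"
  proof (rule eq_vecI)
    fix i assume i: "i < dim_vec y"
    have "(x - y) $ i = 0" unfolding 0 using i xy by simp
    then show "x $ i = y $ i" using i xy by simp
  qed (use xy in simp)
qed

lemma add_vec_zero_imp:
  fixes u w :: "'a::field vec"
  assumes "u \<in> carrier_vec n" "w \<in> carrier_vec n" "u + w = 0\<^sub>v n"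
  shows "w = - u"
proof (rule eq_vecI)
  fix i assume i: "i < dim_vec (- u)"
  have "(u + w) $ i = 0" using i assms by (simp only: assms(3)) simp
  then have "u $ i + w $ i = 0" using i assms(1,2) by simp
  then show "w $ i = (- u) $ i" using i assms(1,2) by (simp add: add_eq_0_iff)
qed (use assms in auto)

lemma zero_mult_mat_vec: "v \<in> carrier_vec n \<Longrightarrow> 0\<^sub>m m n *\<^sub>v v = (0\<^sub>v m :: 'a::field vec)"
  by (intro eq_vecI) auto

text \<open>This is the extension step for independent vectors over the field
  \<open>F[x]/(f)\<close>. In a relation \<open>K x + g(M) v = 0\<close> with \<open>g\<close>
  nonzero of degree below \<open>d\<close>, \<open>g\<close> is invertible modulo \<open>f\<close>,
  and dividing by it puts \<open>v\<close> into the column space of \<open>K\<close>.\<close>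

lemma frames_append_iff:
  fixes M :: "'a::field mat"
  assumes M: "M \<in> carrier_mat n n" and v: "v \<in> carrier_vec n" and f: "lead_coeff f = 1" "degree f = d" "0 < d"
    and irr: "Factorial_Ring.irreducible f" and ann: "poly_mat f M = 0\<^sub>m n n"
    and vs: "length vs = j"
  shows "vs @ [v] \<in> frames d M (Suc j) \<longleftrightarrow>
    vs \<in> frames d M j \<and> v \<notin> (\<lambda>x. krylov d M vs *\<^sub>v x) ` carrier_vec (j * d)"
proof -
  let ?K = "krylov d M vs" and ?K' = "krylov d M (vs @ [v])"
  let ?q = "\<lambda>y :: 'a vec. \<Sum>i<d. smult (y $ i) (monom 1 i)"
  have K: "?K \<in> carrier_mat n (j * d)" using krylov_carrier[OF M, of d vs] vs by simp
  note app = krylov_append[OF M vs v f(3)]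
  have dim: "Suc j * d = j * d + d" by simp
  have q0: "?q (0\<^sub>v d) = 0" by (intro sum.neutral) auto
  show ?thesis
  proof
    assume L: "vs @ [v] \<in> frames d M (Suc j)"
    then have set: "set vs \<subseteq> carrier_vec n" and
      inj: "\<And>x. x \<in> carrier_vec (j * d + d) \<Longrightarrow> ?K' *\<^sub>v x = 0\<^sub>v n \<Longrightarrow> x = 0\<^sub>v (j * d + d)"
      using M unfolding frames_def dim by auto
    have "x = 0\<^sub>v (j * d)" if x: "x \<in> carrier_vec (j * d)" and 0: "?K *\<^sub>v x = 0\<^sub>v n" for x
    proof -
      have "?K' *\<^sub>v (x @\<^sub>v 0\<^sub>v d) = 0\<^sub>v n"
        using app[OF x, of "0\<^sub>v d"] 0 q0 M v by (simp add: zero_mult_mat_vec)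
      then have "x @\<^sub>v 0\<^sub>v d = 0\<^sub>v (j * d) @\<^sub>v 0\<^sub>v d" using inj[of "x @\<^sub>v 0\<^sub>v d"] x by auto
      then show ?thesis using append_vec_eq[OF x, of "0\<^sub>v (j * d)"] by simp
    qed
    then have "vs \<in> frames d M j" using set vs M by (auto simp: frames_def)
    moreover have "v \<notin> (\<lambda>x. ?K *\<^sub>v x) ` carrier_vec (j * d)"
    proof
      assume "v \<in> (\<lambda>x. ?K *\<^sub>v x) ` carrier_vec (j * d)"
      then obtain x where x: "x \<in> carrier_vec (j * d)" "v = ?K *\<^sub>v x" by blast
      \<comment> \<open>These coordinates encode the constant polynomial \<open>-1\<close>, so
        \<open>x\<close> followed by \<open>?y\<close> is the relation
        \<open>?K x - v = 0\<close>.\<close>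
      let ?y = "- unit_vec d 0 :: 'a vec"
      have "?q ?y = (\<Sum>i<d. if i = 0 then - 1 else 0)"
        by (intro sum.cong) (auto simp: unit_vec_def one_pCons monom_0)
      then have "?q ?y = [:-1:]" using f by (simp add: one_pCons)
      then have "poly_mat (?q ?y) M *\<^sub>v v = - v"
        using M v by (simp add: poly_mat_const[OF M]) (intro eq_vecI, auto)
      then have "?K' *\<^sub>v (x @\<^sub>v ?y) = 0\<^sub>v n" using app[OF x(1), of ?y] x(2) v by simp
      then have "x @\<^sub>v ?y = 0\<^sub>v (j * d + d)" using inj[of "x @\<^sub>v ?y"] x by auto
      then have "(x @\<^sub>v ?y) $ (j * d) = 0" using f by simp
      then show False using x f by simp
    qed
    ultimately show "vs \<in> frames d M j \<and> v \<notin> (\<lambda>x. ?K *\<^sub>v x) ` carrier_vec (j * d)" by blast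
  next
    assume R: "vs \<in> frames d M j \<and> v \<notin> (\<lambda>x. ?K *\<^sub>v x) ` carrier_vec (j * d)"
    then have set: "set vs \<subseteq> carrier_vec n" and
      inj: "\<And>x. x \<in> carrier_vec (j * d) \<Longrightarrow> ?K *\<^sub>v x = 0\<^sub>v n \<Longrightarrow> x = 0\<^sub>v (j * d)"
      and nin: "\<And>x. x \<in> carrier_vec (j * d) \<Longrightarrow> v \<noteq> ?K *\<^sub>v x"
      using M unfolding frames_def by auto
    let ?C = "block_companion f (j * d)"
    have MK: "M * ?K = ?K * ?C" using krylov_companion[OF M set f ann] vs by simp
    have "z = 0\<^sub>v (j * d + d)" if z: "z \<in> carrier_vec (j * d + d)" and z0: "?K' *\<^sub>v z = 0\<^sub>v n" for z
    proof -
      define x where "x = vec_first z (j * d)"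
      define y where "y = vec_last z d"
      have x: "x \<in> carrier_vec (j * d)" and y: "y \<in> carrier_vec d" by (auto simp: x_def y_def)
      have zxy: "z = x @\<^sub>v y" using vec_first_last_append[OF z] by (simp add: x_def y_def)
      define g where "g = ?q y"
      have sum0: "?K *\<^sub>v x + poly_mat g M *\<^sub>v v = 0\<^sub>v n"
        using z0 app[OF x y] by (simp add: zxy g_def)
      have g: "poly_mat g M \<in> carrier_mat n n" using M by simp
      have gv: "poly_mat g M *\<^sub>v v = - (?K *\<^sub>v x)"
        by (rule add_vec_zero_imp[OF _ _ sum0]) (use K g x v in auto)
      have coeff_g: "coeff g i = (if i < d then y $ i else 0)" for i
        unfolding g_def by (simp add: coeff_sum if_distrib[of "(*) _"] cong: if_cong)
      have "g = 0"
      proof (rule ccontr)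
        assume g0: "g \<noteq> 0"
        \<comment> \<open>The degree bound excludes \<open>f dvd g\<close>, so the Bezout
          coefficient \<open>b\<close> becomes an inverse of \<open>g(M)\<close>.\<close>
        have "degree g < d" using coeff_g f by (intro degree_lessI) auto
        then have "\<not> f dvd g" using dvd_imp_degree_le[of f g] g0 f by auto
        then obtain a b where ab: "a * f + b * g = 1" using irreducible_poly_bezout[OF irr] by blast
        have "poly_mat (a * f) M = 0\<^sub>m n n"
          using poly_mat_carrier[OF M, of a] by (simp add: poly_mat_mult[OF M] ann)
        then have "poly_mat b M * poly_mat g M = 1\<^sub>m n"
          using arg_cong[OF ab, of "\<lambda>p. poly_mat p M"] poly_mat_carrier[OF M, of "b * g"] M
          by (simp add: poly_mat_add[OF M] poly_mat_mult[OF M, of b])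
        then have "v = poly_mat b M *\<^sub>v (poly_mat g M *\<^sub>v v)"
          using mult_mat_vec_cancel[OF poly_mat_carrier[OF M] g _ v] by (rule_tac sym) simp
        also have "\<dots> = poly_mat b M *\<^sub>v (?K *\<^sub>v (- x))"
          unfolding gv using K x by (intro arg_cong[where f = "(*\<^sub>v) (poly_mat b M)"] eq_vecI) auto
        also have "\<dots> = poly_mat b M * ?K *\<^sub>v (- x)"
          using K x M by (simp add: assoc_mult_mat_vec[of _ n n _ "j * d"])
        \<comment> \<open>Stability of the column space: \<open>b(M)\<close> acts on it through
          \<open>b(?C)\<close>, so the result is again \<open>?K\<close> times a vector.\<close>
        also have "\<dots> = ?K * poly_mat b ?C *\<^sub>v (- x)"
          using poly_mat_intertwine[OF M block_companion_carrier K MK] by simp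
        also have "\<dots> = ?K *\<^sub>v (poly_mat b ?C *\<^sub>v (- x))"
          using K x poly_mat_carrier[OF block_companion_carrier]
          by (intro assoc_mult_mat_vec[of _ n "j * d" _ "j * d"]) auto
        finally show False
          using nin[of "poly_mat b ?C *\<^sub>v (- x)"] x
            mult_mat_vec_carrier[OF poly_mat_carrier[OF block_companion_carrier, of b f "j * d"], of "- x"] by simp
      qed
      then have "y $ i = 0" if "i < d" for i using coeff_g[of i] that by simp
      then have y0: "y = 0\<^sub>v d" using y by (intro eq_vecI) auto
      have "?K *\<^sub>v x \<in> carrier_vec n" using K x by auto
      then have "?K *\<^sub>v x = 0\<^sub>v n" using sum0 \<open>g = 0\<close> v M by (simp add: zero_mult_mat_vec)
      then have "x = 0\<^sub>v (j * d)" using inj[OF x] by simp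
      then show ?thesis using zxy y0 by auto
    qed
    then show "vs @ [v] \<in> frames d M (Suc j)" using vs set v M unfolding frames_def dim by auto
  qed
qed

text \<open>A frame of length \<open>j\<close> can be extended by every vector outside a space of
  \<open>q^(j d)\<close> elements. Truncated subtraction agrees with this: a frame injects that
  space into the \<open>q^n\<close> vectors, and beyond the possible lengths the product contains a
  factor zero.\<close>

lemma card_frames:
  fixes M :: "'a::{finite,field} mat"
  assumes M: "M \<in> carrier_mat n n" and f: "lead_coeff f = 1" "degree f = d" "0 < d"
    and irr: "Factorial_Ring.irreducible f" and ann: "poly_mat f M = 0\<^sub>m n n"
  shows "finite (frames d M j) \<and>
    card (frames d M j) = (\<Prod>i<j. card (UNIV :: 'a set) ^ n - card (UNIV :: 'a set) ^ (i * d))"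
proof (induction j)
  case 0
  have "frames d M 0 = {[]}" by (auto simp: frames_def)
  then show ?case by simp
next
  case (Suc j)
  let ?q = "card (UNIV :: 'a set)"
  let ?R = "\<lambda>vs. carrier_vec n - (\<lambda>x. krylov d M vs *\<^sub>v x) ` carrier_vec (j * d)"
  have dM: "dim_row M = n" using M by simp
  have eq: "frames d M (Suc j) = (\<lambda>(vs, v). vs @ [v]) ` Sigma (frames d M j) ?R"
  proof
    show "frames d M (Suc j) \<subseteq> (\<lambda>(vs, v). vs @ [v]) ` Sigma (frames d M j) ?R"
    proof
      fix ws assume ws: "ws \<in> frames d M (Suc j)"
      then have len: "length ws = Suc j" by (simp add: frames_def)
      then obtain vs v where wv: "ws = vs @ [v]" "length vs = j"
        by (metis length_Suc_conv_rev)
      have v: "v \<in> carrier_vec n" using ws unfolding wv frames_def dM by simp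
      have "(vs, v) \<in> Sigma (frames d M j) ?R"
        using frames_append_iff[OF M v f irr ann wv(2)] ws v unfolding wv by blast
      then show "ws \<in> (\<lambda>(vs, v). vs @ [v]) ` Sigma (frames d M j) ?R" using wv(1) by force
    qed
    show "(\<lambda>(vs, v). vs @ [v]) ` Sigma (frames d M j) ?R \<subseteq> frames d M (Suc j)"
    proof clarify
      fix vs v assume vs: "vs \<in> frames d M j" and v: "v \<in> carrier_vec n"
        and nin: "v \<notin> (\<lambda>x. krylov d M vs *\<^sub>v x) ` carrier_vec (j * d)"
      have "length vs = j" using vs by (simp add: frames_def)
      then show "vs @ [v] \<in> frames d M (Suc j)"
        using frames_append_iff[OF M v f irr ann] vs nin by blast
    qed
  qed
  have cR: "card (?R vs) = ?q ^ n - ?q ^ (j * d)" if vs: "vs \<in> frames d M j" for vs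
  proof -
    let ?K = "krylov d M vs"
    have len: "length vs = j" using vs by (simp add: frames_def)
    have K: "?K \<in> carrier_mat n (j * d)" using krylov_carrier[OF M, of d vs] len by simp
    have "card ((\<lambda>x. ?K *\<^sub>v x) ` carrier_vec (j * d)) = ?q ^ (j * d)"
      by (simp add: card_image[OF frames_inj_on[OF M vs]] card_carrier_vec)
    moreover have "(\<lambda>x. ?K *\<^sub>v x) ` carrier_vec (j * d) \<subseteq> carrier_vec n" using K by auto
    ultimately show ?thesis
      by (subst card_Diff_subset) (auto simp: finite_carrier_vec card_carrier_vec)
  qed
  have inj: "inj_on (\<lambda>(vs, v). vs @ [v]) (Sigma (frames d M j) ?R)" by (auto intro!: inj_onI)
  have fin: "finite (Sigma (frames d M j) ?R)" using Suc finite_carrier_vec by blast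
  have "card (Sigma (frames d M j) ?R) = (\<Sum>vs\<in>frames d M j. ?q ^ n - ?q ^ (j * d))"
    using Suc finite_carrier_vec cR by (subst card_SigmaI) auto
  then show ?case using fin Suc unfolding eq card_image[OF inj] by (simp add: mult.commute)
qed

section \<open>Companion matrices and their cyclic vectors\<close>

lemma mult_mat_zero_vec: "A \<in> carrier_mat m n \<Longrightarrow> A *\<^sub>v 0\<^sub>v n = (0\<^sub>v m :: 'a::field vec)"
  by (intro eq_vecI) auto

lemma monom_Suc_X: "monom 1 (Suc i) = [:0, 1:] * (monom 1 i :: 'a::comm_ring_1 poly)"
  by (simp add: monom_Suc)

text \<open>The first unit vector of a block generates that block under the shift. Hence the first
  columns of the blocks determine a matrix that intertwines with the companion matrix.\<close>

lemma block_companion_power_unit_vec: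
  fixes f :: "'a::field poly"
  assumes d: "degree f = d" and i: "i < d" and j: "j < k"
  shows "poly_mat (monom 1 i) (block_companion f (k * d)) *\<^sub>v unit_vec (k * d) (j * d) = unit_vec (k * d) (j * d + i)"
  using i
proof (induction i)
  case 0
  then show ?case
    by (simp add: monom_0 poly_mat_const[OF block_companion_carrier] one_pCons[symmetric]
        poly_mat_1[OF block_companion_carrier])
next
  case (Suc i)
  let ?N = "k * d" and ?C = "block_companion f (k * d)"
  note C = block_companion_carrier[of f ?N]
  have "j * d + d \<le> ?N" using mult_le_mono1[of "Suc j" k d] j by simp
  then have lt: "j * d + Suc i < ?N" using Suc.prems by simp
  have "poly_mat (monom 1 (Suc i)) ?C *\<^sub>v unit_vec ?N (j * d) = ?C *\<^sub>v (poly_mat (monom 1 i) ?C *\<^sub>v unit_vec ?N (j * d))"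
    unfolding monom_Suc_X poly_mat_mult[OF C] poly_mat_X[OF C]
    by (rule assoc_mult_mat_vec[OF C poly_mat_carrier[OF C]]) simp
  also have "\<dots> = col ?C (j * d + i)"
    using Suc lt by (subst Suc.IH) (auto simp: mult_mat_unit_vec[OF C])
  also have "\<dots> = unit_vec ?N (j * d + Suc i)"
  proof (rule eq_vecI)
    fix r assume r: "r < dim_vec (unit_vec ?N (j * d + Suc i) :: 'a vec)"
    have "Suc (j * d + i) mod d \<noteq> 0" using Suc.prems by (simp add: mod_Suc)
    then show "col ?C (j * d + i) $ r = unit_vec ?N (j * d + Suc i) $ r"
      using r lt d by (simp add: block_companion_def)
  qed (simp add: block_companion_def)
  finally show ?case .
qed

text \<open>It suffices to test the cyclic generators of the blocks, where the negated coefficients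
  in the last column cancel the lower terms of \<open>f\<close>. All other unit vectors are images
  of generators under powers of the matrix, which commute with \<open>f\<close> of it.\<close>

lemma poly_mat_block_companion:
  fixes f :: "'a::field poly"
  assumes f: "lead_coeff f = 1" "degree f = d" "0 < d"
  shows "poly_mat f (block_companion f (k * d)) = 0\<^sub>m (k * d) (k * d)"
proof -
  let ?N = "k * d" and ?C = "block_companion f (k * d)"
  note C = block_companion_carrier[of f ?N]
  have base: "poly_mat f ?C *\<^sub>v unit_vec ?N (j * d) = 0\<^sub>v ?N" if j: "j < k" for j
  proof (rule eq_vecI)
    fix r assume "r < dim_vec (0\<^sub>v ?N :: 'a vec)"
    then have r: "r < ?N" by simp
    have jd: "j * d + d \<le> ?N" using mult_le_mono1[of "Suc j" k d] j by simp
    let ?L = "\<lambda>p. (poly_mat p ?C *\<^sub>v unit_vec ?N (j * d)) $ r"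
    obtain d' where d': "d = Suc d'" using f(3) by (cases d) auto
    have low: "?L (monom 1 s) = (if r = j * d + s then 1 else 0)" if "s < d" for s
      unfolding block_companion_power_unit_vec[OF f(2) that j] using r jd that by (auto simp: unit_vec_def)
    have "poly_mat (monom 1 d) ?C *\<^sub>v unit_vec ?N (j * d) = ?C *\<^sub>v (poly_mat (monom 1 d') ?C *\<^sub>v unit_vec ?N (j * d))"
      unfolding monom_Suc_X d' poly_mat_mult[OF block_companion_carrier] poly_mat_X[OF block_companion_carrier]
      by (rule assoc_mult_mat_vec[OF block_companion_carrier poly_mat_carrier[OF block_companion_carrier]]) simp
    also have "poly_mat (monom 1 d') ?C *\<^sub>v unit_vec ?N (j * d) = unit_vec ?N (j * d + d')"
      using d' by (intro block_companion_power_unit_vec[OF f(2) _ j]) simp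
    also have "?C *\<^sub>v unit_vec ?N (j * d + d') = col ?C (j * d + d')"
      using jd d' by (intro mult_mat_unit_vec[OF C]) simp
    finally have "?L (monom 1 d) = ?C $$ (r, j * d + d')"
      using r jd d' by (simp add: block_companion_def)
    also have "\<dots> = (if r div d = j then - coeff f (r mod d) else 0)"
    proof -
      have "(j * d + d') div d = j" using d' div_eq_iff_block[OF f(3), of "j * d + d'" j] by simp
      moreover have "Suc (j * d + d') mod d = 0"
        using d' mod_mult_self2_is_0[of "Suc j" d] by (simp add: algebra_simps)
      moreover have "j * d + d' < ?N" using jd d' by simp
      ultimately show ?thesis using r f(2) by (simp add: block_companion_def)
    qed
    finally have top: "?L (monom 1 d) = (if r div d = j then - coeff f (r mod d) else 0)" .
    have "?L f = ?L (\<Sum>s\<le>d. smult (coeff f s) (monom 1 s))"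
      by (rule arg_cong[where f = ?L, OF poly_eq_sum_monoms_le]) (simp add: f)
    also have "\<dots> = (\<Sum>s\<le>d. coeff f s * ?L (monom 1 s))"
      by (rule poly_mat_mult_vec_sum[OF C _ r]) simp
    also have "\<dots> = (\<Sum>s<d. coeff f s * ?L (monom 1 s)) + coeff f d * ?L (monom 1 d)"
      by (simp only: lessThan_Suc_atMost[symmetric] sum.lessThan_Suc)
    also have "coeff f d = 1" using f(1,2) by simp
    also have "(\<Sum>s<d. coeff f s * ?L (monom 1 s)) = (\<Sum>s<d. if r = j * d + s then coeff f s else 0)"
      using low by (intro sum.cong) auto
    also have "\<dots> = (if r div d = j then coeff f (r mod d) else 0)"
    proof (cases "r div d = j")
      case True
      then have e: "j * d + r mod d = r" using div_mult_mod_eq[of r d] by simp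
      have "(\<Sum>s<d. if r = j * d + s then coeff f s else 0) = (\<Sum>s<d. if s = r mod d then coeff f (r mod d) else 0)"
      proof (rule sum.cong)
        fix x
        have "r = j * d + x \<longleftrightarrow> x = r mod d" using e by linarith
        then show "(if r = j * d + x then coeff f x else 0) = (if x = r mod d then coeff f (r mod d) else 0)"
          by simp
      qed simp
      then show ?thesis using True f(3) by simp
    next
      case False
      have "r \<noteq> j * d + s" if "s < d" for s
        using False that unfolding div_eq_iff_block[OF f(3)] by auto
      then show ?thesis using False by (auto intro!: sum.neutral)
    qed
    finally show "?L f = 0\<^sub>v ?N $ r" using r top by simp
  qed (use poly_mat_carrier[OF C] in auto)
  have "col (poly_mat f ?C) c = 0\<^sub>v ?N" if c: "c < ?N" for c
  proof -
    define j where "j = c div d"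
    define i where "i = c mod d"
    have j: "j < k" using c by (simp add: j_def less_mult_imp_div_less)
    have i: "i < d" "c = j * d + i" using f(3) by (auto simp: j_def i_def)
    have "col (poly_mat f ?C) c = poly_mat f ?C *\<^sub>v unit_vec ?N c"
      using c by (rule mult_mat_unit_vec[OF poly_mat_carrier[OF C], symmetric])
    also have "\<dots> = poly_mat f ?C *\<^sub>v (poly_mat (monom 1 i) ?C *\<^sub>v unit_vec ?N (j * d))"
      using block_companion_power_unit_vec[OF f(2) i(1) j] i(2) by simp
    also have "\<dots> = poly_mat (f * monom 1 i) ?C *\<^sub>v unit_vec ?N (j * d)"
      unfolding poly_mat_mult[OF C]
      by (rule assoc_mult_mat_vec[OF poly_mat_carrier[OF C] poly_mat_carrier[OF C], symmetric]) simp
    \<comment> \<open>The order is exchanged so that \<open>f\<close> meets the generator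
      first.\<close>
    also have "\<dots> = poly_mat (monom 1 i * f) ?C *\<^sub>v unit_vec ?N (j * d)" by (simp only: mult.commute)
    also have "\<dots> = poly_mat (monom 1 i) ?C *\<^sub>v (poly_mat f ?C *\<^sub>v unit_vec ?N (j * d))"
      unfolding poly_mat_mult[OF C]
      by (rule assoc_mult_mat_vec[OF poly_mat_carrier[OF C] poly_mat_carrier[OF C]]) simp
    also have "\<dots> = 0\<^sub>v ?N" unfolding base[OF j]
      by (rule mult_mat_zero_vec[OF poly_mat_carrier[OF C]])
    finally show ?thesis .
  qed
  then have "col (poly_mat f ?C) c $ r = 0" if "c < ?N" "r < ?N" for r c using that by simp
  then show ?thesis using poly_mat_carrier[OF C, of f] by (intro eq_matI) auto
qed

section \<open>Double counting of matrices with bases over the residue field\<close>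

definition annihilated :: "'a::field poly \<Rightarrow> nat \<Rightarrow> 'a mat set" where
  "annihilated p n = {M \<in> carrier_mat n n. poly_mat p M = 0\<^sub>m n n}"

lemma finite_annihilated: "finite (annihilated p n :: 'a::{finite,field} mat set)"
  unfolding annihilated_def by (rule finite_subset[OF _ finite_carrier_mat]) auto

lemma finite_GL_set: "finite (GL_set T n)"
  unfolding GL_set_def by (rule finite_subset[OF _ finite_carrier_mat]) auto

text \<open>A pair of a matrix and a full frame is the same as an invertible \<open>P\<close>: the
  frame is read off the columns at multiples of \<open>d\<close>, and the matrix is the companion
  matrix conjugated by \<open>P\<close>.\<close>

lemma bij_betw_krylov:
  fixes T :: "'a::{finite,field} itself"
  assumes f: "lead_coeff (f :: 'a poly) = 1" "degree f = d" "0 < d" and n: "n = k * d"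
  shows "bij_betw (\<lambda>(M, vs). krylov d M vs) (Sigma (annihilated f n) (\<lambda>M. frames d M k)) (GL_set T n)"
proof -
  let ?S = "Sigma (annihilated f n) (\<lambda>M. frames d M k)" and ?C = "block_companion f n"
  have inS: "krylov d M vs \<in> carrier_mat n n \<and> invertible_mat (krylov d M vs) \<and>
      M * krylov d M vs = krylov d M vs * ?C \<and> (\<forall>j<k. vs ! j = col (krylov d M vs) (j * d)) \<and> length vs = k"
    if "(M, vs) \<in> ?S" for M vs
  proof -
    have M: "M \<in> carrier_mat n n" and ann: "poly_mat f M = 0\<^sub>m n n" and vs: "vs \<in> frames d M k"
      using that by (auto simp: annihilated_def)
    have len: "length vs = k" and set: "set vs \<subseteq> carrier_vec n" using vs M by (auto simp: frames_def)
    have K: "krylov d M vs \<in> carrier_mat n n" using krylov_carrier[OF M, of d vs] len n by simp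
    have "invertible_mat (krylov d M vs)"
      by (rule invertible_mat_if_inj[OF K]) (use vs M n in \<open>auto simp: frames_def\<close>)
    moreover have "M * krylov d M vs = krylov d M vs * ?C"
      using krylov_companion[OF M set f ann] len n by simp
    moreover have "vs ! j = col (krylov d M vs) (j * d)" if j: "j < k" for j
    proof -
      have v: "vs ! j \<in> carrier_vec n" using set len j by auto
      have "j * d < n" using j f n by simp
      then show ?thesis using M v len n f
        by (intro eq_vecI) (auto simp: krylov_def monom_0 one_pCons[symmetric] poly_mat_1[OF M])
    qed
    ultimately show ?thesis using K len by blast
  qed
  show ?thesis
  proof (rule bij_betw_imageI)
    show "inj_on (\<lambda>(M, vs). krylov d M vs) ?S"
    proof (rule inj_onI, clarify)
      fix M vs M' vs'
      assume a: "M \<in> annihilated f n" "vs \<in> frames d M k" and a': "M' \<in> annihilated f n" "vs' \<in> frames d M' k"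
        and eq: "krylov d M vs = krylov d M' vs'"
      have M: "M \<in> carrier_mat n n" "M' \<in> carrier_mat n n" using a a' by (auto simp: annihilated_def)
      note h = inS[of M vs] inS[of M' vs']
      define K where "K = krylov d M vs"
      have K: "K \<in> carrier_mat n n" "invertible_mat K" and MK: "M * K = K * ?C" "M' * K = K * ?C"
        and l: "length vs = k" "length vs' = k"
        and cols: "\<forall>j<k. vs ! j = col K (j * d)" "\<forall>j<k. vs' ! j = col K (j * d)"
        using h a a' unfolding K_def eq by auto
      have "vs = vs'" using l cols by (auto intro!: nth_equalityI)
      moreover have "A = K * ?C * inv_mat K" if A: "A \<in> carrier_mat n n" and AK: "A * K = K * ?C" for A
      proof -
        note i = inv_mat[OF K]
        have "K * ?C * inv_mat K = A * (K * inv_mat K)"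
          unfolding AK[symmetric] by (rule assoc_mult_mat[OF A K(1) i(1)])
        then show ?thesis using A by (simp add: i)
      qed
      ultimately show "M = M' \<and> vs = vs'" using M MK by blast
    qed
    show "(\<lambda>(M, vs). krylov d M vs) ` ?S = GL_set T n"
    proof
      show "(\<lambda>(M, vs). krylov d M vs) ` ?S \<subseteq> GL_set T n" using inS by (auto simp: GL_set_def)
      show "GL_set T n \<subseteq> (\<lambda>(M, vs). krylov d M vs) ` ?S"
      proof
        fix P assume "P \<in> GL_set T n"
        then have P: "P \<in> carrier_mat n n" "invertible_mat P" by (auto simp: GL_set_def)
        define Q where "Q = inv_mat P"
        note Q = inv_mat[OF P, folded Q_def]
        have C: "?C \<in> carrier_mat n n" by simp
        \<comment> \<open>The preimage of \<open>P\<close> is forced: \<open>M\<close> has to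
          satisfy \<open>M * P = P * ?C\<close>, and the frame has to consist of the first columns
          of the blocks.\<close>
        define M where "M = P * ?C * Q"
        define vs where "vs = map (\<lambda>j. col P (j * d)) [0..<k]"
        have M: "M \<in> carrier_mat n n" unfolding M_def by (rule mult_carrier_mat[OF mult_carrier_mat[OF P(1) C] Q(1)])
        have MP: "M * P = P * ?C"
          unfolding M_def using assoc_mult_mat[OF mult_carrier_mat[OF P(1) C] Q(1) P(1)] Q(3) P(1) C
          by simp
        have ann: "poly_mat f M = 0\<^sub>m n n"
          unfolding M_def poly_mat_conj[OF C P(1) Q(1) Q(3)]
          using poly_mat_block_companion[OF f, of k] P(1) Q(1) by (simp add: n)
        have KP: "krylov d M vs = P"
        proof (rule eq_matI)
          fix r c assume "r < dim_row P" "c < dim_col P"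
          then have r: "r < n" and c: "c < n" using P by auto
          define j where "j = c div d"
          define i where "i = c mod d"
          have j: "j < k" using c n by (simp add: j_def less_mult_imp_div_less)
          have i: "i < d" "j * d + i = c" using f(3) by (auto simp: j_def i_def)
          have jd: "j * d < n" using i c by simp
          have "poly_mat (monom 1 i) M *\<^sub>v vs ! j = poly_mat (monom 1 i) M *\<^sub>v (P *\<^sub>v unit_vec n (j * d))"
            using j jd by (simp add: vs_def mult_mat_unit_vec[OF P(1)])
          also have "\<dots> = poly_mat (monom 1 i) M * P *\<^sub>v unit_vec n (j * d)"
            by (rule assoc_mult_mat_vec[OF poly_mat_carrier[OF M] P(1), symmetric]) simp
          also have "\<dots> = P * poly_mat (monom 1 i) ?C *\<^sub>v unit_vec n (j * d)"
            unfolding poly_mat_intertwine[OF M C P(1) MP] ..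
          also have "\<dots> = P *\<^sub>v (poly_mat (monom 1 i) ?C *\<^sub>v unit_vec n (j * d))"
            by (rule assoc_mult_mat_vec[OF P(1) poly_mat_carrier[OF C]]) simp
          also have "poly_mat (monom 1 i) ?C *\<^sub>v unit_vec n (j * d) = unit_vec n c"
            using block_companion_power_unit_vec[OF f(2) i(1) j] i(2) by (simp add: n)
          also have "P *\<^sub>v unit_vec n c = col P c" using c by (rule mult_mat_unit_vec[OF P(1)])
          finally have "(poly_mat (monom 1 i) M *\<^sub>v vs ! j) $ r = P $$ (r, c)" using r c P by simp
          moreover have "length vs * d = n" by (simp add: vs_def n)
          ultimately show "krylov d M vs $$ (r, c) = P $$ (r, c)"
            using r c M by (simp add: krylov_def j_def i_def)
        qed (use M P in \<open>auto simp: krylov_def vs_def n\<close>)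
        have "vs \<in> frames d M k"
        proof -
          have "set vs \<subseteq> carrier_vec n" using P by (auto simp: vs_def)
          moreover have "x = 0\<^sub>v n" if x: "x \<in> carrier_vec n" and 0: "P *\<^sub>v x = 0\<^sub>v n" for x
            using mult_mat_vec_cancel[OF Q(1) P(1) Q(3) x] mult_mat_zero_vec[OF Q(1)] 0 by simp
          ultimately show ?thesis using M KP by (auto simp: frames_def vs_def n)
        qed
        then have "(M, vs) \<in> ?S" using M ann by (simp add: annihilated_def)
        then show "P \<in> (\<lambda>(M, vs). krylov d M vs) ` ?S" using KP by force
      qed
    qed
  qed
qed

text \<open>The number of full frames does not depend on \<open>M\<close>; the product is the order
  of \<open>GL(k, q^d)\<close>. Dividing the bijection by it leaves the number of matrices.\<close>

lemma card_annihilated_irreducible: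
  fixes T :: "'a::{finite,field} itself"
  assumes f: "lead_coeff (f :: 'a poly) = 1" "degree f = d" "0 < d" "Factorial_Ring.irreducible f" and n: "n = k * d"
  shows "card (annihilated f n) * (\<Prod>i<k. card (UNIV :: 'a set) ^ n - card (UNIV :: 'a set) ^ (i * d)) = card (GL_set T n)"
proof -
  have fr: "finite (frames d M k) \<and> card (frames d M k) = (\<Prod>i<k. card (UNIV :: 'a set) ^ n - card (UNIV :: 'a set) ^ (i * d))"
    if "M \<in> annihilated f n" for M
    using that by (intro card_frames[OF _ f]) (auto simp: annihilated_def)
  have "card (GL_set T n) = card (Sigma (annihilated f n) (\<lambda>M. frames d M k))"
    using bij_betw_same_card[OF bij_betw_krylov[OF f(1-3) n, of T]] by simp
  also have "\<dots> = (\<Sum>M\<in>annihilated f n. card (frames d M k))"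
    using fr finite_annihilated by (intro card_SigmaI) auto
  also have "\<dots> = (\<Sum>M\<in>annihilated f n. \<Prod>i<k. card (UNIV :: 'a set) ^ n - card (UNIV :: 'a set) ^ (i * d))"
    using fr by (intro sum.cong) auto
  finally show ?thesis by simp
qed

lemma card_field_gt_1: "1 < card (UNIV :: 'a::{finite,field} set)"
proof -
  have "card {0, 1 :: 'a} \<le> card (UNIV :: 'a set)" by (intro card_mono) auto
  then show ?thesis by simp
qed

text \<open>The space would be a vector space over a field of degree \<open>d\<close>. In terms of
  frames: the counting formula produces one of length \<open>n div d + 1\<close>, whose Krylov
  matrix would inject a space of dimension above \<open>n\<close> into dimension
  \<open>n\<close>.\<close>

lemma annihilated_irreducible_empty:
  fixes f :: "'a::{finite,field} poly"
  assumes f: "lead_coeff f = 1" "degree f = d" "0 < d" "Factorial_Ring.irreducible f" and n: "\<not> d dvd n"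
  shows "annihilated f n = {}"
proof (rule ccontr)
  assume "annihilated f n \<noteq> {}"
  then obtain M where M: "M \<in> carrier_mat n n" and ann: "poly_mat f M = 0\<^sub>m n n"
    by (auto simp: annihilated_def)
  let ?q = "card (UNIV :: 'a set)"
  define k where "k = n div d"
  have kd: "k * d < n" "n < Suc k * d"
  proof -
    have "k * d + n mod d = n" by (simp add: k_def)
    moreover have "0 < n mod d" using n by (simp add: dvd_eq_mod_eq_0)
    moreover have "n mod d < d" using f(3) by simp
    ultimately show "k * d < n" "n < Suc k * d" by simp_all
  qed
  \<comment> \<open>Since \<open>d\<close> does not divide \<open>n\<close>, even the last factor,
    with \<open>i = k\<close>, has \<open>k * d\<close> strictly below \<open>n\<close> and is
    positive.\<close>
  have "(\<Prod>i<Suc k. ?q ^ n - ?q ^ (i * d)) \<noteq> 0"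
  proof -
    have pos: "0 < ?q ^ n - ?q ^ (i * d)" if "i < Suc k" for i
    proof -
      have "i * d < n" using mult_le_mono1[of i k d] that kd(1) by linarith
      then show ?thesis using card_field_gt_1[where 'a = 'a] by simp
    qed
    have "0 < (\<Prod>i<Suc k. ?q ^ n - ?q ^ (i * d))" by (rule prod_pos) (rule pos, simp)
    then show ?thesis by (rule gr_implies_not0)
  qed
  then have "frames d M (Suc k) \<noteq> {}" using card_frames[OF M f(1-4) ann, of "Suc k"] by auto
  then obtain vs where vs: "vs \<in> frames d M (Suc k)" by blast
  then have l: "length vs = Suc k" by (simp add: frames_def)
  have K: "krylov d M vs \<in> carrier_mat n (Suc k * d)" using krylov_carrier[OF M, of d vs] l by simp
  note inj = frames_inj_on[OF M vs]
  have "(\<lambda>x. krylov d M vs *\<^sub>v x) ` carrier_vec (Suc k * d) \<subseteq> carrier_vec n" using K by auto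
  then have "card (carrier_vec (Suc k * d) :: 'a vec set) \<le> card (carrier_vec n :: 'a vec set)"
    using card_inj_on_le[OF inj _ finite_carrier_vec] by blast
  then have "Suc k * d \<le> n" using card_field_gt_1[where 'a = 'a] by (simp add: card_carrier_vec)
  then show False using kd(2) by simp
qed

section \<open>Counting conjugates of block diagonal matrices\<close>

lemma card_eq_card_image_mult:
  assumes "finite S" "\<And>x. x \<in> S \<Longrightarrow> card {y \<in> S. F y = F x} = c"
  shows "card S = card (F ` S) * c"
proof -
  have "card S = card (\<Union>z\<in>F ` S. {y \<in> S. F y = z})" by (rule arg_cong[of _ _ card]) auto
  also have "\<dots> = (\<Sum>z\<in>F ` S. card {y \<in> S. F y = z})"
    using assms(1) by (intro card_UN_disjoint) auto
  also have "\<dots> = (\<Sum>z\<in>F ` S. c)" using assms(2) by (intro sum.cong) auto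
  finally show ?thesis by simp
qed

lemma mult_mat_left_cancel:
  fixes P :: "'a::field mat"
  assumes P: "P \<in> carrier_mat n n" "invertible_mat P" and A: "A \<in> carrier_mat n m" and B: "B \<in> carrier_mat n m"
    and eq: "P * A = P * B"
  shows "A = B"
proof -
  note c = mult_mat_cancel_left[OF inv_mat(1)[OF P] P(1) inv_mat(3)[OF P]]
  have "A = inv_mat P * (P * A)" by (rule c[OF A, symmetric])
  also have "\<dots> = B" unfolding eq by (rule c[OF B])
  finally show ?thesis .
qed

lemma conj_eq_iff:
  fixes P :: "'a::field mat"
  assumes P: "P \<in> carrier_mat n n" "invertible_mat P" and D: "D \<in> carrier_mat n n" and M: "M \<in> carrier_mat n n"
  shows "P * D * inv_mat P = M \<longleftrightarrow> M * P = P * D"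
proof
  note i = inv_mat[OF P]
  assume "P * D * inv_mat P = M"
  then have "M * P = P * D * inv_mat P * P" by simp
  also have "\<dots> = P * D * (inv_mat P * P)" by (rule assoc_mult_mat[OF mult_carrier_mat[OF P(1) D] i(1) P(1)])
  finally show "M * P = P * D" using i P D by simp
next
  note i = inv_mat[OF P]
  assume "M * P = P * D"
  then have "P * D * inv_mat P = M * P * inv_mat P" by simp
  also have "\<dots> = M * (P * inv_mat P)" by (rule assoc_mult_mat[OF M P(1) i(1)])
  finally show "P * D * inv_mat P = M" using i M by simp
qed

text \<open>This covers \<open>GL(n, q)\<close> and \<open>A(n, q)\<close> together, so that
  conjugates are counted only once. The parameter is the matrix size, hence \<open>n + 1\<close> for
  \<open>A(n, q)\<close>.\<close>

definition matrix_group :: "nat \<Rightarrow> 'a::field mat set \<Rightarrow> bool" where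
  "matrix_group n H \<longleftrightarrow> finite H \<and> H \<subseteq> carrier_mat n n \<and>
     (\<forall>P\<in>H. invertible_mat P \<and> inv_mat P \<in> H) \<and> (\<forall>P\<in>H. \<forall>Q\<in>H. P * Q \<in> H)"

text \<open>The fibres of \<open>(P, D) \<mapsto> P D P\<^bsup>-1\<^esup>\<close> are the orbits of the centralizer of \<open>J\<close>:
  since every \<open>D\<close> in the family has \<open>e(D) = J\<close>, two pairs with the same image differ by a matrix that commutes with \<open>J\<close>.\<close>

lemma card_conjugates:
  fixes H :: "'a::field mat set"
  assumes H: "matrix_group n H" and finD: "finite DD" and D: "DD \<subseteq> carrier_mat n n"
    and e: "\<And>D. D \<in> DD \<Longrightarrow> poly_mat e D = J"
    and closed: "\<And>Z D. Z \<in> H \<Longrightarrow> Z * J = J * Z \<Longrightarrow> D \<in> DD \<Longrightarrow> inv_mat Z * D * Z \<in> DD"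
  shows "card H * card DD = card ((\<lambda>(P, D). P * D * inv_mat P) ` (H \<times> DD)) * card {Z \<in> H. Z * J = J * Z}"
proof -
  let ?F = "\<lambda>(P, D). P * D * inv_mat P" and ?Z = "{Z \<in> H. Z * J = J * Z}"
  have Hc: "P \<in> carrier_mat n n" "invertible_mat P" "inv_mat P \<in> H" if "P \<in> H" for P
    using H that by (auto simp: matrix_group_def)
  have Hm: "P * Q \<in> H" if "P \<in> H" "Q \<in> H" for P Q using H that by (auto simp: matrix_group_def)
  have fin: "finite (H \<times> DD)" using H finD by (simp add: matrix_group_def)
  have "card {y \<in> H \<times> DD. ?F y = ?F x} = card ?Z" if x: "x \<in> H \<times> DD" for x
  proof -
    obtain P D0 where x_eq: "x = (P, D0)" and P: "P \<in> H" and D0: "D0 \<in> DD" using x by auto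
    have D0c: "D0 \<in> carrier_mat n n" using D D0 by auto
    note Pc = Hc[OF P]
    define M where "M = P * D0 * inv_mat P"
    have M: "M \<in> carrier_mat n n" unfolding M_def using Pc D0c inv_mat(1)[OF Pc(1,2)]
      by (intro mult_carrier_mat)
    have MP: "M * P = P * D0" using conj_eq_iff[OF Pc(1,2) D0c M] by (simp add: M_def)
    have J: "J \<in> carrier_mat n n" using e[OF D0] poly_mat_carrier[OF D0c] by blast
    \<comment> \<open>A centralizing \<open>Z\<close> replaces \<open>P\<close> by
      \<open>P * Z\<close> and undoes this on \<open>D0\<close>. The action is free because
      \<open>P\<close> can be cancelled, so the fibre has the size of the centralizer.\<close>
    have "{y \<in> H \<times> DD. ?F y = ?F x} = (\<lambda>Z. (P * Z, inv_mat Z * D0 * Z)) ` ?Z"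
    proof
      show "{y \<in> H \<times> DD. ?F y = ?F x} \<subseteq> (\<lambda>Z. (P * Z, inv_mat Z * D0 * Z)) ` ?Z"
      proof
        fix y assume y: "y \<in> {y \<in> H \<times> DD. ?F y = ?F x}"
        obtain P' D' where y_eq: "y = (P', D')" by (cases y)
        have P': "P' \<in> H" and D': "D' \<in> DD" and eq: "?F (P', D') = ?F x" using y y_eq by auto
        note Pc' = Hc[OF P']
        have D'c: "D' \<in> carrier_mat n n" using D D' by auto
        have "P' * D' * inv_mat P' = M" using eq by (simp add: x_eq M_def)
        then have MP': "M * P' = P' * D'" using conj_eq_iff[OF Pc'(1,2) D'c M] by simp
        define Z where "Z = inv_mat P * P'"
        have Z: "Z \<in> H" unfolding Z_def using Hm[OF Pc(3) P'] .
        note Zc = Hc[OF Z]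
        have PZ: "P * Z = P'" unfolding Z_def
          using mult_mat_cancel_left[OF Pc(1) inv_mat(1,2)[OF Pc(1,2)] Pc'(1)] .
        \<comment> \<open>Both conjugations carry \<open>J\<close> to the same matrix
          \<open>e(M)\<close>, so \<open>Z\<close> commutes with \<open>J\<close>.\<close>
        have "P * (Z * J) = P' * J"
          unfolding PZ[symmetric] by (rule assoc_mult_mat[OF Pc(1) Zc(1) J, symmetric])
        also have "\<dots> = poly_mat e M * P'"
          using poly_mat_intertwine[OF M D'c Pc'(1) MP', of e] e[OF D'] by simp
        also have "\<dots> = poly_mat e M * P * Z"
          unfolding PZ[symmetric] by (rule assoc_mult_mat[OF poly_mat_carrier[OF M] Pc(1) Zc(1), symmetric])
        also have "\<dots> = P * J * Z"
          using poly_mat_intertwine[OF M D0c Pc(1) MP, of e] e[OF D0] by simp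
        also have "\<dots> = P * (J * Z)" by (rule assoc_mult_mat[OF Pc(1) J Zc(1)])
        finally have ZJ: "Z * J = J * Z"
          by (rule mult_mat_left_cancel[OF Pc(1,2) mult_carrier_mat[OF Zc(1) J] mult_carrier_mat[OF J Zc(1)]])
        have "P * (Z * D') = P' * D'"
          unfolding PZ[symmetric] by (rule assoc_mult_mat[OF Pc(1) Zc(1) D'c, symmetric])
        also have "\<dots> = M * P'" by (rule MP'[symmetric])
        also have "\<dots> = M * P * Z" unfolding PZ[symmetric] by (rule assoc_mult_mat[OF M Pc(1) Zc(1), symmetric])
        also have "\<dots> = P * (D0 * Z)" unfolding MP by (rule assoc_mult_mat[OF Pc(1) D0c Zc(1)])
        finally have "Z * D' = D0 * Z"
          by (rule mult_mat_left_cancel[OF Pc(1,2) mult_carrier_mat[OF Zc(1) D'c] mult_carrier_mat[OF D0c Zc(1)]])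
        then have "inv_mat Z * (D0 * Z) = inv_mat Z * (Z * D')" by simp
        also have "\<dots> = D'"
          by (rule mult_mat_cancel_left[OF inv_mat(1)[OF Zc(1,2)] Zc(1) inv_mat(3)[OF Zc(1,2)] D'c])
        finally have "inv_mat Z * D0 * Z = D'"
          using assoc_mult_mat[OF inv_mat(1)[OF Zc(1,2)] D0c Zc(1)] by simp
        then show "y \<in> (\<lambda>Z. (P * Z, inv_mat Z * D0 * Z)) ` ?Z" using Z ZJ PZ y_eq by force
      qed
      show "(\<lambda>Z. (P * Z, inv_mat Z * D0 * Z)) ` ?Z \<subseteq> {y \<in> H \<times> DD. ?F y = ?F x}"
      proof
        fix y assume "y \<in> (\<lambda>Z. (P * Z, inv_mat Z * D0 * Z)) ` ?Z"
        then obtain Z where y_eq: "y = (P * Z, inv_mat Z * D0 * Z)" and Z: "Z \<in> H" and ZJ: "Z * J = J * Z"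
          by blast
        note Zc = Hc[OF Z] and i = inv_mat[OF Hc(1,2)[OF Z]]
        have PZ: "P * Z \<in> H" by (rule Hm[OF P Z])
        have D1: "inv_mat Z * D0 * Z \<in> DD" using closed[OF Z ZJ D0] .
        then have D1c: "inv_mat Z * D0 * Z \<in> carrier_mat n n" using D by auto
        have "Z * (inv_mat Z * D0 * Z) = Z * (inv_mat Z * (D0 * Z))"
          using assoc_mult_mat[OF i(1) D0c Zc(1)] by simp
        also have "\<dots> = D0 * Z"
          by (rule mult_mat_cancel_left[OF Zc(1) i(1,2) mult_carrier_mat[OF D0c Zc(1)]])
        finally have ZD: "Z * (inv_mat Z * D0 * Z) = D0 * Z" .
        have "M * (P * Z) = P * D0 * Z" unfolding MP[symmetric] by (rule assoc_mult_mat[OF M Pc(1) Zc(1), symmetric])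
        also have "\<dots> = P * (Z * (inv_mat Z * D0 * Z))" unfolding ZD by (rule assoc_mult_mat[OF Pc(1) D0c Zc(1)])
        also have "\<dots> = P * Z * (inv_mat Z * D0 * Z)" by (rule assoc_mult_mat[OF Pc(1) Zc(1) D1c, symmetric])
        finally have "P * Z * (inv_mat Z * D0 * Z) * inv_mat (P * Z) = M"
          using conj_eq_iff[OF Hc(1,2)[OF PZ] D1c M] by simp
        then show "y \<in> {y \<in> H \<times> DD. ?F y = ?F x}"
          using PZ D1 by (simp add: x_eq y_eq M_def)
      qed
    qed
    moreover have "inj_on (\<lambda>Z. (P * Z, inv_mat Z * D0 * Z)) ?Z"
    proof (rule inj_onI)
      fix Z Z' assume "Z \<in> ?Z" "Z' \<in> ?Z" "(P * Z, inv_mat Z * D0 * Z) = (P * Z', inv_mat Z' * D0 * Z')"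
      then show "Z = Z'" using mult_mat_left_cancel[OF Pc(1,2) Hc(1) Hc(1), of Z Z'] by simp
    qed
    ultimately show ?thesis by (simp add: card_image)
  qed
  from card_eq_card_image_mult[OF fin this] show ?thesis by (simp add: card_cartesian_product)
qed

section \<open>Inverses and vectors in block form\<close>

lemma diag2_mult_vec:
  assumes "A \<in> carrier_mat k k" "B \<in> carrier_mat m m" "x \<in> carrier_vec k" "y \<in> carrier_vec m"
  shows "diag2 A B *\<^sub>v (x @\<^sub>v y) = (A *\<^sub>v x) @\<^sub>v (B *\<^sub>v (y :: 'a::field vec))"
proof -
  have "diag2 A B *\<^sub>v (x @\<^sub>v y) = (A *\<^sub>v x + 0\<^sub>m k m *\<^sub>v y) @\<^sub>v (0\<^sub>m m k *\<^sub>v x + B *\<^sub>v y)"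
    using assms by (subst four_block_mat_mult_vec[of _ k k _ m _ m]) auto
  moreover have "A *\<^sub>v x + 0\<^sub>m k m *\<^sub>v y = A *\<^sub>v x" "0\<^sub>m m k *\<^sub>v x + B *\<^sub>v y = B *\<^sub>v y"
    using assms mult_mat_vec_carrier[OF assms(1,3)] mult_mat_vec_carrier[OF assms(2,4)]
    by (simp_all add: zero_mult_mat_vec)
  ultimately show ?thesis by simp
qed

lemma invertible_diag2_iff:
  fixes A B :: "'a::field mat"
  assumes A: "A \<in> carrier_mat k k" and B: "B \<in> carrier_mat m m"
  shows "invertible_mat (diag2 A B) \<longleftrightarrow> invertible_mat A \<and> invertible_mat B"
proof
  assume "invertible_mat A \<and> invertible_mat B"
  then have i: "inv_mat A \<in> carrier_mat k k" "A * inv_mat A = 1\<^sub>m k" "inv_mat B \<in> carrier_mat m m" "B * inv_mat B = 1\<^sub>m m"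
    using inv_mat[OF A] inv_mat[OF B] by auto
  have "diag2 A B * diag2 (inv_mat A) (inv_mat B) = 1\<^sub>m (k + m)"
    unfolding diag2_mult[OF A i(1) B i(3)] using i by simp
  then show "invertible_mat (diag2 A B)"
    by (rule invertible_matI[rotated 2]) (use A B i in auto)
next
  let ?D = "diag2 A B"
  assume inv: "invertible_mat ?D"
  have D: "?D \<in> carrier_mat (k + m) (k + m)" using A B by simp
  note i = inv_mat[OF D inv]
  have inj: "z = 0\<^sub>v (k + m)" if z: "z \<in> carrier_vec (k + m)" "?D *\<^sub>v z = 0\<^sub>v (k + m)" for z
    using mult_mat_vec_cancel[OF i(1) D i(3) z(1)] z(2) mult_mat_zero_vec[OF i(1)] by simp
  show "invertible_mat A \<and> invertible_mat B"
  proof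
    show "invertible_mat A"
    proof (rule invertible_mat_if_inj[OF A])
      fix x assume x: "x \<in> carrier_vec k" and 0: "A *\<^sub>v x = 0\<^sub>v k"
      have "?D *\<^sub>v (x @\<^sub>v 0\<^sub>v m) = 0\<^sub>v (k + m)"
        unfolding diag2_mult_vec[OF A B x zero_carrier_vec] 0 mult_mat_zero_vec[OF B] by auto
      then have "x @\<^sub>v 0\<^sub>v m = 0\<^sub>v k @\<^sub>v 0\<^sub>v m" using inj[of "x @\<^sub>v 0\<^sub>v m"] x by auto
      then show "x = 0\<^sub>v k" using append_vec_eq[OF x, of "0\<^sub>v k"] by simp
    qed
    show "invertible_mat B"
    proof (rule invertible_mat_if_inj[OF B])
      fix x assume x: "x \<in> carrier_vec m" and 0: "B *\<^sub>v x = 0\<^sub>v m"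
      have "?D *\<^sub>v (0\<^sub>v k @\<^sub>v x) = 0\<^sub>v (k + m)"
        unfolding diag2_mult_vec[OF A B zero_carrier_vec x] 0 mult_mat_zero_vec[OF A] by auto
      then have "0\<^sub>v k @\<^sub>v x = 0\<^sub>v k @\<^sub>v 0\<^sub>v m" using inj[of "0\<^sub>v k @\<^sub>v x"] x by auto
      then show "x = 0\<^sub>v m" using append_vec_eq[of "0\<^sub>v k :: 'a vec" k "0\<^sub>v k" x "0\<^sub>v m"] by simp
    qed
  qed
qed

lemma inv_mat_diag2:
  fixes A B :: "'a::field mat"
  assumes A: "A \<in> carrier_mat k k" "invertible_mat A" and B: "B \<in> carrier_mat m m" "invertible_mat B"
  shows "inv_mat (diag2 A B) = diag2 (inv_mat A) (inv_mat B)"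
proof -
  note i = inv_mat[OF A] inv_mat[OF B]
  have "diag2 A B * diag2 (inv_mat A) (inv_mat B) = 1\<^sub>m (k + m)"
    unfolding diag2_mult[OF A(1) i(1) B(1) i(4)] using i by simp
  then show ?thesis by (rule inv_mat_unique[rotated 2]) (use A B i in auto)
qed

lemma inj_on_diag2:
  "inj_on (\<lambda>(A, B). diag2 A B) (carrier_mat k k \<times> carrier_mat m m)"
proof (rule inj_onI, clarify)
  fix A B A' B' :: "'a mat"
  assume c: "A \<in> carrier_mat k k" "B \<in> carrier_mat m m" "A' \<in> carrier_mat k k" "B' \<in> carrier_mat m m"
    and eq: "diag2 A B = diag2 A' B'"
  show "A = A' \<and> B = B'"
    using four_block_mat_inject(1,4)[OF eq, of k k m m] c by auto
qed

lemma diag2_commute_projection: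
  fixes A B :: "'a::field mat"
  assumes "A \<in> carrier_mat k k" "B \<in> carrier_mat m m"
  shows "diag2 A B * diag2 (1\<^sub>m k) (0\<^sub>m m m) = diag2 (1\<^sub>m k) (0\<^sub>m m m) * diag2 A B"
  unfolding diag2_mult[OF assms(1) one_carrier_mat assms(2) zero_carrier_mat]
    diag2_mult[OF one_carrier_mat assms(1) zero_carrier_mat assms(2)]
  using assms by simp

section \<open>The two matrix groups and families of block diagonal matrices\<close>

lemma matrix_group_GL_set: "matrix_group n (GL_set T n)"
  unfolding matrix_group_def using finite_GL_set inv_mat(1) invertible_inv_mat invertible_mult_mat(1)
  by (auto simp: GL_set_def)

text \<open>The entry conditions say that the first unit vector is fixed. In this form closure under
  products and inverses and the description of centralizers are immediate.\<close>

lemma A_set_iff: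
  "P \<in> A_set T n \<longleftrightarrow> P \<in> GL_set T (n + 1) \<and> P *\<^sub>v unit_vec (n + 1) 0 = unit_vec (n + 1) 0"
proof (cases "P \<in> GL_set T (n + 1)")
  case True
  then have P: "P \<in> carrier_mat (n + 1) (n + 1)" by (simp add: GL_set_def)
  have "col P 0 = unit_vec (n + 1) 0 \<longleftrightarrow> P $$ (0, 0) = 1 \<and> (\<forall>j\<in>{1..n}. P $$ (j, 0) = 0)"
  proof
    assume c: "col P 0 = unit_vec (n + 1) 0"
    have "P $$ (j, 0) = (if j = 0 then 1 else 0)" if "j < n + 1" for j
      using arg_cong[OF c, of "\<lambda>v. vec_index v j"] that P by auto
    then show "P $$ (0, 0) = 1 \<and> (\<forall>j\<in>{1..n}. P $$ (j, 0) = 0)" by auto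
  next
    assume h: "P $$ (0, 0) = 1 \<and> (\<forall>j\<in>{1..n}. P $$ (j, 0) = 0)"
    show "col P 0 = unit_vec (n + 1) 0"
    proof (rule eq_vecI)
      fix j assume "j < dim_vec (unit_vec (n + 1) 0 :: 'a vec)"
      then show "col P 0 $ j = unit_vec (n + 1) 0 $ j" using h P by (cases "j = 0") auto
    qed (use P in auto)
  qed
  then show ?thesis using True mult_mat_unit_vec[OF P, of 0] by (simp add: A_set_def)
qed (simp add: A_set_def)

lemma matrix_group_A_set: "matrix_group (n + 1) (A_set T n)"
  unfolding matrix_group_def
proof (intro conjI ballI)
  show "finite (A_set T n)" using finite_GL_set[of T "n + 1"] by (simp add: A_set_def)
  show "A_set T n \<subseteq> carrier_mat (n + 1) (n + 1)" by (auto simp: A_set_def GL_set_def)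
  fix P assume "P \<in> A_set T n"
  then have P: "P \<in> carrier_mat (n + 1) (n + 1)" "invertible_mat P" and Pe: "P *\<^sub>v unit_vec (n + 1) 0 = unit_vec (n + 1) 0"
    by (auto simp: A_set_iff GL_set_def)
  show "invertible_mat P" by (rule P)
  have "inv_mat P *\<^sub>v unit_vec (n + 1) 0 = inv_mat P *\<^sub>v (P *\<^sub>v unit_vec (n + 1) 0)" by (simp only: Pe)
  also have "\<dots> = unit_vec (n + 1) 0"
    by (rule mult_mat_vec_cancel[OF inv_mat(1)[OF P] P(1) inv_mat(3)[OF P]]) simp
  finally show "inv_mat P \<in> A_set T n"
    using inv_mat(1)[OF P] invertible_inv_mat[OF P] by (simp add: A_set_iff GL_set_def)
  fix Q assume "Q \<in> A_set T n"
  then have Q: "Q \<in> carrier_mat (n + 1) (n + 1)" "invertible_mat Q" and Qe: "Q *\<^sub>v unit_vec (n + 1) 0 = unit_vec (n + 1) 0"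
    by (auto simp: A_set_iff GL_set_def)
  have "P * Q *\<^sub>v unit_vec (n + 1) 0 = P *\<^sub>v (Q *\<^sub>v unit_vec (n + 1) 0)"
    by (rule assoc_mult_mat_vec[OF P(1) Q(1)]) simp
  also have "\<dots> = unit_vec (n + 1) 0" unfolding Qe Pe ..
  finally show "P * Q \<in> A_set T n"
    using invertible_mult_mat(1)[OF P Q] mult_carrier_mat[OF P(1) Q(1)] by (simp add: A_set_iff GL_set_def)
qed

lemma annihilatedD: "M \<in> annihilated p n \<Longrightarrow> M \<in> carrier_mat n n" "M \<in> annihilated p n \<Longrightarrow> poly_mat p M = 0\<^sub>m n n"
  by (auto simp: annihilated_def)

lemma annihilated_dvd:
  assumes "p dvd p'" shows "annihilated p n \<subseteq> annihilated p' n"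
proof
  fix M assume "M \<in> annihilated p n"
  note M = annihilatedD[OF this]
  obtain c where "p' = p * c" using assms unfolding dvd_def by blast
  then have "poly_mat p' M = 0\<^sub>m n n"
    using poly_mat_carrier[OF M(1), of c] by (simp add: poly_mat_mult[OF M(1)] M(2))
  then show "M \<in> annihilated p' n" using M by (simp add: annihilated_def)
qed

lemma annihilated_conj:
  fixes M :: "'a::field mat"
  assumes M: "M \<in> annihilated p n" and P: "P \<in> carrier_mat n n" "Q \<in> carrier_mat n n" "Q * P = 1\<^sub>m n"
  shows "P * M * Q \<in> annihilated p n"
  using poly_mat_conj[OF annihilatedD(1)[OF M] P, of p] annihilatedD[OF M] P
  by (simp add: annihilated_def)

definition block_pairs :: "'a::field mat set \<Rightarrow> 'a mat set \<Rightarrow> 'a mat set" where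
  "block_pairs A B = (\<lambda>(A, B). diag2 A B) ` (A \<times> B)"

lemma card_block_pairs:
  assumes "A \<subseteq> carrier_mat k k" "B \<subseteq> carrier_mat m m"
  shows "card (block_pairs A B) = card A * card B"
proof -
  have "inj_on (\<lambda>(A, B). diag2 A B) (A \<times> B)"
    by (rule inj_on_subset[OF inj_on_diag2[of k m]]) (use assms in auto)
  then show ?thesis by (simp add: block_pairs_def card_image card_cartesian_product)
qed

lemma block_pairs_annihilated:
  assumes "D \<in> block_pairs (annihilated f k) (annihilated g m)"
  shows "D \<in> annihilated (f * g) (k + m)"
proof -
  obtain A B where AB: "A \<in> annihilated f k" "B \<in> annihilated g m" and D: "D = diag2 A B"
    using assms by (auto simp: block_pairs_def)
  have A: "A \<in> carrier_mat k k" "poly_mat (f * g) A = 0\<^sub>m k k"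
    and B: "B \<in> carrier_mat m m" "poly_mat (f * g) B = 0\<^sub>m m m"
    using annihilated_dvd[of f "f * g"] annihilated_dvd[of g "f * g"] AB by (auto simp: annihilated_def)
  show ?thesis unfolding annihilated_def using A B poly_mat_diag2[OF A(1) B(1), of "f * g"]
    by (simp add: D)
qed

text \<open>\<open>b * g\<close> is \<open>1\<close> modulo \<open>f\<close> and \<open>0\<close>
  modulo \<open>g\<close>. A single polynomial thus gives the same projection on the whole family,
  as the fibre count requires.\<close>

lemma poly_mat_projection:
  fixes f g :: "'a::field poly"
  assumes bez: "a * f + b * g = 1" and D: "D \<in> block_pairs (annihilated f k) (annihilated g m)"
  shows "poly_mat (b * g) D = diag2 (1\<^sub>m k) (0\<^sub>m m m)"
proof -
  obtain A B where AB: "A \<in> annihilated f k" "B \<in> annihilated g m" and D: "D = diag2 A B"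
    using D by (auto simp: block_pairs_def)
  note A = annihilatedD[OF AB(1)] and B = annihilatedD[OF AB(2)]
  have "poly_mat (a * f) A = 0\<^sub>m k k"
    using poly_mat_carrier[OF A(1), of a] by (simp add: poly_mat_mult[OF A(1)] A(2))
  then have "poly_mat (b * g) A = 1\<^sub>m k"
    using arg_cong[OF bez, of "\<lambda>p. poly_mat p A"] poly_mat_carrier[OF A(1), of "b * g"]
    by (simp add: poly_mat_add[OF A(1)] poly_mat_1[OF A(1)])
  moreover have "poly_mat (b * g) B = 0\<^sub>m m m"
    using poly_mat_carrier[OF B(1), of b] by (simp add: poly_mat_mult[OF B(1)] B(2))
  ultimately show ?thesis unfolding D poly_mat_diag2[OF A(1) B(1)] by simp
qed

text \<open>The rank is the multiplicity of the root \<open>1\<close> in the characteristic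
  polynomial, a similarity invariant.\<close>

lemma projection_similar_unique:
  fixes E :: "'a::field mat"
  assumes "similar_mat E (diag2 (1\<^sub>m k) (0\<^sub>m m m))" "similar_mat E (diag2 (1\<^sub>m k') (0\<^sub>m m' m'))"
  shows "k = k'"
proof -
  have cp: "char_poly (diag2 (1\<^sub>m k) (0\<^sub>m m m) :: 'a mat) = [:-1, 1:] ^ k * [:0, 1:] ^ m" for k m
  proof -
    let ?J = "diag2 (1\<^sub>m k) (0\<^sub>m m m) :: 'a mat"
    have J: "?J \<in> carrier_mat (k + m) (k + m)" by simp
    have "upper_triangular ?J" unfolding upper_triangular_def by auto
    moreover have "diag_mat ?J = replicate k 1 @ replicate m 0"
      by (intro nth_equalityI) (auto simp: diag_mat_def nth_append)
    ultimately show ?thesis using char_poly_upper_triangular[OF J] by simp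
  qed
  have "similar_mat (diag2 (1\<^sub>m k) (0\<^sub>m m m)) (diag2 (1\<^sub>m k') (0\<^sub>m m' m') :: 'a mat)"
    using assms similar_mat_sym similar_mat_trans by blast
  from char_poly_similar[OF this]
  have eq: "[:-1, 1:] ^ k * [:0, 1:] ^ m = [:-1, 1:] ^ k' * ([:0, 1:] ^ m' :: 'a poly)" unfolding cp .
  have "order 1 ([:-1, 1:] ^ k * [:0, 1:] ^ m :: 'a poly) = k" for k m
  proof -
    have "order 1 ([:0, 1:] ^ m :: 'a poly) = 0" by (rule order_0I) simp
    then show ?thesis using order_power_n_n[of "1 :: 'a" k] by (subst order_mult) auto
  qed
  from this[of k m] this[of k' m'] show ?thesis unfolding eq by simp
qed

text \<open>The families for different \<open>i\<close> are disjoint: \<open>(b g)(M)\<close> is a projection of rank \<open>\<kappa> i\<close>.\<close>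

lemma card_UN_conjugates:
  fixes H :: "'a::{finite,field} mat set" and D :: "nat \<Rightarrow> 'a mat set"
  assumes H: "matrix_group n H" and bez: "a * f + b * g = 1"
    and k: "\<And>i. i \<in> I \<Longrightarrow> \<kappa> i + \<mu> i = n" and inj: "inj_on \<kappa> I" and I: "finite I"
    and D: "\<And>i. i \<in> I \<Longrightarrow> D i = block_pairs (annihilated f (\<kappa> i)) (annihilated g (\<mu> i))"
  shows "real (card (\<Union>i\<in>I. (\<lambda>(P, D). P * D * inv_mat P) ` (H \<times> D i))) =
    (\<Sum>i\<in>I. real (card H) * (real (card (annihilated f (\<kappa> i))) * real (card (annihilated g (\<mu> i)))) /
      real (card {Z \<in> H. Z * diag2 (1\<^sub>m (\<kappa> i)) (0\<^sub>m (\<mu> i) (\<mu> i)) = diag2 (1\<^sub>m (\<kappa> i)) (0\<^sub>m (\<mu> i) (\<mu> i)) * Z}))"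
    (is "real (card (\<Union>i\<in>I. ?Y i)) = (\<Sum>i\<in>I. real (card H) * ?c i / real (card (?Z i)))")
proof -
  let ?J = "\<lambda>i. diag2 (1\<^sub>m (\<kappa> i)) (0\<^sub>m (\<mu> i) (\<mu> i)) :: 'a mat"
  have Hc: "P \<in> carrier_mat n n" "invertible_mat P" if "P \<in> H" for P
    using H that by (auto simp: matrix_group_def)
  have Dc: "D i \<subseteq> carrier_mat n n" if "i \<in> I" for i
    using block_pairs_annihilated[of _ f "\<kappa> i" g "\<mu> i"] that k[OF that] D[OF that] by (auto simp: annihilated_def)
  have finD: "finite (D i)" if "i \<in> I" for i using Dc[OF that] finite_carrier_mat finite_subset by blast
  have finY: "finite (?Y i)" if "i \<in> I" for i
    using H finD[OF that] by (auto simp: matrix_group_def)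
  have e: "poly_mat (b * g) W = ?J i" if "i \<in> I" "W \<in> D i" for i W
    using poly_mat_projection[OF bez] that D by blast
  have sim: "similar_mat (poly_mat (b * g) M) (?J i)" if i: "i \<in> I" and "M \<in> ?Y i" for M i
  proof -
    obtain P W where P: "P \<in> H" and W: "W \<in> D i" and M: "M = P * W * inv_mat P" using \<open>M \<in> ?Y i\<close> by auto
    note Pc = Hc[OF P] and i' = inv_mat[OF Hc(1,2)[OF P]]
    have Xc: "W \<in> carrier_mat n n" using Dc[OF i] W by auto
    have "poly_mat (b * g) M = P * ?J i * inv_mat P"
      unfolding M poly_mat_conj[OF Xc Pc(1) i'(1,3)] e[OF i W] ..
    then show ?thesis using Pc i' poly_mat_carrier[OF Xc, of "b * g"] e[OF i W]
      by (intro similar_matI[of _ _ P "inv_mat P" n]) auto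
  qed
  have disj: "?Y i \<inter> ?Y j = {}" if "i \<in> I" "j \<in> I" "i \<noteq> j" for i j
  proof (rule ccontr)
    assume "?Y i \<inter> ?Y j \<noteq> {}"
    then obtain M where "M \<in> ?Y i" "M \<in> ?Y j" by blast
    then have "\<kappa> i = \<kappa> j" using projection_similar_unique sim that by blast
    then show False using inj that by (auto dest: inj_onD)
  qed
  have cardY: "real (card (?Y i)) = real (card H) * ?c i / real (card (?Z i))" if i: "i \<in> I" for i
  proof -
    \<comment> \<open>A matrix commuting with the projection is block diagonal, so it conjugates
      each block separately and preserves both annihilation conditions.\<close>
    have "inv_mat Z * W * Z \<in> D i" if Z: "Z \<in> H" and ZJ: "Z * ?J i = ?J i * Z" and W: "W \<in> D i" for Z W
    proof -
      obtain A B where AB: "A \<in> annihilated f (\<kappa> i)" "B \<in> annihilated g (\<mu> i)" and Xeq: "W = diag2 A B"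
        using W D[OF i] by (auto simp: block_pairs_def)
      note A = annihilatedD(1)[OF AB(1)] and B = annihilatedD(1)[OF AB(2)]
      have "Z \<in> carrier_mat (\<kappa> i + \<mu> i) (\<kappa> i + \<mu> i)" using Hc[OF Z] k[OF i] by simp
      then obtain R S where RS: "R \<in> carrier_mat (\<kappa> i) (\<kappa> i)" "S \<in> carrier_mat (\<mu> i) (\<mu> i)" "Z = diag2 R S"
        using commute_projection_imp_diag2 ZJ by blast
      have inv: "invertible_mat R" "invertible_mat S"
        using invertible_diag2_iff[OF RS(1,2)] Hc(2)[OF Z] RS(3) by auto
      note iR = inv_mat[OF RS(1) inv(1)] and iS = inv_mat[OF RS(2) inv(2)]
      have "inv_mat Z * W * Z = diag2 (inv_mat R * A * R) (inv_mat S * B * S)"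
        unfolding RS(3) Xeq inv_mat_diag2[OF RS(1) inv(1) RS(2) inv(2)]
          diag2_mult[OF iR(1) A iS(1) B]
          diag2_mult[OF mult_carrier_mat[OF iR(1) A] RS(1) mult_carrier_mat[OF iS(1) B] RS(2)] ..
      moreover have "inv_mat R * A * R \<in> annihilated f (\<kappa> i)" "inv_mat S * B * S \<in> annihilated g (\<mu> i)"
        using annihilated_conj[OF AB(1) iR(1) RS(1) iR(2)] annihilated_conj[OF AB(2) iS(1) RS(2) iS(2)] by auto
      ultimately show ?thesis unfolding D[OF i] block_pairs_def
        by (intro image_eqI[of _ _ "(inv_mat R * A * R, inv_mat S * B * S)"]) auto
    qed
    from card_conjugates[OF H finD[OF i] Dc[OF i] e[OF i] this]
    have "card H * card (D i) = card (?Y i) * card (?Z i)" .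
    moreover have "card (D i) = card (annihilated f (\<kappa> i)) * card (annihilated g (\<mu> i))"
      unfolding D[OF i] by (rule card_block_pairs[of _ "\<kappa> i" _ "\<mu> i"]) (auto simp: annihilated_def)
    ultimately have eq: "card H * (card (annihilated f (\<kappa> i)) * card (annihilated g (\<mu> i))) = card (?Y i) * card (?Z i)"
      by simp
    show ?thesis
    \<comment> \<open>If there are conjugates, then \<open>H\<close> has an element and hence
      contains the identity. The centralizer is then nonempty and may be divided by.\<close>
    proof (cases "?Y i = {}")
      case True
      then have "card (?Y i) = 0" by (simp only: True card.empty)
      then have "card H * (card (annihilated f (\<kappa> i)) * card (annihilated g (\<mu> i))) = 0" using eq by simp
      then have "real (card H) * ?c i = 0" by auto
      then show ?thesis using \<open>card (?Y i) = 0\<close> by simp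
    next
      case False
      then have "H \<noteq> {}" by auto
      then obtain P where P: "P \<in> H" by blast
      then have "P * inv_mat P \<in> H" using H by (auto simp: matrix_group_def)
      then have "1\<^sub>m n \<in> H" using inv_mat(2)[OF Hc[OF P]] by simp
      moreover have "?J i \<in> carrier_mat n n" using k[OF i] by auto
      then have "1\<^sub>m n * ?J i = ?J i * 1\<^sub>m n" using left_mult_one_mat right_mult_one_mat by metis
      ultimately have "1\<^sub>m n \<in> ?Z i" by blast
      moreover have "finite (?Z i)" using H by (auto simp: matrix_group_def)
      ultimately have "card (?Z i) \<noteq> 0" by auto
      then show ?thesis using arg_cong[OF eq, of real] by (simp add: field_simps)
    qed
  qed
  have "card (\<Union>i\<in>I. ?Y i) = (\<Sum>i\<in>I. card (?Y i))"
    by (rule card_UN_disjoint[OF I]) (use finY disj in auto)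
  then have "real (card (\<Union>i\<in>I. ?Y i)) = (\<Sum>i\<in>I. real (card (?Y i)))" by (simp only: of_nat_sum)
  also have "\<dots> = (\<Sum>i\<in>I. real (card H) * ?c i / real (card (?Z i)))" by (rule sum.cong[OF refl cardY])
  finally show ?thesis .
qed

lemma annihilated_linear: "annihilated [:-a, 1:] n = {a \<cdot>\<^sub>m 1\<^sub>m n :: 'a::field mat}"
proof
  show "annihilated [:-a, 1:] n \<subseteq> {a \<cdot>\<^sub>m 1\<^sub>m n}"
  proof
    fix A assume A: "A \<in> annihilated [:-a, 1:] n"
    note Ac = annihilatedD[OF A]
    have p: "poly_mat [:-a, 1:] A = (-a) \<cdot>\<^sub>m 1\<^sub>m n + A"
      using Ac(1) by (simp add: poly_mat_pCons[OF Ac(1)] poly_mat_const[OF Ac(1)] one_pCons[symmetric])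
    have "A $$ (i, j) = (a \<cdot>\<^sub>m 1\<^sub>m n) $$ (i, j)" if "i < n" "j < n" for i j
    proof -
      have "((-a) \<cdot>\<^sub>m 1\<^sub>m n + A) $$ (i, j) = 0" using Ac(2) that unfolding p by simp
      then show ?thesis using that Ac(1) by (cases "i = j") (auto simp: add_eq_0_iff)
    qed
    then have "A = a \<cdot>\<^sub>m 1\<^sub>m n" using Ac(1) by (intro eq_matI) auto
    then show "A \<in> {a \<cdot>\<^sub>m 1\<^sub>m n}" by simp
  qed
  have "poly_mat [:-a, 1:] (a \<cdot>\<^sub>m 1\<^sub>m n) = 0\<^sub>m n n"
    by (intro eq_matI) (auto simp: poly_mat_pCons[of _ n])
  then show "{a \<cdot>\<^sub>m 1\<^sub>m n} \<subseteq> annihilated [:-a, 1:] n" by (simp add: annihilated_def)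
qed

lemma annihilated_X_minus_1: "annihilated [:-1, 1:] n = {1\<^sub>m n :: 'a::field mat}"
proof -
  have "(1 :: 'a) \<cdot>\<^sub>m 1\<^sub>m n = 1\<^sub>m n" by (intro eq_matI) auto
  then show ?thesis using annihilated_linear[of "1 :: 'a" n] by simp
qed

section \<open>Centralizers of the projections\<close>

lemma centralizer_projection_GL:
  fixes T :: "'a::{finite,field} itself"
  assumes "k + m = n"
  shows "{Z \<in> GL_set T n. Z * diag2 (1\<^sub>m k) (0\<^sub>m m m) = diag2 (1\<^sub>m k) (0\<^sub>m m m) * Z}
    = block_pairs (GL_set T k) (GL_set T m)" (is "?L = ?R")
proof
  show "?L \<subseteq> ?R"
  proof
    fix Z assume Z: "Z \<in> ?L"
    then obtain R S where RS: "R \<in> carrier_mat k k" "S \<in> carrier_mat m m" "Z = diag2 R S"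
      using commute_projection_imp_diag2[of Z k m] assms by (auto simp: GL_set_def)
    then have "invertible_mat R" "invertible_mat S"
      using invertible_diag2_iff[OF RS(1,2)] Z by (auto simp: GL_set_def)
    then show "Z \<in> ?R" unfolding block_pairs_def
      by (intro image_eqI[of _ _ "(R, S)"]) (use RS in \<open>auto simp: GL_set_def\<close>)
  qed
  show "?R \<subseteq> ?L"
  proof
    fix Z assume "Z \<in> ?R"
    then obtain R S where RS: "R \<in> carrier_mat k k" "S \<in> carrier_mat m m" "Z = diag2 R S"
      "invertible_mat R" "invertible_mat S" by (auto simp: block_pairs_def GL_set_def)
    have "Z \<in> GL_set T n"
      using invertible_diag2_iff[OF RS(1,2)] RS assms by (auto simp: GL_set_def)
    then show "Z \<in> ?L" using diag2_commute_projection[OF RS(1,2)] RS(3) by blast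
  qed
qed

lemma diag2_fixes_unit_vec:
  fixes R :: "'a::field mat"
  assumes R: "R \<in> carrier_mat (k + 1) (k + 1)" and S: "S \<in> carrier_mat m m"
  shows "diag2 R S *\<^sub>v unit_vec (k + 1 + m) 0 = unit_vec (k + 1 + m) 0 \<longleftrightarrow> R *\<^sub>v unit_vec (k + 1) 0 = unit_vec (k + 1) 0"
proof -
  have u: "unit_vec (k + 1 + m) 0 = unit_vec (k + 1) 0 @\<^sub>v (0\<^sub>v m :: 'a vec)"
    by (intro eq_vecI) (auto simp: unit_vec_def)
  have "diag2 R S *\<^sub>v unit_vec (k + 1 + m) 0 = (R *\<^sub>v unit_vec (k + 1) 0) @\<^sub>v 0\<^sub>v m"
    unfolding u diag2_mult_vec[OF R S unit_vec_carrier zero_carrier_vec] mult_mat_zero_vec[OF S] ..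
  moreover have "R *\<^sub>v unit_vec (k + 1) 0 \<in> carrier_vec (k + 1)" using R by simp
  ultimately show ?thesis
    unfolding u using append_vec_eq[of "R *\<^sub>v unit_vec (k + 1) 0" "k + 1" "unit_vec (k + 1) 0" "0\<^sub>v m" "0\<^sub>v m"] by simp
qed

text \<open>Intersect the centralizer in the larger general linear group with the stabilizer of the
  first unit vector. That vector lies in the first block, of size \<open>k + 1\<close>, so the
  condition falls on this block alone.\<close>

lemma centralizer_projection_A:
  fixes T :: "'a::{finite,field} itself"
  assumes n: "k + m = n"
  shows "{Z \<in> A_set T n. Z * diag2 (1\<^sub>m (k + 1)) (0\<^sub>m m m) = diag2 (1\<^sub>m (k + 1)) (0\<^sub>m m m) * Z}
    = block_pairs (A_set T k) (GL_set T m)" (is "?L = ?R")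
proof -
  have n': "k + 1 + m = n + 1" using n by simp
  have "?L = {Z \<in> block_pairs (GL_set T (k + 1)) (GL_set T m). Z *\<^sub>v unit_vec (n + 1) 0 = unit_vec (n + 1) 0}"
    unfolding centralizer_projection_GL[OF n', symmetric] by (auto simp: A_set_iff)
  also have "\<dots> = ?R"
  proof
    show "\<dots> \<subseteq> ?R"
    proof
      fix Z assume Z: "Z \<in> {Z \<in> block_pairs (GL_set T (k + 1)) (GL_set T m). Z *\<^sub>v unit_vec (n + 1) 0 = unit_vec (n + 1) 0}"
      then obtain R S where RS: "R \<in> GL_set T (k + 1)" "S \<in> GL_set T m" and Zeq: "Z = diag2 R S"
        by (auto simp: block_pairs_def)
      have "R *\<^sub>v unit_vec (k + 1) 0 = unit_vec (k + 1) 0"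
        using diag2_fixes_unit_vec[of R k S m, unfolded n'] RS Z unfolding Zeq GL_set_def by blast
      then show "Z \<in> ?R" unfolding block_pairs_def
        by (intro image_eqI[of _ _ "(R, S)"]) (use RS Zeq in \<open>auto simp: A_set_iff\<close>)
    qed
    show "?R \<subseteq> {Z \<in> block_pairs (GL_set T (k + 1)) (GL_set T m). Z *\<^sub>v unit_vec (n + 1) 0 = unit_vec (n + 1) 0}"
    proof
      fix Z assume "Z \<in> ?R"
      then obtain R S where RS: "R \<in> GL_set T (k + 1)" "S \<in> GL_set T m" and Re: "R *\<^sub>v unit_vec (k + 1) 0 = unit_vec (k + 1) 0"
        and Zeq: "Z = diag2 R S"
        by (auto simp: block_pairs_def A_set_iff)
      have "Z *\<^sub>v unit_vec (n + 1) 0 = unit_vec (n + 1) 0"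
        using diag2_fixes_unit_vec[of R k S m, unfolded n'] RS Re unfolding Zeq GL_set_def by blast
      moreover have "Z \<in> block_pairs (GL_set T (k + 1)) (GL_set T m)"
        unfolding block_pairs_def by (intro image_eqI[of _ _ "(R, S)"]) (use RS Zeq in auto)
      ultimately show "Z \<in> {Z \<in> block_pairs (GL_set T (k + 1)) (GL_set T m). Z *\<^sub>v unit_vec (n + 1) 0 = unit_vec (n + 1) 0}"
        by blast
    qed
  qed
  finally show ?thesis .
qed

section \<open>Decomposition into conjugates and the convolution formulas\<close>

lemma card_GL_set_pos: "card (GL_set T n) \<noteq> 0"
proof -
  have "1\<^sub>m n \<in> GL_set T n" by (auto simp: GL_set_def intro: invertible_matI[of _ n "1\<^sub>m n"])
  then show ?thesis using finite_GL_set[of T n] by (metis card_0_eq empty_iff)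
qed

lemma card_A_set_pos: "card (A_set T n) \<noteq> 0"
proof -
  have "1\<^sub>m (n + 1) \<in> A_set T n"
    by (auto simp: A_set_iff GL_set_def simp del: One_nat_def intro: invertible_matI[of _ "n + 1" "1\<^sub>m (n + 1)"])
  moreover have "finite (A_set T n)" using matrix_group_A_set[of n T] by (simp add: matrix_group_def)
  ultimately show ?thesis by (metis card_0_eq empty_iff)
qed

lemma similar_mat_obtain:
  fixes M :: "'a::field mat"
  assumes "similar_mat M N" "M \<in> carrier_mat n n"
  obtains P where "P \<in> carrier_mat n n" "invertible_mat P" "N \<in> carrier_mat n n" "M = P * N * inv_mat P"
proof -
  obtain n' P Q where PQ: "{M, N, P, Q} \<subseteq> carrier_mat n' n'" "P * Q = 1\<^sub>m n'" "M = P * N * Q"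
    using similar_matD[OF assms(1)] by blast
  have "n' = n" using PQ(1) assms(2) by auto
  then have c: "N \<in> carrier_mat n n" "P \<in> carrier_mat n n" "Q \<in> carrier_mat n n" "P * Q = 1\<^sub>m n" using PQ by auto
  show ?thesis
    by (rule that[OF c(2) invertible_matI[OF c(2-4)] c(1)]) (simp add: inv_mat_unique[OF c(2-4)] PQ(3))
qed

lemma annihilated_mult_eq_UN:
  fixes T :: "'a::{finite,field} itself"
  assumes bez: "a * f + b * g = (1 :: 'a poly)"
  shows "annihilated (f * g) n = (\<Union>k\<in>{..n}. (\<lambda>(P, D). P * D * inv_mat P) `
    (GL_set T n \<times> block_pairs (annihilated f k) (annihilated g (n - k))))" (is "_ = (\<Union>k\<in>{..n}. ?Y k)")
proof
  show "annihilated (f * g) n \<subseteq> (\<Union>k\<in>{..n}. ?Y k)"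
  proof
    fix M assume "M \<in> annihilated (f * g) n"
    note M = annihilatedD[OF this]
    obtain k m A B where km: "n = k + m" and AB: "A \<in> carrier_mat k k" "B \<in> carrier_mat m m"
      "poly_mat f A = 0\<^sub>m k k" "poly_mat g B = 0\<^sub>m m m" and sim: "similar_mat M (diag2 A B)"
      using coprime_block_decomposition[OF M(1) bez M(2)] by blast
    obtain P where P: "P \<in> carrier_mat n n" "invertible_mat P" "M = P * diag2 A B * inv_mat P"
      using similar_mat_obtain[OF sim M(1)] by blast
    have "diag2 A B \<in> block_pairs (annihilated f k) (annihilated g (n - k))"
      unfolding block_pairs_def by (intro image_eqI[of _ _ "(A, B)"]) (use AB km in \<open>auto simp: annihilated_def\<close>)
    then have "M \<in> ?Y k"
      by (intro image_eqI[of _ _ "(P, diag2 A B)"]) (use P in \<open>auto simp: GL_set_def\<close>)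
    then show "M \<in> (\<Union>k\<in>{..n}. ?Y k)" by (rule UN_I[rotated]) (use km in simp)
  qed
  show "(\<Union>k\<in>{..n}. ?Y k) \<subseteq> annihilated (f * g) n"
  proof
    fix M assume "M \<in> (\<Union>k\<in>{..n}. ?Y k)"
    then obtain k P D where k: "k \<le> n" and P: "P \<in> carrier_mat n n" "invertible_mat P"
      and D: "D \<in> block_pairs (annihilated f k) (annihilated g (n - k))" and M: "M = P * D * inv_mat P"
      by (auto simp: GL_set_def)
    have "D \<in> annihilated (f * g) n" using block_pairs_annihilated[OF D] k by simp
    then show "M \<in> annihilated (f * g) n"
      unfolding M by (rule annihilated_conj[OF _ P(1) inv_mat(1,3)[OF P]])
  qed
qed

text \<open>The conjugates of a family with blocks of sizes \<open>k\<close> and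
  \<open>n - k\<close> are counted by the order of \<open>GL(n, q)\<close> over the order of the
  centralizer \<open>GL(k, q)\<close> times \<open>GL(n - k, q)\<close>. After division by the group
  order this is a Cauchy product.\<close>

lemma card_annihilated_mult:
  fixes T :: "'a::{finite,field} itself"
  assumes bez: "a * f + b * g = (1 :: 'a poly)"
  shows "real (card (annihilated (f * g) n)) / real (card (GL_set T n)) =
    (\<Sum>k\<le>n. real (card (annihilated f k)) / real (card (GL_set T k)) *
      (real (card (annihilated g (n - k))) / real (card (GL_set T (n - k)))))"
proof -
  have cent: "card {Z \<in> GL_set T n. Z * diag2 (1\<^sub>m k) (0\<^sub>m (n - k) (n - k)) = diag2 (1\<^sub>m k) (0\<^sub>m (n - k) (n - k)) * Z}
      = card (GL_set T k) * card (GL_set T (n - k))" if "k \<in> {..n}" for k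
    using that centralizer_projection_GL[of k "n - k" n T]
      card_block_pairs[of "GL_set T k" k "GL_set T (n - k)" "n - k"] by (simp add: GL_set_def)
  have "real (card (annihilated (f * g) n)) = (\<Sum>k\<in>{..n}. real (card (GL_set T n)) *
      (real (card (annihilated f k)) * real (card (annihilated g (n - k)))) /
      real (card {Z \<in> GL_set T n. Z * diag2 (1\<^sub>m k) (0\<^sub>m (n - k) (n - k)) = diag2 (1\<^sub>m k) (0\<^sub>m (n - k) (n - k)) * Z}))"
    unfolding annihilated_mult_eq_UN[OF bez, of n T]
    by (rule card_UN_conjugates[OF matrix_group_GL_set bez]) auto
  also have "\<dots> = (\<Sum>k\<in>{..n}. real (card (GL_set T n)) * (real (card (annihilated f k)) / real (card (GL_set T k)) *
      (real (card (annihilated g (n - k))) / real (card (GL_set T (n - k))))))"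
    by (rule sum.cong[OF refl], subst cent) auto
  finally have "real (card (annihilated (f * g) n)) = real (card (GL_set T n)) *
      (\<Sum>k\<in>{..n}. real (card (annihilated f k)) / real (card (GL_set T k)) *
      (real (card (annihilated g (n - k))) / real (card (GL_set T (n - k)))))"
    unfolding sum_distrib_left .
  then show ?thesis using card_GL_set_pos[of T n] by simp
qed

lemma annihilated_invertible:
  fixes M :: "'a::field mat"
  assumes M: "M \<in> annihilated g n" and bez: "c * [:0, 1:] + d * g = 1"
  shows "invertible_mat M"
proof -
  note Mc = annihilatedD[OF M]
  have "poly_mat (d * g) M = 0\<^sub>m n n"
    using poly_mat_carrier[OF Mc(1), of d] by (simp add: poly_mat_mult[OF Mc(1)] Mc(2))
  moreover have "poly_mat ([:0, 1:] * c + d * g) M = 1\<^sub>m n"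
    using bez poly_mat_1[OF Mc(1)] by (simp only: mult.commute[of "[:0, 1:]"])
  moreover have "M * poly_mat c M \<in> carrier_mat n n" using Mc(1) by auto
  ultimately have "M * poly_mat c M = 1\<^sub>m n"
    unfolding poly_mat_add[OF Mc(1)] poly_mat_mult[OF Mc(1), of "[:0, 1:]"] poly_mat_X[OF Mc(1)] by simp
  then show ?thesis using invertible_matI[OF Mc(1) poly_mat_carrier[OF Mc(1)]] by blast
qed

text \<open>A conjugator in the general linear group is corrected to one fixing the first unit
  vector. The preimage of that vector lies in the block of eigenvalue \<open>1\<close>, which is an
  identity block, so any change of basis there commutes with the block form.\<close>

lemma A_set_annihilated_eq_UN:
  fixes T :: "'a::{finite,field} itself" and g :: "'a poly"
  assumes bez: "a * [:-1, 1:] + b * g = 1" and bez0: "c * [:0, 1:] + d * g = 1"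
  shows "A_set T n \<inter> annihilated ([:-1, 1:] * g) (n + 1) = (\<Union>k\<in>{..n}. (\<lambda>(P, D). P * D * inv_mat P) `
    (A_set T n \<times> block_pairs (annihilated [:-1, 1:] (k + 1)) (annihilated g (n - k))))" (is "_ = (\<Union>k\<in>{..n}. ?Y k)")
proof
  show "A_set T n \<inter> annihilated ([:-1, 1:] * g) (n + 1) \<subseteq> (\<Union>k\<in>{..n}. ?Y k)"
  proof
    fix M assume "M \<in> A_set T n \<inter> annihilated ([:-1, 1:] * g) (n + 1)"
    then have M: "M \<in> carrier_mat (n + 1) (n + 1)" "poly_mat ([:-1, 1:] * g) M = 0\<^sub>m (n + 1) (n + 1)"
      and Me: "M *\<^sub>v unit_vec (n + 1) 0 = unit_vec (n + 1) 0"
      by (auto simp: A_set_iff annihilated_def GL_set_def simp del: One_nat_def)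
    let ?e = "unit_vec (n + 1) 0 :: 'a vec"
    obtain k m A B where km: "n + 1 = k + m" and AB: "A \<in> carrier_mat k k" "B \<in> carrier_mat m m"
      "poly_mat [:-1, 1:] A = 0\<^sub>m k k" "poly_mat g B = 0\<^sub>m m m" and sim: "similar_mat M (diag2 A B)"
      using coprime_block_decomposition[OF M(1) bez M(2)] by blast
    have "A \<in> annihilated [:-1, 1:] k" using AB by (simp add: annihilated_def)
    then have A1: "A = 1\<^sub>m k" unfolding annihilated_X_minus_1 by simp
    let ?D = "diag2 A B"
    obtain P where P: "P \<in> carrier_mat (n + 1) (n + 1)" "invertible_mat P" and D: "?D \<in> carrier_mat (n + 1) (n + 1)"
      and MP: "M = P * ?D * inv_mat P"
      using similar_mat_obtain[OF sim M(1)] by blast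
    note iP = inv_mat[OF P]
    have MP': "M * P = P * ?D" using conj_eq_iff[OF P D M(1)] MP by simp
    \<comment> \<open>\<open>y\<close> is the fixed vector of \<open>M\<close> written in the
      coordinates of the block form.\<close>
    define y where "y = inv_mat P *\<^sub>v ?e"
    have y: "y \<in> carrier_vec (n + 1)" unfolding y_def using iP(1) by simp
    have Py: "P *\<^sub>v y = ?e" unfolding y_def by (rule mult_mat_vec_cancel[OF P(1) iP(1,2)]) simp
    have "P *\<^sub>v (?D *\<^sub>v y) = P * ?D *\<^sub>v y" by (rule assoc_mult_mat_vec[OF P(1) D y, symmetric])
    also have "\<dots> = M * P *\<^sub>v y" unfolding MP' ..
    also have "\<dots> = M *\<^sub>v (P *\<^sub>v y)" by (rule assoc_mult_mat_vec[OF M(1) P(1) y])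
    also have "\<dots> = P *\<^sub>v y" unfolding Py Me ..
    finally have PDy: "P *\<^sub>v (?D *\<^sub>v y) = P *\<^sub>v y" .
    have Dyc: "?D *\<^sub>v y \<in> carrier_vec (n + 1)" by (rule mult_mat_vec_carrier[OF D y])
    have "?D *\<^sub>v y = inv_mat P *\<^sub>v (P *\<^sub>v (?D *\<^sub>v y))"
      by (rule mult_mat_vec_cancel[OF iP(1) P(1) iP(3) Dyc, symmetric])
    also have "\<dots> = y" unfolding PDy by (rule mult_mat_vec_cancel[OF iP(1) P(1) iP(3) y])
    finally have Dy: "?D *\<^sub>v y = y" .
    define y1 where "y1 = vec_first y k"
    define y2 where "y2 = vec_last y m"
    have y12: "y1 \<in> carrier_vec k" "y2 \<in> carrier_vec m" by (auto simp: y1_def y2_def)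
    have "y \<in> carrier_vec (k + m)" using y km by simp
    from vec_first_last_append[OF this] have yeq: "y = y1 @\<^sub>v y2" by (simp add: y1_def y2_def)
    have "(A *\<^sub>v y1) @\<^sub>v (B *\<^sub>v y2) = y1 @\<^sub>v y2"
      using Dy diag2_mult_vec[OF AB(1,2) y12] unfolding yeq by simp
    then have By: "B *\<^sub>v y2 = y2"
      using append_vec_eq[OF mult_mat_vec_carrier[OF AB(1) y12(1)] y12(1)] by blast
    \<comment> \<open>The polynomial \<open>x - 1\<close> is coprime to \<open>g\<close>, so
      \<open>B - 1\<close> is invertible and the component of \<open>y\<close> in the second block
      vanishes.\<close>
    have y20: "y2 = 0\<^sub>v m"
    proof -
      have pB: "poly_mat [:-1, 1:] B *\<^sub>v y2 = 0\<^sub>v m"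
      proof -
        have "poly_mat [:-1, 1:] B = (-1) \<cdot>\<^sub>m 1\<^sub>m m + B"
          using AB(2) by (simp add: poly_mat_pCons[OF AB(2)] poly_mat_const[OF AB(2)] one_pCons[symmetric])
        also have "\<dots> *\<^sub>v y2 = ((-1) \<cdot>\<^sub>m 1\<^sub>m m) *\<^sub>v y2 + B *\<^sub>v y2"
          by (rule add_mult_distrib_mat_vec[OF _ AB(2) y12(2)]) simp
        also have "\<dots> = 0\<^sub>v m" unfolding By using y12(2) by (intro eq_vecI) auto
        finally show ?thesis .
      qed
      have bg: "poly_mat (b * g) B = 0\<^sub>m m m"
        using poly_mat_carrier[OF AB(2), of b] by (simp add: poly_mat_mult[OF AB(2)] AB(4))
      have "poly_mat (a * [:-1, 1:] + b * g) B = 1\<^sub>m m" unfolding bez by (rule poly_mat_1[OF AB(2)])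
      then have "poly_mat a B * poly_mat [:-1, 1:] B + 0\<^sub>m m m = 1\<^sub>m m"
        unfolding poly_mat_add[OF AB(2)] poly_mat_mult[OF AB(2), of a] bg .
      then have "poly_mat a B * poly_mat [:-1, 1:] B = 1\<^sub>m m"
        using right_add_zero_mat[OF mult_carrier_mat[OF poly_mat_carrier[OF AB(2)] poly_mat_carrier[OF AB(2)]]] by simp
      from mult_mat_vec_cancel[OF poly_mat_carrier[OF AB(2)] poly_mat_carrier[OF AB(2)] this y12(2)]
      show ?thesis unfolding pB mult_mat_zero_vec[OF poly_mat_carrier[OF AB(2)]] by (rule sym)
    qed
    have "?e \<noteq> 0\<^sub>v (n + 1)"
    proof
      assume "?e = 0\<^sub>v (n + 1)"
      then have "?e $ 0 = (0\<^sub>v (n + 1) :: 'a vec) $ 0" by (rule arg_cong)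
      then show False by simp
    qed
    then have "y \<noteq> 0\<^sub>v (n + 1)" using Py mult_mat_zero_vec[OF P(1)] by metis
    then have y10: "y1 \<noteq> 0\<^sub>v k" using yeq y20 km by auto
    \<comment> \<open>A nonzero fixed vector needs an eigenvalue-\<open>1\<close> block of positive
      size. This is the shift from \<open>k'\<close> to \<open>k' + 1\<close> in the index of the
      union.\<close>
    then have "k \<noteq> 0" using y12(1) by auto
    then obtain k' where k': "k = k' + 1" by (metis Suc_eq_plus1 not0_implies_Suc)
    have m: "m = n - k'" "k' \<le> n" using km k' by auto
    obtain Q where Q: "Q \<in> carrier_mat k k" "invertible_mat Q" "Q *\<^sub>v unit_vec k 0 = y1"
      using exists_invertible_mat_first_column[OF y12(1) y10] by blast
    \<comment> \<open>\<open>R\<close> commutes with \<open>?D\<close>, as the first block is the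
      identity, and sends the first unit vector to \<open>y\<close>. Hence \<open>P * R\<close>
      still conjugates \<open>?D\<close> to \<open>M\<close> and now fixes that unit vector.\<close>
    define R where "R = diag2 Q (1\<^sub>m m)"
    have Rc: "R \<in> carrier_mat (n + 1) (n + 1)" using Q(1) km by (simp add: R_def)
    have inv1: "invertible_mat (1\<^sub>m m :: 'a mat)" by (rule invertible_matI[of _ m "1\<^sub>m m"]) auto
    have Rinv: "invertible_mat R" unfolding R_def using invertible_diag2_iff[OF Q(1) one_carrier_mat] Q(2) inv1 by blast
    have u: "?e = unit_vec k 0 @\<^sub>v 0\<^sub>v m" unfolding km k' by (intro eq_vecI) (auto simp: unit_vec_def)
    have Re: "R *\<^sub>v ?e = y"
      unfolding u R_def diag2_mult_vec[OF Q(1) one_carrier_mat unit_vec_carrier zero_carrier_vec] Q(3) yeq y20 by simp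
    have PR: "P * R \<in> carrier_mat (n + 1) (n + 1)" "invertible_mat (P * R)"
      using P Rc invertible_mult_mat(1)[OF P Rc Rinv] by auto
    have "P * R *\<^sub>v ?e = P *\<^sub>v (R *\<^sub>v ?e)" by (rule assoc_mult_mat_vec[OF P(1) Rc]) simp
    then have "P * R *\<^sub>v ?e = ?e" unfolding Re Py .
    then have PRA: "P * R \<in> A_set T n" using PR by (simp add: A_set_iff GL_set_def)
    have "?D * R = R * ?D"
      unfolding R_def A1 diag2_mult[OF one_carrier_mat Q(1) AB(2) one_carrier_mat]
        diag2_mult[OF Q(1) one_carrier_mat one_carrier_mat AB(2)] using Q(1) AB(2) by simp
    then have "M * (P * R) = P * R * ?D"
      using assoc_mult_mat[OF M(1) P(1) Rc] assoc_mult_mat[OF P(1) D Rc] assoc_mult_mat[OF P(1) Rc D] MP' by simp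
    then have "M = P * R * ?D * inv_mat (P * R)" using conj_eq_iff[OF PR D M(1)] by simp
    moreover have "?D \<in> block_pairs (annihilated [:-1, 1:] (k' + 1)) (annihilated g (n - k'))"
      unfolding block_pairs_def
      by (intro image_eqI[of _ _ "(A, B)"]) (use AB k' m in \<open>auto simp: annihilated_def\<close>)
    ultimately have "M \<in> ?Y k'" using PRA by (intro image_eqI[of _ _ "(P * R, ?D)"]) auto
    then show "M \<in> (\<Union>k\<in>{..n}. ?Y k)" by (rule UN_I[rotated]) (use m in simp)
  qed
  show "(\<Union>k\<in>{..n}. ?Y k) \<subseteq> A_set T n \<inter> annihilated ([:-1, 1:] * g) (n + 1)"
  proof
    fix M assume "M \<in> (\<Union>k\<in>{..n}. ?Y k)"
    then obtain k P D where k: "k \<le> n" and P: "P \<in> A_set T n"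
      and D: "D \<in> block_pairs (annihilated [:-1, 1:] (k + 1)) (annihilated g (n - k))" and M: "M = P * D * inv_mat P"
      by auto
    have Pc: "P \<in> carrier_mat (n + 1) (n + 1)" "invertible_mat P" using P by (auto simp: A_set_def GL_set_def)
    have n: "k + 1 + (n - k) = n + 1" using k by simp
    have "D \<in> annihilated ([:-1, 1:] * g) (n + 1)" using block_pairs_annihilated[OF D] unfolding n .
    then have 1: "M \<in> annihilated ([:-1, 1:] * g) (n + 1)"
      unfolding M by (rule annihilated_conj[OF _ Pc(1) inv_mat(1,3)[OF Pc]])
    obtain B where B: "B \<in> annihilated g (n - k)" and Deq: "D = diag2 (1\<^sub>m (k + 1)) B"
      using D by (auto simp: block_pairs_def annihilated_X_minus_1)
    \<comment> \<open>Coprimality of \<open>g\<close> with \<open>x\<close> is used here: it makes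
      \<open>B\<close> invertible, so that \<open>D\<close> itself lies in
      \<open>A_set T n\<close>.\<close>
    have Bc: "B \<in> carrier_mat (n - k) (n - k)" "invertible_mat B"
      using annihilatedD(1)[OF B] annihilated_invertible[OF B bez0] by auto
    have inv1: "invertible_mat (1\<^sub>m (k + 1) :: 'a mat)" by (rule invertible_matI[of _ "k + 1" "1\<^sub>m (k + 1)"]) auto
    have "D \<in> carrier_mat (n + 1) (n + 1)" unfolding Deq n[symmetric]
      by (rule four_block_carrier_mat[OF one_carrier_mat Bc(1)])
    moreover have "invertible_mat D" unfolding Deq using invertible_diag2_iff[OF one_carrier_mat Bc(1)] Bc(2) inv1 by blast
    moreover have "D *\<^sub>v unit_vec (n + 1) 0 = unit_vec (n + 1) 0"
      unfolding Deq n[symmetric] using diag2_fixes_unit_vec[OF one_carrier_mat Bc(1), of k] by simp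
    ultimately have "D \<in> A_set T n" by (simp add: A_set_iff GL_set_def)
    then have "M \<in> A_set T n" using P matrix_group_A_set[of n T] unfolding M matrix_group_def by blast
    then show "M \<in> A_set T n \<inter> annihilated ([:-1, 1:] * g) (n + 1)" using 1 by blast
  qed
qed

text \<open>Only the identity is annihilated by \<open>x - 1\<close>, so the first block contributes
  a single matrix; the order of \<open>A(k, q)\<close> comes from the centralizer.\<close>

lemma card_A_set_annihilated:
  fixes T :: "'a::{finite,field} itself" and g :: "'a poly"
  assumes bez: "a * [:-1, 1:] + b * g = 1" and bez0: "c * [:0, 1:] + d * g = 1"
  shows "real (card (A_set T n \<inter> annihilated ([:-1, 1:] * g) (n + 1))) / real (card (A_set T n)) =
    (\<Sum>k\<le>n. 1 / real (card (A_set T k)) * (real (card (annihilated g (n - k))) / real (card (GL_set T (n - k)))))"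
proof -
  let ?J = "\<lambda>k. diag2 (1\<^sub>m (k + 1)) (0\<^sub>m (n - k) (n - k)) :: 'a mat"
  have cent: "card {Z \<in> A_set T n. Z * ?J k = ?J k * Z} = card (A_set T k) * card (GL_set T (n - k))" if "k \<in> {..n}" for k
  proof -
    have "k + (n - k) = n" using that by simp
    then have "{Z \<in> A_set T n. Z * ?J k = ?J k * Z} = block_pairs (A_set T k) (GL_set T (n - k))"
      by (rule centralizer_projection_A)
    then show ?thesis
      using card_block_pairs[of "A_set T k" "k + 1" "GL_set T (n - k)" "n - k"] by (auto simp: A_set_def GL_set_def)
  qed
  have "real (card (A_set T n \<inter> annihilated ([:-1, 1:] * g) (n + 1))) = (\<Sum>k\<in>{..n}. real (card (A_set T n)) *
      (real (card (annihilated [:-1, 1 :: 'a:] (k + 1))) * real (card (annihilated g (n - k)))) /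
      real (card {Z \<in> A_set T n. Z * ?J k = ?J k * Z}))"
    unfolding A_set_annihilated_eq_UN[OF bez bez0, of T n]
    by (rule card_UN_conjugates[OF matrix_group_A_set bez]) (auto simp: inj_on_def)
  also have "\<dots> = (\<Sum>k\<in>{..n}. real (card (A_set T n)) * (1 / real (card (A_set T k)) *
      (real (card (annihilated g (n - k))) / real (card (GL_set T (n - k))))))"
    by (rule sum.cong[OF refl], subst cent) (auto simp: annihilated_X_minus_1)
  finally have "real (card (A_set T n \<inter> annihilated ([:-1, 1:] * g) (n + 1))) = real (card (A_set T n)) *
      (\<Sum>k\<in>{..n}. 1 / real (card (A_set T k)) *
      (real (card (annihilated g (n - k))) / real (card (GL_set T (n - k)))))"
    unfolding sum_distrib_left .
  then show ?thesis using card_A_set_pos[of T n] by simp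
qed

section \<open>Group orders\<close>

lemma card_GL_set:
  fixes T :: "'a::{finite,field} itself"
  shows "card (GL_set T n) = (\<Prod>i<n. card (UNIV :: 'a set) ^ n - card (UNIV :: 'a set) ^ i)"
proof -
  have irr: "Factorial_Ring.irreducible [:-1, 1 :: 'a:]" by (rule irreducible_linear_field_poly) simp
  \<comment> \<open>The case \<open>d = 1\<close> with \<open>f = x - 1\<close>: the only
    annihilated matrix is the identity, and its frames are the ordered bases.\<close>
  have "card (annihilated [:-1, 1 :: 'a:] n) * (\<Prod>i<n. card (UNIV :: 'a set) ^ n - card (UNIV :: 'a set) ^ (i * 1)) = card (GL_set T n)"
    by (rule card_annihilated_irreducible[OF _ _ _ irr]) auto
  then show ?thesis by (simp add: annihilated_X_minus_1)
qed

text \<open>\<open>A_set T n\<close> is the stabilizer of the first unit vector in the group \<open>GL_set T (n + 1)\<close>, which acts transitively on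
  nonzero vectors.\<close>

lemma card_GL_set_eq_card_A_set:
  fixes T :: "'a::{finite,field} itself"
  shows "card (GL_set T (n + 1)) = (card (UNIV :: 'a set) ^ (n + 1) - 1) * card (A_set T n)"
proof -
  let ?e = "unit_vec (n + 1) 0 :: 'a vec" and ?G = "GL_set T (n + 1)"
  have A: "P \<in> A_set T n \<longleftrightarrow> P \<in> ?G \<and> P *\<^sub>v ?e = ?e" for P by (rule A_set_iff)
  have G: "matrix_group (n + 1) ?G" by (rule matrix_group_GL_set)
  have Gc: "P \<in> carrier_mat (n + 1) (n + 1)" "invertible_mat P" "inv_mat P \<in> ?G" if "P \<in> ?G" for P
    using that G by (auto simp: matrix_group_def)
  have Gm: "P * Q \<in> ?G" if "P \<in> ?G" "Q \<in> ?G" for P Q using that G by (auto simp: matrix_group_def)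
  have "card {Q \<in> ?G. Q *\<^sub>v ?e = P *\<^sub>v ?e} = card (A_set T n)" if P: "P \<in> ?G" for P
  proof -
    note Pc = Gc[OF P] and iP = inv_mat[OF Gc(1,2)[OF P]]
    have "{Q \<in> ?G. Q *\<^sub>v ?e = P *\<^sub>v ?e} = (\<lambda>Z. P * Z) ` A_set T n"
    proof
      show "(\<lambda>Z. P * Z) ` A_set T n \<subseteq> {Q \<in> ?G. Q *\<^sub>v ?e = P *\<^sub>v ?e}"
      proof clarify
        fix Z assume "Z \<in> A_set T n"
        then have Z: "Z \<in> ?G" "Z *\<^sub>v ?e = ?e" unfolding A by auto
        have "P * Z *\<^sub>v ?e = P *\<^sub>v (Z *\<^sub>v ?e)" by (rule assoc_mult_mat_vec[OF Pc(1) Gc(1)[OF Z(1)]]) simp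
        then show "P * Z \<in> ?G \<and> P * Z *\<^sub>v ?e = P *\<^sub>v ?e" using Gm[OF P Z(1)] unfolding Z(2) by blast
      qed
      show "{Q \<in> ?G. Q *\<^sub>v ?e = P *\<^sub>v ?e} \<subseteq> (\<lambda>Z. P * Z) ` A_set T n"
      proof
        fix Q assume "Q \<in> {Q \<in> ?G. Q *\<^sub>v ?e = P *\<^sub>v ?e}"
        then have Q: "Q \<in> ?G" and Qe: "Q *\<^sub>v ?e = P *\<^sub>v ?e" by auto
        have "inv_mat P * Q *\<^sub>v ?e = inv_mat P *\<^sub>v (Q *\<^sub>v ?e)"
          by (rule assoc_mult_mat_vec[OF iP(1) Gc(1)[OF Q]]) simp
        also have "\<dots> = ?e" unfolding Qe by (rule mult_mat_vec_cancel[OF iP(1) Pc(1) iP(3)]) simp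
        finally have "inv_mat P * Q \<in> A_set T n" unfolding A using Gm[OF Pc(3) Q] by blast
        moreover have "P * (inv_mat P * Q) = Q"
          by (rule mult_mat_cancel_left[OF Pc(1) iP(1,2) Gc(1)[OF Q]])
        ultimately show "Q \<in> (\<lambda>Z. P * Z) ` A_set T n" by (intro image_eqI[of Q _ "inv_mat P * Q"]) simp_all
      qed
    qed
    moreover have "inj_on (\<lambda>Z. P * Z) (A_set T n)"
      by (rule inj_onI, rule mult_mat_left_cancel[OF Pc(1,2)]) (auto simp: A_set_def GL_set_def)
    ultimately show ?thesis by (simp add: card_image)
  qed
  then have "card ?G = card ((\<lambda>P. P *\<^sub>v ?e) ` ?G) * card (A_set T n)"
    by (rule card_eq_card_image_mult[OF finite_GL_set])
  moreover have "(\<lambda>P. P *\<^sub>v ?e) ` ?G = carrier_vec (n + 1) - {0\<^sub>v (n + 1)}"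
  proof
    show "(\<lambda>P. P *\<^sub>v ?e) ` ?G \<subseteq> carrier_vec (n + 1) - {0\<^sub>v (n + 1)}"
    proof clarify
      fix P assume P: "P \<in> ?G"
      note Pc = Gc[OF P] and iP = inv_mat[OF Gc(1,2)[OF P]]
      have "P *\<^sub>v ?e \<noteq> 0\<^sub>v (n + 1)"
      proof
        assume 0: "P *\<^sub>v ?e = 0\<^sub>v (n + 1)"
        have "inv_mat P *\<^sub>v (P *\<^sub>v ?e) = ?e" by (rule mult_mat_vec_cancel[OF iP(1) Pc(1) iP(3)]) simp
        then have "0\<^sub>v (n + 1) = ?e" unfolding 0 mult_mat_zero_vec[OF iP(1)] .
        then have "(0\<^sub>v (n + 1) :: 'a vec) $ 0 = ?e $ 0" by (rule arg_cong)
        then show False by simp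
      qed
      moreover have "P *\<^sub>v ?e \<in> carrier_vec (n + 1)" by (rule mult_mat_vec_carrier[OF Pc(1)]) simp
      ultimately show "P *\<^sub>v ?e \<in> carrier_vec (n + 1) - {0\<^sub>v (n + 1)}" by simp
    qed
    show "carrier_vec (n + 1) - {0\<^sub>v (n + 1)} \<subseteq> (\<lambda>P. P *\<^sub>v ?e) ` ?G"
    proof
      fix v :: "'a vec" assume "v \<in> carrier_vec (n + 1) - {0\<^sub>v (n + 1)}"
      then obtain Q where "Q \<in> carrier_mat (n + 1) (n + 1)" "invertible_mat Q" "Q *\<^sub>v ?e = v"
        using exists_invertible_mat_first_column[of v "n + 1"] by blast
      then show "v \<in> (\<lambda>P. P *\<^sub>v ?e) ` ?G" by (intro image_eqI[of _ _ Q]) (auto simp: GL_set_def)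
    qed
  qed
  moreover have "card (carrier_vec (n + 1) - {0\<^sub>v (n + 1) :: 'a vec}) = card (UNIV :: 'a set) ^ (n + 1) - 1"
    by (subst card_Diff_singleton) (auto simp: card_carrier_vec)
  ultimately show ?thesis by simp
qed

section \<open>Generating functions\<close>

text \<open>Extract \<open>Q^k\<close> from each factor and reindex by \<open>j = k - i\<close>.
  With \<open>Q = q^d\<close> this turns the order of \<open>GL(k, q^d)\<close> into the
  denominators of \<open>Fd\<close>.\<close>

lemma prod_power_diff_eq_qpoch:
  fixes Q :: real
  assumes "Q > 0"
  shows "(\<Prod>i<k. Q ^ k - Q ^ i) = Q ^ (k\<^sup>2) * qpoch (1 / Q) k"
proof -
  have "(\<Prod>i<k. Q ^ k - Q ^ i) = (\<Prod>i<k. Q ^ k * (1 - (1 / Q) ^ (k - i)))"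
  proof (rule prod.cong)
    fix i assume "i \<in> {..<k}"
    then have "Q ^ k = Q ^ (k - i) * Q ^ i" by (simp add: power_add[symmetric])
    then show "Q ^ k - Q ^ i = Q ^ k * (1 - (1 / Q) ^ (k - i))"
      using assms by (simp add: field_simps)
  qed simp
  also have "\<dots> = (\<Prod>i<k. Q ^ k) * (\<Prod>i<k. 1 - (1 / Q) ^ (k - i))" by (rule prod.distrib)
  also have "(\<Prod>i<k. Q ^ k) = Q ^ (k\<^sup>2)" by (simp add: power_mult[symmetric] power2_eq_square)
  also have "(\<Prod>i<k. 1 - (1 / Q) ^ (k - i)) = (\<Prod>j\<in>{1..k}. 1 - (1 / Q) ^ j)"
    by (rule prod.reindex_bij_witness[of _ "\<lambda>j. k - j" "\<lambda>i. k - i"]) auto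
  finally show ?thesis by (simp add: qpoch_def)
qed

lemma real_prod_power_diff:
  fixes q :: nat
  assumes "1 < q"
  shows "real (\<Prod>i<k. q ^ (k * d) - q ^ (i * d)) = (real q ^ d) ^ (k\<^sup>2) * qpoch (1 / real q ^ d) k"
proof -
  have "real (q ^ (k * d) - q ^ (i * d)) = (real q ^ d) ^ k - (real q ^ d) ^ i" if "i < k" for i
  proof -
    have "q ^ (i * d) \<le> q ^ (k * d)" using assms that by (intro power_increasing) auto
    then show ?thesis by (simp add: of_nat_diff power_mult[symmetric] mult.commute)
  qed
  then have "real (\<Prod>i<k. q ^ (k * d) - q ^ (i * d)) = (\<Prod>i<k. (real q ^ d) ^ k - (real q ^ d) ^ i)"
    unfolding of_nat_prod by (intro prod.cong) auto
  then show ?thesis using prod_power_diff_eq_qpoch[of "real q ^ d" k] assms by simp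
qed

lemma real_card_GL_set:
  fixes T :: "'a::{finite,field} itself"
  defines "q \<equiv> real (card (UNIV :: 'a set))"
  shows "real (card (GL_set T n)) = q ^ (n\<^sup>2) * qpoch (1 / q) n"
  using real_prod_power_diff[OF card_field_gt_1[where 'a = 'a], of n 1] by (simp add: card_GL_set q_def)

lemma real_card_A_set:
  fixes T :: "'a::{finite,field} itself"
  defines "q \<equiv> real (card (UNIV :: 'a set))"
  shows "real (card (A_set T n)) = q ^ (n\<^sup>2 + n) * qpoch (1 / q) n"
proof -
  have q: "q > 1" using card_field_gt_1[where 'a = 'a] by (simp add: q_def)
  have "real (card (UNIV :: 'a set) ^ (n + 1) - 1) = q ^ (n + 1) - 1"
    using q by (subst of_nat_diff) (auto simp: q_def)
  then have "q ^ ((n + 1)\<^sup>2) * qpoch (1 / q) (n + 1) = (q ^ (n + 1) - 1) * real (card (A_set T n))"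
    using arg_cong[OF card_GL_set_eq_card_A_set[of T n], of real] real_card_GL_set[of T "n + 1"]
    by (simp add: q_def)
  moreover have "q ^ ((n + 1)\<^sup>2) * qpoch (1 / q) (n + 1) = (q ^ (n + 1) - 1) * (q ^ (n\<^sup>2 + n) * qpoch (1 / q) n)"
  proof -
    \<comment> \<open>The exponent splits so that \<open>q^(n + 1)\<close> joins the last factor of
      \<open>qpoch\<close>, producing \<open>q^(n + 1) - 1\<close>, the number of nonzero
      vectors.\<close>
    have "(n + 1)\<^sup>2 = (n\<^sup>2 + n) + (n + 1)" by (simp add: power2_eq_square algebra_simps)
    then have a1: "q ^ ((n + 1)\<^sup>2) = q ^ (n\<^sup>2 + n) * q ^ (n + 1)" by (simp only: power_add)
    have a2: "qpoch (1 / q) (n + 1) = qpoch (1 / q) n * (1 - (1 / q) ^ (n + 1))"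
      by (simp add: qpoch_def)
    have a3: "q ^ (n + 1) * (1 - (1 / q) ^ (n + 1)) = q ^ (n + 1) - 1"
      using q by (simp add: field_simps)
    show ?thesis unfolding a1 a2 a3[symmetric] by (simp only: mult_ac)
  qed
  moreover have "q ^ (n + 1) - 1 \<noteq> 0" using q one_less_power[of q "n + 1"] by simp
  ultimately show ?thesis by simp
qed

text \<open>The weight is the reciprocal group order, the one for which splitting along coprime
  factors becomes multiplication of series.\<close>

definition ann_fps :: "'a::{finite,field} itself \<Rightarrow> 'a poly \<Rightarrow> real fps" where
  "ann_fps T p = Abs_fps (\<lambda>n. real (card (annihilated p n)) / real (card (GL_set T n)))"

text \<open>The constant polynomial \<open>1\<close> annihilates only the empty matrix; this is the
  base case for products over sets of irreducibles.\<close>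

lemma ann_fps_1: "ann_fps T 1 = 1"
proof (rule fps_ext)
  fix n
  have "annihilated (1 :: 'a poly) n = (if n = 0 then {0\<^sub>m 0 0} else {})"
  proof -
    have "(1\<^sub>m n :: 'a mat) = 0\<^sub>m n n \<longleftrightarrow> n = 0"
    proof
      assume e: "(1\<^sub>m n :: 'a mat) = 0\<^sub>m n n"
      show "n = 0"
      proof (rule ccontr)
        assume "n \<noteq> 0"
        then show False using arg_cong[OF e, of "\<lambda>M. M $$ (0, 0)"] by simp
      qed
    qed auto
    then show ?thesis by (auto simp: annihilated_def)
  qed
  moreover have "card (GL_set T 0) = 1" by (simp add: card_GL_set)
  ultimately show "ann_fps T 1 $ n = 1 $ n" by (simp add: ann_fps_def)
qed

lemma ann_fps_mult:
  assumes "a * f + b * g = 1"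
  shows "ann_fps T (f * g) = ann_fps T f * ann_fps T g"
  by (rule fps_ext) (simp add: ann_fps_def card_annihilated_mult[OF assms] fps_mult_nth atLeast0AtMost)

lemma ann_fps_irreducible:
  fixes T :: "'a::{finite,field} itself" and f :: "'a poly"
  assumes f: "lead_coeff f = 1" "Factorial_Ring.irreducible f"
  shows "ann_fps T f = Fd (real (card (UNIV :: 'a set))) (degree f)"
proof (rule fps_ext)
  fix n
  let ?q = "card (UNIV :: 'a set)" and ?d = "degree f"
  have d: "0 < ?d"
  proof (rule ccontr)
    assume "\<not> 0 < ?d"
    then have "f = 1" using f(1) by (auto simp: one_pCons elim: degree_eq_zeroE)
    then show False using f(2) by (simp add: comm_semiring_1_class.irreducible_def)
  qed
  show "ann_fps T f $ n = Fd (real ?q) ?d $ n"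
  proof (cases "?d dvd n")
    case True
    then have n: "n = n div ?d * ?d" by simp
    define k where "k = n div ?d"
    have nk: "n = k * ?d" using n by (simp add: k_def)
    define Z where "Z = (real ?q ^ ?d) ^ (k\<^sup>2) * qpoch (1 / real ?q ^ ?d) k"
    have cZ: "real (card (annihilated f n)) * Z = real (card (GL_set T n))"
      using arg_cong[OF card_annihilated_irreducible[OF f(1) refl d f(2) nk, of T], of real]
        real_prod_power_diff[OF card_field_gt_1[where 'a = 'a], of k ?d] by (simp only: of_nat_mult nk Z_def)
    have G0: "real (card (GL_set T n)) \<noteq> 0" using card_GL_set_pos by simp
    then have "Z \<noteq> 0" using cZ by auto
    then have "real (card (annihilated f n)) / real (card (GL_set T n)) = 1 / Z"
      using cZ G0 by (simp add: field_simps)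
    moreover have "Z = real ?q ^ (k\<^sup>2 * ?d) * qpoch (1 / real ?q ^ ?d) k"
      unfolding Z_def by (simp add: power_mult[symmetric] mult.commute)
    ultimately show ?thesis using True by (simp add: ann_fps_def Fd_def k_def[symmetric])
  next
    case False
    then show ?thesis using annihilated_irreducible_empty[OF f(1) refl d f(2) False]
      by (simp add: ann_fps_def Fd_def)
  qed
qed

section \<open>Products of distinct monic irreducible polynomials\<close>

lemma irreducible_bezout_prod:
  fixes f :: "'a::field poly"
  assumes f: "Factorial_Ring.irreducible f" and S: "finite S"
    and ndvd: "\<And>g. g \<in> S \<Longrightarrow> \<not> f dvd g"
  obtains a b where "a * f + b * \<Prod>S = 1"
proof -
  have prime: "prime_elem f" using field_poly_irreducible_imp_prime f by blast
  have "\<not> f dvd \<Prod>S" using S ndvd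
  proof (induction S rule: finite_induct)
    case empty
    show ?case unfolding prod.empty by (rule irreducible_not_unit[OF f])
  next
    case (insert g S)
    then show ?case using prime_elem_dvd_mult_iff[OF prime, of g "\<Prod>S"] by auto
  qed
  then show ?thesis using irreducible_poly_bezout[OF f] that by blast
qed

lemma monic_irreducible_dvd_imp_eq:
  fixes f g :: "'a::field poly"
  assumes "lead_coeff f = 1" "Factorial_Ring.irreducible f" "lead_coeff g = 1" "Factorial_Ring.irreducible g" "f dvd g"
  shows "f = g"
proof -
  have "\<not> is_unit f" using irreducible_not_unit[OF assms(2)] .
  then have "g dvd f" using irreducibleD'[OF assms(4,5)] by blast
  then show ?thesis using assms poly_dvd_antisym by metis
qed

lemma ann_fps_prod:
  fixes T :: "'a::{finite,field} itself"
  assumes "finite S" "\<And>f. f \<in> S \<Longrightarrow> lead_coeff f = 1 \<and> Factorial_Ring.irreducible f"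
  shows "ann_fps T (\<Prod>S) = (\<Prod>f\<in>S. Fd (real (card (UNIV :: 'a set))) (degree f))"
  using assms
proof (induction S rule: finite_induct)
  case empty
  then show ?case by (simp add: ann_fps_1)
next
  case (insert f S)
  have "\<not> f dvd g" if "g \<in> S" for g
    using monic_irreducible_dvd_imp_eq[of f g] insert that by blast
  then obtain a b where "a * f + b * \<Prod>S = 1"
    using irreducible_bezout_prod[of f S] insert.hyps(1) insert.prems[of f] by auto
  then have "ann_fps T (f * \<Prod>S) = ann_fps T f * ann_fps T (\<Prod>S)" by (rule ann_fps_mult)
  also have "ann_fps T f = Fd (real (card (UNIV :: 'a set))) (degree f)"
    using insert.prems[of f] by (intro ann_fps_irreducible) auto
  also have "ann_fps T (\<Prod>S) = (\<Prod>f\<in>S. Fd (real (card (UNIV :: 'a set))) (degree f))"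
    using insert.prems by (intro insert.IH) blast
  finally show ?case by (simp only: prod.insert[OF insert.hyps] id_apply)
qed

section \<open>Semisimple matrices\<close>

text \<open>Splitting off one root \<open>a\<close> leaves the scalar block \<open>a\<close> and a
  smaller matrix annihilated by the remaining factors, so the matrix and its size vary in the
  induction.\<close>

lemma diagonalizable_if_annihilated:
  fixes M :: "'a::field mat"
  assumes "finite S" "M \<in> annihilated (\<Prod>a\<in>S. [:-a, 1:]) n"
  shows "\<exists>D. diagonal_mat D \<and> similar_mat M D"
  using assms
proof (induction S arbitrary: M n rule: finite_induct)
  case empty
  note M = annihilatedD[OF empty]
  have "1\<^sub>m n = (0\<^sub>m n n :: 'a mat)" using M by (simp add: poly_mat_1[OF M(1)])
  from arg_cong[OF this, of "\<lambda>A. A $$ (0, 0)"] have "n = 0" by (cases "n = 0") auto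
  then have "diagonal_mat M" using M(1) by (auto simp: diagonal_mat_def)
  then show ?case using similar_mat_refl[OF M(1)] by blast
next
  case (insert a S)
  have irr: "Factorial_Ring.irreducible [:-a, 1:]" by (rule irreducible_linear_field_poly) simp
  have eq: "(\<Prod>a\<in>S. [:-a, 1:]) = \<Prod>((\<lambda>a. [:-a, 1:]) ` S)"
    by (subst prod.reindex) (auto simp: inj_on_def)
  have "\<not> [:-a, 1:] dvd g" if "g \<in> (\<lambda>a. [:-a, 1:]) ` S" for g
    using that insert.hyps(2) by (auto simp: dvd_iff_poly_eq_0)
  then obtain c d where bez: "c * [:-a, 1:] + d * (\<Prod>a\<in>S. [:-a, 1:]) = 1"
    unfolding eq using irreducible_bezout_prod[OF irr, of "(\<lambda>a. [:-a, 1:]) ` S"] insert.hyps(1) by blast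
  have "M \<in> annihilated ([:-a, 1:] * (\<Prod>a\<in>S. [:-a, 1:])) n"
    using insert.prems unfolding prod.insert[OF insert.hyps] .
  note M = annihilatedD[OF this]
  obtain k m A B where km: "n = k + m" and AB: "A \<in> carrier_mat k k" "B \<in> carrier_mat m m"
    "poly_mat [:-a, 1:] A = 0\<^sub>m k k" "poly_mat (\<Prod>a\<in>S. [:-a, 1:]) B = 0\<^sub>m m m" and sim: "similar_mat M (diag2 A B)"
    using coprime_block_decomposition[OF M(1) bez M(2)] by blast
  have "A \<in> annihilated [:-a, 1:] k" using AB by (simp add: annihilated_def)
  then have A: "A = a \<cdot>\<^sub>m 1\<^sub>m k" unfolding annihilated_linear by simp
  have "B \<in> annihilated (\<Prod>a\<in>S. [:-a, 1:]) m" using AB by (simp add: annihilated_def)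
  from insert.IH[OF this] obtain D where D: "diagonal_mat D" "similar_mat B D" by blast
  have Dc: "D \<in> carrier_mat m m" using similar_mat_obtain[OF D(2) AB(2)] by blast
  have "similar_mat (diag2 A B) (diag2 A D)"
    using similar_mat_four_block_0_0[OF similar_mat_refl[OF AB(1)] D(2) AB(1,2)] AB Dc by simp
  then have "similar_mat M (diag2 A D)" using sim similar_mat_trans by blast
  moreover have "diagonal_mat (diag2 A D)"
    using D(1) Dc unfolding A by (auto simp: diagonal_mat_def)
  ultimately show ?case by blast
qed

lemma exists_monic_irreducible_factor:
  fixes g :: "'a::field poly"
  assumes "degree g > 0"
  obtains f where "lead_coeff f = 1" "Factorial_Ring.irreducible f" "f dvd g"
proof -
  obtain h where h: "h dvd g" "degree h > 0" and min: "\<And>x. x dvd g \<Longrightarrow> degree x > 0 \<Longrightarrow> degree h \<le> degree x"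
    using ex_has_least_nat[of "\<lambda>x. x dvd g \<and> degree x > 0" g degree] assms by auto
  have h0: "h \<noteq> 0" using h(2) by auto
  define f where "f = smult (inverse (lead_coeff h)) h"
  have f0: "f \<noteq> 0" using h0 by (simp add: f_def)
  have fd: "f dvd g" using h(1) h0 by (simp add: f_def smult_dvd_iff)
  have deg: "degree f = degree h" using h0 by (simp add: f_def)
  have "Factorial_Ring.irreducible f"
  proof (rule comm_semiring_1_class.irreducibleI)
    show "f \<noteq> 0" by (rule f0)
    show "\<not> is_unit f" using h(2) deg f0 by (simp add: is_unit_iff_degree)
    fix a b assume ab: "f = a * b"
    then have nz: "a \<noteq> 0" "b \<noteq> 0" using f0 by auto
    have dg: "degree f = degree a + degree b" unfolding ab by (rule degree_mult_eq[OF nz])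
    have "a dvd g" "b dvd g" using fd ab dvd_mult_left dvd_mult_right by blast+
    then have "degree a = 0 \<or> degree b = 0" using min[of a] min[of b] dg deg by linarith
    then show "is_unit a \<or> is_unit b" using nz by (simp add: is_unit_iff_degree)
  qed
  moreover have "lead_coeff f = 1" using h0 by (simp add: f_def)
  ultimately show ?thesis using that fd by blast
qed

text \<open>Strip off one irreducible factor at a time. Squarefreeness keeps each new factor out of
  the set already found, so a set rather than a multiset suffices; mutual divisibility absorbs the
  leading coefficient.\<close>

lemma squarefree_poly_factorization:
  fixes g :: "'a::field poly"
  assumes "g \<noteq> 0" "\<And>x. x * x dvd g \<Longrightarrow> is_unit x"
  shows "\<exists>S. finite S \<and> (\<forall>f\<in>S. lead_coeff f = 1 \<and> Factorial_Ring.irreducible f) \<and> g dvd \<Prod>S \<and> \<Prod>S dvd g"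
  using assms
proof (induction "degree g" arbitrary: g rule: less_induct)
  case less
  show ?case
  proof (cases "degree g = 0")
    case True
    then have "is_unit g" using less.prems(1) by (simp add: is_unit_iff_degree)
    then show ?thesis by (intro exI[of _ "{}"]) auto
  next
    case False
    then obtain f where f: "lead_coeff f = 1" "Factorial_Ring.irreducible f" "f dvd g"
      using exists_monic_irreducible_factor[of g] by blast
    obtain h where gh: "g = f * h" using f(3) unfolding dvd_def by blast
    have nz: "f \<noteq> 0" "h \<noteq> 0" using less.prems(1) gh by auto
    have "degree f \<noteq> 0"
      using irreducible_not_unit[OF f(2)] nz(1) is_unit_iff_degree[OF nz(1)] by blast
    then have "degree h < degree g" unfolding gh degree_mult_eq[OF nz] by simp
    moreover have "is_unit x" if "x * x dvd h" for x
      using that less.prems(2)[of x] dvd_mult[of "x * x" h f] unfolding gh by blast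
    ultimately obtain S where S: "finite S" "\<forall>f\<in>S. lead_coeff f = 1 \<and> Factorial_Ring.irreducible f"
      "h dvd \<Prod>S" "\<Prod>S dvd h" using less.hyps[of h] nz(2) by blast
    have "f \<notin> S"
    proof
      assume "f \<in> S"
      then have "f dvd h" using dvd_prodI[OF S(1), of f "\<lambda>x. x"] S(4) dvd_trans by auto
      then have "f * f dvd g" unfolding gh by simp
      then show False using less.prems(2) irreducible_not_unit[OF f(2)] by blast
    qed
    then have ins: "\<Prod>(insert f S) = f * \<Prod>S" using S(1) by simp
    have "g dvd \<Prod>(insert f S)" "\<Prod>(insert f S) dvd g"
      unfolding ins gh using mult_dvd_mono[OF dvd_refl S(3)] mult_dvd_mono[OF dvd_refl S(4)] by blast+
    then show ?thesis using S(1,2) f by (intro exI[of _ "insert f S"]) auto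
  qed
qed

section \<open>Frobenius powers on the algebraic closure\<close>

lemma finite_poly_degree_less: "finite {r :: 'a::{finite,zero} poly. degree r < d}"
proof -
  have "{r :: 'a poly. degree r < d} \<subseteq> Poly ` {xs. set xs \<subseteq> UNIV \<and> length xs \<le> d}"
  proof
    fix r :: "'a poly" assume "r \<in> {r. degree r < d}"
    then have "coeffs r \<in> {xs. set xs \<subseteq> UNIV \<and> length xs \<le> d}" by (cases "r = 0") (auto simp: length_coeffs_degree)
    then show "r \<in> Poly ` {xs. set xs \<subseteq> UNIV \<and> length xs \<le> d}"
      by (rule image_eqI[of r Poly "coeffs r", OF Poly_coeffs[symmetric]])
  qed
  then show ?thesis by (rule finite_subset[OF _ finite_imageI[OF finite_lists_length_le[OF finite]]])
qed

lemma map_poly_to_ac_add: "map_poly to_ac (p + q) = map_poly to_ac p + map_poly to_ac q"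
  by (rule poly_eqI) (simp add: coeff_map_poly)

lemma map_poly_to_ac_smult: "map_poly to_ac (smult c p) = smult (to_ac c) (map_poly to_ac p)"
  by (rule poly_eqI) (simp add: coeff_map_poly)

lemma map_poly_to_ac_pCons: "map_poly to_ac (pCons c p) = pCons (to_ac c) (map_poly to_ac p)"
  by (rule poly_eqI) (simp add: coeff_map_poly coeff_pCons split: nat.splits)

lemma map_poly_to_ac_mult: "map_poly to_ac (p * q :: 'a::field poly) = map_poly to_ac p * map_poly to_ac q"
proof (induction p)
  case (pCons a p)
  show ?case
    unfolding mult_pCons_left map_poly_to_ac_add map_poly_to_ac_smult map_poly_to_ac_pCons pCons.IH by simp
qed simp

lemma map_poly_to_ac_diff: "map_poly to_ac (p - q) = map_poly to_ac p - map_poly to_ac q"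
  by (rule poly_eqI) (simp add: coeff_map_poly)

lemma map_poly_to_ac_monom: "map_poly to_ac (monom 1 n) = monom 1 n"
  by (rule poly_eqI) (simp add: coeff_map_poly)

lemma prime_CHAR_finite_field: "Factorial_Ring.prime CHAR('a::{finite,field})"
  using finite_imp_CHAR_pos[where 'a = 'a] by (intro prime_CHAR_semidom) auto

lemma frobenius_inj:
  fixes x y :: "'a::{finite,field} alg_closure"
  assumes "x ^ (CHAR('a) ^ i) = y ^ (CHAR('a) ^ i)"
  shows "x = y"
proof -
  let ?P = "CHAR('a) ^ i"
  have "x ^ ?P = ((x - y) + y) ^ ?P" by simp
  also have "\<dots> = (x - y) ^ ?P + y ^ ?P"
    by (rule freshmans_dream') (auto simp: prime_CHAR_finite_field)
  finally have "(x - y) ^ ?P = 0" using assms by simp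
  then show ?thesis by simp
qed

text \<open>An algebraic element over a finite field has only finitely many powers, so two of its
  Frobenius iterates coincide. Injectivity of Frobenius cancels the common part.\<close>

lemma alg_closure_frobenius_fixed:
  fixes x :: "'a::{finite,field} alg_closure"
  obtains m where "m > 0" "x ^ (CHAR('a) ^ m) = x"
proof -
  obtain p :: "'a poly" where p: "p \<noteq> 0" "poly (map_poly to_ac p) x = 0" by (rule alg_closure_algebraic)
  have dp: "degree p > 0"
  proof (rule ccontr)
    assume "\<not> degree p > 0"
    then obtain c where c: "p = [:c:]" using degree_eq_zeroE by blast
    then show False using p by (simp add: map_poly_to_ac_pCons)
  qed
  \<comment> \<open>Reducing exponents modulo \<open>p\<close> expresses every power of
    \<open>x\<close> by a polynomial of degree below that of \<open>p\<close>, and there are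
    finitely many of these.\<close>
  let ?V = "(\<lambda>r. poly (map_poly to_ac r) x) ` {r. degree r < degree p}"
  have "x ^ i \<in> ?V" for i
  proof -
    let ?r = "monom 1 i mod p :: 'a poly"
    have "monom 1 i = monom 1 i div p * p + ?r" by simp
    then have "map_poly to_ac (monom 1 i) = map_poly to_ac (monom 1 i div p * p + ?r)" by (rule arg_cong)
    then have "poly (monom 1 i) x = poly (map_poly to_ac (monom 1 i div p * p + ?r)) x"
      by (simp only: map_poly_to_ac_monom)
    also have "\<dots> = poly (map_poly to_ac ?r) x"
      unfolding map_poly_to_ac_add map_poly_to_ac_mult using p(2) by simp
    finally have "x ^ i = poly (map_poly to_ac ?r) x" by (simp add: poly_monom)
    moreover have "degree ?r < degree p" using degree_mod_less[OF p(1), of "monom 1 i"] dp by auto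
    ultimately show ?thesis by blast
  qed
  then have "range (\<lambda>i. x ^ (CHAR('a) ^ i)) \<subseteq> ?V" by blast
  moreover have "finite ?V" using finite_poly_degree_less by (rule finite_imageI)
  ultimately have "finite (range (\<lambda>i. x ^ (CHAR('a) ^ i)))" by (rule finite_subset)
  then have "\<not> inj (\<lambda>i :: nat. x ^ (CHAR('a) ^ i))" using finite_imageD infinite_UNIV_nat by blast
  then obtain i j where "i \<noteq> j" and eq: "x ^ (CHAR('a) ^ i) = x ^ (CHAR('a) ^ j)" by (auto simp: inj_def)
  then have "\<exists>i j. i < j \<and> x ^ (CHAR('a) ^ i) = x ^ (CHAR('a) ^ j)"
    by (metis linorder_neq_iff)
  then obtain i j where ij: "i < j" "x ^ (CHAR('a) ^ i) = x ^ (CHAR('a) ^ j)" by blast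
  have "(x ^ (CHAR('a) ^ (j - i))) ^ (CHAR('a) ^ i) = x ^ (CHAR('a) ^ i)"
    using ij by (simp add: power_mult[symmetric] power_add[symmetric])
  then have "x ^ (CHAR('a) ^ (j - i)) = x" by (rule frobenius_inj)
  then show ?thesis using that[of "j - i"] ij(1) by simp
qed

lemma frobenius_fixed_mult:
  fixes x :: "'b::comm_ring_1"
  assumes "x ^ (p ^ m) = x" shows "x ^ (p ^ (m * k)) = x"
proof (induction k)
  case (Suc k)
  have "x ^ (p ^ (m * Suc k)) = (x ^ (p ^ (m * k))) ^ (p ^ m)" by (simp add: power_mult[symmetric] power_add mult.commute)
  then show ?case using Suc assms by simp
qed simp

text \<open>An exponent that works for an element may be replaced by any multiple, so the product of
  the exponents works for all elements.\<close>

lemma finite_alg_closure_frobenius_fixed: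
  fixes U :: "'a::{finite,field} alg_closure set"
  assumes "finite U"
  shows "\<exists>m>0. \<forall>x\<in>U. x ^ (CHAR('a) ^ m) = x"
  using assms
proof (induction U rule: finite_induct)
  case (insert y U)
  obtain m where m: "m > 0" "\<forall>x\<in>U. x ^ (CHAR('a) ^ m) = x" using insert.IH by blast
  obtain k where k: "k > 0" "y ^ (CHAR('a) ^ k) = y" using alg_closure_frobenius_fixed by blast
  have "\<forall>x\<in>insert y U. x ^ (CHAR('a) ^ (m * k)) = x"
    using frobenius_fixed_mult[of _ "CHAR('a)" m k] frobenius_fixed_mult[OF k(2), of m] m(2)
    by (auto simp: mult.commute[of m k])
  then show ?case using m(1) k(1) by (intro exI[of _ "m * k"]) auto
qed auto

text \<open>Used with \<open>N\<close> a power of the characteristic; its roots are then the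
  elements fixed by a power of Frobenius.\<close>

definition frob_poly :: "nat \<Rightarrow> 'a::field poly" where
  "frob_poly N = monom 1 N - [:0, 1:]"

lemma poly_frob_poly: "poly (frob_poly N) x = x ^ N - x"
  by (simp add: frob_poly_def poly_monom)

lemma map_poly_frob_poly: "map_poly to_ac (frob_poly N) = frob_poly N"
  by (simp add: frob_poly_def map_poly_to_ac_diff map_poly_to_ac_monom map_poly_to_ac_pCons)

text \<open>A square factor \<open>x * x\<close> makes \<open>x\<close> divide the derivative, which
  is \<open>-1\<close> because \<open>N\<close> vanishes in the field.\<close>

lemma frob_poly_squarefree:
  assumes N: "of_nat N = (0 :: 'a::field)"
  shows "(frob_poly N :: 'a poly) \<noteq> 0" "\<And>x :: 'a poly. x * x dvd frob_poly N \<Longrightarrow> is_unit x"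
proof -
  have d: "pderiv (frob_poly N :: 'a poly) = - 1"
    using N by (simp add: frob_poly_def pderiv_diff pderiv_monom pderiv_pCons one_pCons)
  then show "(frob_poly N :: 'a poly) \<noteq> 0" by auto
  fix x :: "'a poly" assume "x * x dvd frob_poly N"
  then obtain c where c: "frob_poly N = x * (x * c)" by (auto simp: dvd_def mult.assoc)
  have "pderiv (frob_poly N) = x * (pderiv (x * c) + pderiv x * c)"
    unfolding c by (simp add: pderiv_mult algebra_simps)
  then have "x dvd - 1" unfolding d by simp
  then show "is_unit x" by simp
qed

section \<open>Semisimplicity and annihilation over the base field\<close>

lemma map_mat_to_ac_mult:
  fixes A B :: "'a::field mat"
  assumes "A \<in> carrier_mat n n" "B \<in> carrier_mat n n"
  shows "map_mat to_ac (A * B) = map_mat to_ac A * map_mat to_ac B"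
  using assms by (intro eq_matI) (auto simp: scalar_prod_def to_ac_sum)

lemma poly_mat_map_to_ac:
  fixes M :: "'a::field mat"
  assumes M: "M \<in> carrier_mat n n"
  shows "poly_mat (map_poly to_ac p) (map_mat to_ac M) = map_mat to_ac (poly_mat p M)"
proof (induction p)
  case 0
  show ?case using M by (intro eq_matI) auto
next
  case (pCons a p)
  have M': "map_mat to_ac M \<in> carrier_mat n n" using M by simp
  have "poly_mat (map_poly to_ac (pCons a p)) (map_mat to_ac M) =
      to_ac a \<cdot>\<^sub>m 1\<^sub>m n + map_mat to_ac (M * poly_mat p M)"
    unfolding map_poly_to_ac_pCons poly_mat_pCons[OF M'] pCons.IH
      map_mat_to_ac_mult[OF M poly_mat_carrier[OF M]] ..
  also have "\<dots> = map_mat to_ac (poly_mat (pCons a p) M)"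
    unfolding poly_mat_pCons[OF M] using M poly_mat_carrier[OF M, of p]
    by (intro eq_matI) (auto simp del: index_mult_mat(1))
  finally show ?case .
qed

lemma annihilated_map_to_ac:
  fixes M :: "'a::field mat"
  assumes M: "M \<in> carrier_mat n n"
  shows "map_mat to_ac M \<in> annihilated (map_poly to_ac p) n \<longleftrightarrow> M \<in> annihilated p n"
proof -
  have "map_mat to_ac (poly_mat p M) = 0\<^sub>m n n \<longleftrightarrow> poly_mat p M = 0\<^sub>m n n"
  proof
    assume e: "map_mat to_ac (poly_mat p M) = 0\<^sub>m n n"
    have "poly_mat p M $$ (i, j) = 0" if "i < n" "j < n" for i j
      using arg_cong[OF e, of "\<lambda>A. A $$ (i, j)"] that poly_mat_carrier[OF M, of p] by simp
    then show "poly_mat p M = 0\<^sub>m n n" using poly_mat_carrier[OF M, of p] by (intro eq_matI) auto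
  next
    assume "poly_mat p M = 0\<^sub>m n n"
    then show "map_mat to_ac (poly_mat p M) = 0\<^sub>m n n" by (intro eq_matI) auto
  qed
  then show ?thesis using M by (simp add: annihilated_def poly_mat_map_to_ac[OF M])
qed

lemma poly_mat_diagonal:
  fixes D :: "'a::field mat"
  assumes D: "D \<in> carrier_mat n n" "diagonal_mat D"
  shows "poly_mat p D = mat n n (\<lambda>(i, j). if i = j then poly p (D $$ (i, i)) else 0)"
proof (induction p)
  case 0
  show ?case using D(1) by (intro eq_matI) auto
next
  case (pCons a p)
  have "D * mat n n (\<lambda>(i, j). if i = j then poly p (D $$ (i, i)) else 0)
      = mat n n (\<lambda>(i, j). if i = j then D $$ (i, i) * poly p (D $$ (i, i)) else 0)" (is "D * ?E = ?F")
  proof (rule eq_matI)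
    fix i j assume "i < dim_row ?F" "j < dim_col ?F"
    then have ij: "i < n" "j < n" by auto
    have "(D * ?E) $$ (i, j) = (\<Sum>s\<in>{0..<n}. D $$ (i, s) * ?E $$ (s, j))"
      using D ij by (simp add: scalar_prod_def)
    also have "\<dots> = (\<Sum>s\<in>{0..<n}. if s = i then D $$ (i, i) * ?E $$ (i, j) else 0)"
      using D ij by (intro sum.cong) (auto simp: diagonal_mat_def)
    finally show "(D * ?E) $$ (i, j) = ?F $$ (i, j)" using ij by simp
  qed (use D in auto)
  then show ?case unfolding poly_mat_pCons[OF D(1)] pCons.IH by (intro eq_matI) auto
qed

text \<open>A common Frobenius power fixes all eigenvalues, so \<open>x^N - x\<close> annihilates
  the diagonal form and hence the matrix. Its coefficients lie in the base field, so both the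
  annihilation and the squarefree factorization take place there.\<close>

lemma semisimple_imp_annihilated:
  fixes M :: "'a::{finite,field} mat"
  assumes M: "M \<in> carrier_mat n n" and ss: "semisimple M"
  obtains S where "finite S" "\<And>f. f \<in> S \<Longrightarrow> lead_coeff f = 1 \<and> Factorial_Ring.irreducible f" "M \<in> annihilated (\<Prod>S) n"
proof -
  obtain D :: "'a alg_closure mat" where D: "diagonal_mat D" "similar_mat (map_mat to_ac M) D"
    using ss unfolding semisimple_def by blast
  have M': "map_mat to_ac M \<in> carrier_mat n n" using M by simp
  obtain P where P: "P \<in> carrier_mat n n" "invertible_mat P" and Dc: "D \<in> carrier_mat n n"
    and MP: "map_mat to_ac M = P * D * inv_mat P"
    using similar_mat_obtain[OF D(2) M'] by blast
  obtain m where m: "m > 0" "\<forall>x\<in>(\<lambda>i. D $$ (i, i)) ` {..<n}. x ^ (CHAR('a) ^ m) = x"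
    using finite_alg_closure_frobenius_fixed[of "(\<lambda>i. D $$ (i, i)) ` {..<n}"] by auto
  let ?N = "CHAR('a) ^ m"
  have "poly_mat (frob_poly ?N) D = 0\<^sub>m n n"
    unfolding poly_mat_diagonal[OF Dc D(1)] using m(2) by (intro eq_matI) (auto simp: poly_frob_poly)
  then have "D \<in> annihilated (frob_poly ?N) n" using Dc by (simp add: annihilated_def)
  then have "map_mat to_ac M \<in> annihilated (map_poly to_ac (frob_poly ?N)) n"
    unfolding MP map_poly_frob_poly by (rule annihilated_conj[OF _ P(1) inv_mat(1,3)[OF P]])
  then have ann: "M \<in> annihilated (frob_poly ?N) n" using annihilated_map_to_ac[OF M] by blast
  have N: "of_nat ?N = (0 :: 'a)" using m(1) by simp
  obtain S where S: "finite S" "\<forall>f\<in>S. lead_coeff f = 1 \<and> Factorial_Ring.irreducible f"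
    "(frob_poly ?N :: 'a poly) dvd \<Prod>S"
    using squarefree_poly_factorization[OF frob_poly_squarefree[OF N]] by blast
  show ?thesis by (rule that[OF S(1)]) (use S(2) annihilated_dvd[OF S(3)] ann in auto)
qed

lemma prod_irreducible_dvd:
  fixes g :: "'a::field poly"
  assumes "finite S" "\<And>f. f \<in> S \<Longrightarrow> lead_coeff f = 1 \<and> Factorial_Ring.irreducible f \<and> f dvd g"
  shows "\<Prod>S dvd g"
  using assms
proof (induction S rule: finite_induct)
  case (insert f S)
  have f: "lead_coeff f = 1" "Factorial_Ring.irreducible f" "f dvd g" using insert.prems[of f] by auto
  have "\<not> f dvd h" if h: "h \<in> S" for h
  proof
    assume "f dvd h"
    moreover have "lead_coeff h = 1" "Factorial_Ring.irreducible h" using insert.prems[of h] h by auto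
    ultimately have "f = h" using monic_irreducible_dvd_imp_eq[OF f(1,2)] by simp
    then show False using h insert.hyps(2) by blast
  qed
  then obtain a b where ab: "a * f + b * \<Prod>S = 1"
    using irreducible_bezout_prod[OF f(2) insert.hyps(1)] by auto
  have S: "\<Prod>S dvd g" using insert.prems by (intro insert.IH) blast
  have "f * \<Prod>S dvd g * (a * f + b * \<Prod>S)"
    unfolding distrib_left
  proof (rule dvd_add)
    have "f * \<Prod>S dvd f * g" by (rule mult_dvd_mono[OF dvd_refl S])
    then show "f * \<Prod>S dvd g * (a * f)" using dvd_mult[of "f * \<Prod>S" "f * g" a] by (simp only: mult_ac)
    have "f * \<Prod>S dvd g * \<Prod>S" by (rule mult_dvd_mono[OF f(3) dvd_refl])
    then show "f * \<Prod>S dvd g * (b * \<Prod>S)" using dvd_mult[of "f * \<Prod>S" "g * \<Prod>S" b] by (simp only: mult_ac)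
  qed
  then show ?case unfolding ab prod.insert[OF insert.hyps] by simp
qed simp

text \<open>For suitable \<open>N\<close> every factor divides \<open>x^N - x\<close>. That
  polynomial stays squarefree over the closure, where it splits into distinct linear factors, and
  this makes the matrix diagonalizable there.\<close>

lemma annihilated_imp_semisimple:
  fixes M :: "'a::{finite,field} mat"
  assumes S: "finite S" "\<And>f. f \<in> S \<Longrightarrow> lead_coeff f = 1 \<and> Factorial_Ring.irreducible f"
    and M: "M \<in> annihilated (\<Prod>S) n"
  shows "semisimple M"
proof -
  note Mc = annihilatedD(1)[OF M]
  have "\<exists>x :: 'a alg_closure. poly (map_poly to_ac f) x = 0" if "f \<in> S" for f
  proof -
    have f: "f \<noteq> 0" "\<not> is_unit f" using S(2)[OF that] irreducible_not_unit by auto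
    then have "degree f > 0" using is_unit_iff_degree[OF f(1)] by simp
    then have "degree (map_poly to_ac f) > 0" by (subst degree_map_poly) auto
    then show ?thesis using alg_closed_imp_poly_has_root by blast
  qed
  then obtain \<rho> :: "'a poly \<Rightarrow> 'a alg_closure" where \<rho>: "\<And>f. f \<in> S \<Longrightarrow> poly (map_poly to_ac f) (\<rho> f) = 0" by metis
  obtain m where m: "m > 0" "\<forall>x\<in>\<rho> ` S. x ^ (CHAR('a) ^ m) = x"
    using finite_alg_closure_frobenius_fixed[of "\<rho> ` S"] S(1) by auto
  let ?N = "CHAR('a) ^ m"
  \<comment> \<open>One root in the closure suffices: if \<open>f\<close> did not divide, the Bezout
    identity evaluated at the common root \<open>\<rho> f\<close> would give
    \<open>0 = 1\<close>.\<close>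
  have "f dvd frob_poly ?N" if f: "f \<in> S" for f
  proof (rule ccontr)
    assume "\<not> f dvd frob_poly ?N"
    then obtain a b where ab: "a * f + b * frob_poly ?N = 1"
      using irreducible_poly_bezout S(2)[OF f] by blast
    have "poly (map_poly to_ac (a * f + b * frob_poly ?N)) (\<rho> f) = 0"
      unfolding map_poly_to_ac_add map_poly_to_ac_mult map_poly_frob_poly
      using \<rho>[OF f] m(2) f by (simp add: poly_frob_poly)
    then show False unfolding ab by simp
  qed
  then have "\<Prod>S dvd frob_poly ?N" using S by (intro prod_irreducible_dvd) auto
  then have "M \<in> annihilated (frob_poly ?N) n" using annihilated_dvd M by blast
  then have M': "map_mat to_ac M \<in> annihilated (frob_poly ?N) n"
    using annihilated_map_to_ac[OF Mc, of "frob_poly ?N"] by (simp only: map_poly_frob_poly)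
  have N: "of_nat ?N = (0 :: 'a alg_closure)"
    using m(1) of_nat_CHAR[where 'a = "'a alg_closure"] by simp
  obtain R where R: "finite R" "\<forall>f\<in>R. lead_coeff f = 1 \<and> Factorial_Ring.irreducible f"
    "(frob_poly ?N :: 'a alg_closure poly) dvd \<Prod>R"
    using squarefree_poly_factorization[OF frob_poly_squarefree[OF N]] by blast
  \<comment> \<open>Over an algebraically closed field the monic irreducibles are linear. The double
    sign matches the form \<open>[:-a, 1:]\<close> with root \<open>a = - coeff f 0\<close>.\<close>
  have lin: "f = [:- (- coeff f 0), 1:]" if f: "f \<in> R" for f
  proof -
    have "degree f \<le> 1" using alg_closed_imp_reducible[of f] R(2) f by (meson not_le)
    moreover have "degree f \<noteq> 0"
    proof
      assume "degree f = 0"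
      moreover have "f \<noteq> 0" using R(2) f by auto
      ultimately have "is_unit f" using is_unit_iff_degree by blast
      then show False using irreducible_not_unit R(2) f by blast
    qed
    ultimately have d: "degree f = 1" by simp
    then have "coeff f 1 = 1" using R(2) f by auto
    then show ?thesis using d by (intro poly_eqI) (auto simp: coeff_pCons coeff_eq_0 split: nat.splits)
  qed
  define U where "U = (\<lambda>f. - coeff f 0) ` R"
  have "R = (\<lambda>a. [:-a, 1:]) ` U" unfolding U_def image_image using lin by (auto simp: image_iff) 
  then have "\<Prod>R = (\<Prod>a\<in>U. [:-a, 1:])" by (subst \<open>R = _\<close>, subst prod.reindex) (auto simp: inj_on_def)
  then have "map_mat to_ac M \<in> annihilated (\<Prod>a\<in>U. [:-a, 1:]) n"
    using annihilated_dvd[OF R(3)] M' by auto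
  moreover have "finite U" using R(1) by (simp add: U_def)
  ultimately show ?thesis unfolding semisimple_def using diagonalizable_if_annihilated by blast
qed

section \<open>The generating functions of semisimple elements\<close>

text \<open>The block annihilated by \<open>f\<close> has a size divisible by
  \<open>degree f\<close> and at most \<open>n\<close>, hence size zero.\<close>

lemma annihilated_cancel_large_degree:
  fixes f g :: "'a::{finite,field} poly"
  assumes f: "lead_coeff f = 1" "Factorial_Ring.irreducible f" and deg: "n < degree f"
    and bez: "a * f + b * g = 1" and M: "M \<in> annihilated (f * g) n"
  shows "M \<in> annihilated g n"
proof -
  note Mc = annihilatedD[OF M]
  obtain k m A B where km: "n = k + m" and AB: "A \<in> carrier_mat k k" "B \<in> carrier_mat m m"
    "poly_mat f A = 0\<^sub>m k k" "poly_mat g B = 0\<^sub>m m m" and sim: "similar_mat M (diag2 A B)"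
    using coprime_block_decomposition[OF Mc(1) bez Mc(2)] by blast
  have "A \<in> annihilated f k" using AB by (simp add: annihilated_def)
  then have "degree f dvd k" using annihilated_irreducible_empty[OF f(1) refl _ f(2), of k] deg by auto
  then have k: "k = 0" using deg km by (auto dest: dvd_imp_le)
  obtain P where P: "P \<in> carrier_mat n n" "invertible_mat P" and MP: "M = P * diag2 A B * inv_mat P"
    using similar_mat_obtain[OF sim Mc(1)] by blast
  have "poly_mat g A = 0\<^sub>m k k" using poly_mat_carrier[OF AB(1), of g] k by (intro eq_matI) auto
  then have "poly_mat g (diag2 A B) = 0\<^sub>m n n" unfolding poly_mat_diag2[OF AB(1,2)] AB(4) km by simp
  then have "diag2 A B \<in> annihilated g n" using AB km by (simp add: annihilated_def)
  then show ?thesis unfolding MP by (rule annihilated_conj[OF _ P(1) inv_mat(1,3)[OF P]])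
qed

lemma annihilated_cancel_X:
  fixes M :: "'a::field mat"
  assumes inv: "invertible_mat M" and M: "M \<in> annihilated ([:0, 1:] * g) n"
  shows "M \<in> annihilated g n"
proof -
  note Mc = annihilatedD[OF M]
  have "M * poly_mat g M = M * 0\<^sub>m n n"
    using Mc by (simp only: poly_mat_mult[OF Mc(1)] poly_mat_X[OF Mc(1)]) simp
  then have "poly_mat g M = 0\<^sub>m n n"
    by (rule mult_mat_left_cancel[OF Mc(1) inv poly_mat_carrier[OF Mc(1)] zero_carrier_mat])
  then show ?thesis using Mc(1) by (simp add: annihilated_def)
qed

text \<open>The bound \<open>m\<close> keeps the set finite. Leaving out \<open>x\<close> reflects
  invertibility; leaving out \<open>x - 1\<close> isolates the one factor in which the two
  generating functions differ.\<close>

definition irreducibles :: "'a::{finite,field} itself \<Rightarrow> nat \<Rightarrow> 'a poly set" where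
  "irreducibles T m = {f. lead_coeff f = 1 \<and> Factorial_Ring.irreducible f \<and> degree f \<le> m \<and>
     f \<noteq> [:0, 1:] \<and> f \<noteq> [:-1, 1:]}"

lemma irreduciblesD:
  "f \<in> irreducibles T m \<Longrightarrow> lead_coeff f = 1 \<and> Factorial_Ring.irreducible f"
  by (simp add: irreducibles_def)

lemma finite_irreducibles: "finite (irreducibles T m)"
  by (rule finite_subset[OF _ finite_poly_degree_less[of "Suc m"]]) (auto simp: irreducibles_def)

lemma irreducible_linear: "Factorial_Ring.irreducible [:c, 1 :: 'a::field:]"
  by (rule irreducible_linear_field_poly) simp

lemma linear_bezout_irreducibles:
  fixes T :: "'a::{finite,field} itself"
  assumes "c = 0 \<or> c = -1"
  obtains a b where "a * [:c, 1 :: 'a:] + b * \<Prod>(irreducibles T m) = 1"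
proof -
  have "\<not> [:c, 1 :: 'a:] dvd f" if "f \<in> irreducibles T m" for f
  proof
    assume "[:c, 1:] dvd f"
    then have "[:c, 1:] = f"
      using monic_irreducible_dvd_imp_eq[OF _ irreducible_linear, of c f] irreduciblesD[OF that] by simp
    then show False using that assms by (auto simp: irreducibles_def)
  qed
  then show ?thesis
    using irreducible_bezout_prod[OF irreducible_linear finite_irreducibles] that by blast
qed

text \<open>This replaces a set of irreducibles depending on the matrix by one polynomial valid for
  all invertible matrices of size at most \<open>m\<close>. A factor outside the list is either
  \<open>x\<close>, which an invertible matrix can cancel, or of degree above the matrix
  size.\<close>

lemma semisimple_iff_annihilated:
  fixes T :: "'a::{finite,field} itself"
  assumes M: "M \<in> carrier_mat n n" and inv: "invertible_mat M" and m: "n \<le> m"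
  shows "semisimple (M :: 'a mat) \<longleftrightarrow> M \<in> annihilated ([:-1, 1:] * \<Prod>(irreducibles T m)) n"
proof
  let ?R = "insert [:-1, 1:] (irreducibles T m)"
  have finR: "finite ?R" using finite_irreducibles by simp
  have nin: "[:-1, 1 :: 'a:] \<notin> irreducibles T m" by (simp add: irreducibles_def)
  have irrR: "lead_coeff f = 1 \<and> Factorial_Ring.irreducible f" if "f \<in> ?R" for f
    using that irreduciblesD irreducible_linear[of "-1"] by auto
  have prodR: "\<Prod>?R = [:-1, 1:] * \<Prod>(irreducibles T m)"
    using prod.insert[OF finite_irreducibles nin, of "\<lambda>x. x"] by simp
  {
    assume "M \<in> annihilated ([:-1, 1:] * \<Prod>(irreducibles T m)) n"
    then show "semisimple M" unfolding prodR[symmetric] by (rule annihilated_imp_semisimple[OF finR, rotated]) (rule irrR)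
  }
  assume "semisimple M"
  then obtain S where S: "finite S" "\<And>f. f \<in> S \<Longrightarrow> lead_coeff f = 1 \<and> Factorial_Ring.irreducible f"
    "M \<in> annihilated (\<Prod>S) n" using semisimple_imp_annihilated[OF M] by metis
  \<comment> \<open>\<open>B\<close> collects the factors still to be discarded and \<open>C\<close>
    those to be kept; induction on \<open>B\<close> removes them singly.\<close>
  have drop: "M \<in> annihilated (\<Prod>C) n"
    if "finite B" "finite C" "B \<inter> C = {}" "B \<union> C \<subseteq> S" "B \<inter> ?R = {}" "M \<in> annihilated (\<Prod>(B \<union> C)) n" for B C
    using that
  proof (induction B rule: finite_induct)
    case (insert f B)
    have f: "lead_coeff f = 1" "Factorial_Ring.irreducible f" using S(2)[of f] insert.prems by auto
    have fin: "finite (B \<union> C)" using insert by simp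
    have fnin: "f \<notin> B \<union> C" using insert by auto
    have "\<Prod>(insert f B \<union> C) = f * \<Prod>(B \<union> C)"
      using prod.insert[OF fin fnin, of "\<lambda>x. x"] by simp
    then have Mf: "M \<in> annihilated (f * \<Prod>(B \<union> C)) n" using insert.prems(5) by simp
    have "M \<in> annihilated (\<Prod>(B \<union> C)) n"
    proof (cases "f = [:0, 1:]")
      case True
      then show ?thesis using annihilated_cancel_X[OF inv, of "\<Prod>(B \<union> C)" n] Mf by simp
    next
      case False
      then have "f \<notin> irreducibles T m" "f \<noteq> [:-1, 1:]" using insert.prems(4) by auto
      then have "m < degree f" using f False by (simp add: irreducibles_def)
      then have deg: "n < degree f" using m by simp
      have "\<not> f dvd h" if h: "h \<in> B \<union> C" for h
      proof
        assume "f dvd h"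
        moreover have "lead_coeff h = 1" "Factorial_Ring.irreducible h" using S(2)[of h] h insert.prems(3) by auto
        ultimately have "f = h" using monic_irreducible_dvd_imp_eq[OF f] by simp
        then show False using h fnin by blast
      qed
      then obtain a b where ab: "a * f + b * \<Prod>(B \<union> C) = 1"
        using irreducible_bezout_prod[OF f(2) fin] by auto
      show ?thesis by (rule annihilated_cancel_large_degree[OF f deg ab Mf])
    qed
    then show ?case using insert.prems by (intro insert.IH) auto
  qed simp
  have "(S - ?R) \<union> (S \<inter> ?R) = S" by blast
  then have "M \<in> annihilated (\<Prod>(S \<inter> ?R)) n"
    using drop[of "S - ?R" "S \<inter> ?R"] S(1,3) by auto
  moreover have "\<Prod>(S \<inter> ?R) dvd \<Prod>?R" using finR by (intro prod_dvd_prod_subset) auto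
  ultimately show "M \<in> annihilated ([:-1, 1:] * \<Prod>(irreducibles T m)) n"
    unfolding prodR[symmetric] using annihilated_dvd by blast
qed

section \<open>Coefficients of the two generating functions\<close>

lemma EA_eq:
  fixes T :: "'a::{finite,field} itself"
  shows "EA (real (card (UNIV :: 'a set))) = Abs_fps (\<lambda>k. 1 / real (card (A_set T k)))"
  by (simp add: EA_def real_card_A_set)

text \<open>\<open>EB\<close> is the factor of the linear polynomial \<open>x - 1\<close> in the
  general linear case. Exchanging it for \<open>EA\<close> gives the quotient in the final
  formula.\<close>

lemma EB_eq_Fd: "EB q = Fd q 1"
  by (simp add: EB_def Fd_def)

lemma ss_GL_eq:
  fixes T :: "'a::{finite,field} itself"
  assumes m: "n \<le> m"
  shows "ss_GL T n = (EB (real (card (UNIV :: 'a set))) * ann_fps T (\<Prod>(irreducibles T m))) $ n"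
proof -
  obtain a b where ab: "a * [:-1, 1:] + b * \<Prod>(irreducibles T m) = 1"
    using linear_bezout_irreducibles[of "-1" T m] by blast
  \<comment> \<open>The polynomial is coprime to \<open>x\<close>, so the matrices it annihilates
    are automatically invertible and may be counted among all matrices.\<close>
  obtain c d where cd: "c * [:0, 1:] + d * ([:-1, 1:] * \<Prod>(irreducibles T m)) = 1"
  proof -
    have "\<not> [:0, 1 :: 'a:] dvd [:-1, 1:]" by (simp add: dvd_iff_poly_eq_0[of 0, simplified])
    moreover have "\<not> [:0, 1 :: 'a:] dvd \<Prod>(irreducibles T m)"
    proof
      assume d: "[:0, 1 :: 'a:] dvd \<Prod>(irreducibles T m)"
      obtain a b where "a * [:0, 1:] + b * \<Prod>(irreducibles T m) = 1"
        using linear_bezout_irreducibles[of 0 T m] by blast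
      then have "[:0, 1 :: 'a:] dvd 1"
        using d by (metis dvd_add dvd_mult dvd_refl)
      then show False using irreducible_not_unit[OF irreducible_linear[of 0]] by blast
    qed
    ultimately have "\<not> [:0, 1:] dvd [:-1, 1:] * \<Prod>(irreducibles T m)"
      using prime_elem_dvd_mult_iff[OF field_poly_irreducible_imp_prime[OF irreducible_linear[of 0]]] by blast
    then show ?thesis using irreducible_poly_bezout[OF irreducible_linear[of 0]] that by blast
  qed
  have "{x \<in> GL_set T n. semisimple x} = annihilated ([:-1, 1:] * \<Prod>(irreducibles T m)) n"
  proof
    show "{x \<in> GL_set T n. semisimple x} \<subseteq> annihilated ([:-1, 1:] * \<Prod>(irreducibles T m)) n"
      using semisimple_iff_annihilated[OF _ _ m, of _ T] by (auto simp: GL_set_def)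
    show "annihilated ([:-1, 1:] * \<Prod>(irreducibles T m)) n \<subseteq> {x \<in> GL_set T n. semisimple x}"
    proof
      fix x assume x: "x \<in> annihilated ([:-1, 1:] * \<Prod>(irreducibles T m)) n"
      then have "x \<in> carrier_mat n n" "invertible_mat x"
        using annihilatedD(1) annihilated_invertible[OF x cd] by auto
      then show "x \<in> {x \<in> GL_set T n. semisimple x}"
        using semisimple_iff_annihilated[OF _ _ m, of x T] x by (simp add: GL_set_def)
    qed
  qed
  then have "ss_GL T n = ann_fps T ([:-1, 1:] * \<Prod>(irreducibles T m)) $ n"
    by (simp add: ss_GL_def ann_fps_def)
  also have "\<dots> = (ann_fps T [:-1, 1:] * ann_fps T (\<Prod>(irreducibles T m))) $ n"
    by (simp only: ann_fps_mult[OF ab])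
  also have "ann_fps T [:-1, 1:] = EB (real (card (UNIV :: 'a set)))"
    using ann_fps_irreducible[OF _ irreducible_linear[of "-1"], of T] by (simp add: EB_eq_Fd)
  finally show ?thesis .
qed

lemma ss_A_eq:
  fixes T :: "'a::{finite,field} itself"
  assumes m: "n < m"
  shows "ss_A T n = (EA (real (card (UNIV :: 'a set))) * ann_fps T (\<Prod>(irreducibles T m))) $ n"
proof -
  \<comment> \<open>Elements of \<open>A_set T n\<close> have size \<open>n + 1\<close>, which is
    why the truncation must be one degree higher than for \<open>ss_GL\<close>.\<close>
  have m': "n + 1 \<le> m" using m by simp
  obtain a b where ab: "a * [:-1, 1:] + b * \<Prod>(irreducibles T m) = 1"
    using linear_bezout_irreducibles[of "-1" T m] by blast
  obtain c d where cd: "c * [:0, 1:] + d * \<Prod>(irreducibles T m) = 1"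
    using linear_bezout_irreducibles[of 0 T m] by blast
  have "{x \<in> A_set T n. semisimple x} = A_set T n \<inter> annihilated ([:-1, 1:] * \<Prod>(irreducibles T m)) (n + 1)"
    using semisimple_iff_annihilated[OF _ _ m', of _ T] by (auto simp: A_set_def GL_set_def)
  then have "ss_A T n = real (card (A_set T n \<inter> annihilated ([:-1, 1:] * \<Prod>(irreducibles T m)) (n + 1))) / real (card (A_set T n))"
    by (simp add: ss_A_def)
  also have "\<dots> = (\<Sum>k\<le>n. 1 / real (card (A_set T k)) *
      (real (card (annihilated (\<Prod>(irreducibles T m)) (n - k))) / real (card (GL_set T (n - k)))))"
    by (rule card_A_set_annihilated[OF ab cd])
  also have "\<dots> = (EA (real (card (UNIV :: 'a set))) * ann_fps T (\<Prod>(irreducibles T m))) $ n"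
    by (simp add: EA_eq[of T] ann_fps_def fps_mult_nth atLeast0AtMost)
  finally show ?thesis .
qed

lemma card_irreducibles_degree:
  fixes T :: "'a::{finite,field} itself"
  assumes "d \<in> {1..m}"
  shows "card {f \<in> irreducibles T m. degree f = d} = N' T d"
proof (cases "d = 1")
  case True
  have "{f \<in> irreducibles T m. degree f = d} = (\<lambda>c. [:c, 1:]) ` (UNIV - {0, -1 :: 'a})"
  proof
    show "{f \<in> irreducibles T m. degree f = d} \<subseteq> (\<lambda>c. [:c, 1:]) ` (UNIV - {0, -1})"
    proof
      fix f assume f: "f \<in> {f \<in> irreducibles T m. degree f = d}"
      then have "f = [:coeff f 0, 1:]" using True
        by (intro poly_eqI) (auto simp: irreducibles_def coeff_pCons coeff_eq_0 split: nat.splits)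
      moreover have "f \<noteq> [:0, 1:]" "f \<noteq> [:-1, 1:]" using f by (auto simp: irreducibles_def)
      ultimately show "f \<in> (\<lambda>c. [:c, 1:]) ` (UNIV - {0, -1})" by (metis Diff_iff UNIV_I image_eqI insert_iff singletonD)
    qed
    show "(\<lambda>c. [:c, 1:]) ` (UNIV - {0, -1 :: 'a}) \<subseteq> {f \<in> irreducibles T m. degree f = d}"
      using True assms irreducible_linear by (auto simp: irreducibles_def)
  qed
  moreover have "inj_on (\<lambda>c. [:c, 1:]) (UNIV - {0, -1 :: 'a})" by (auto simp: inj_on_def)
  ultimately have "card {f \<in> irreducibles T m. degree f = d} = card (UNIV - {0, -1 :: 'a})" by (simp add: card_image)
  \<comment> \<open>The constants \<open>0\<close> and \<open>-1\<close> are distinct in a field, so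
    exactly two of the \<open>q\<close> monic linear polynomials are missing.\<close>
  also have "\<dots> = card (UNIV :: 'a set) - 2" by (subst card_Diff_subset) auto
  finally show ?thesis using True by (simp add: N'_def)
next
  case False
  then have "{f \<in> irreducibles T m. degree f = d} =
      {p :: 'a poly. lead_coeff p = 1 \<and> Factorial_Ring.irreducible p \<and> degree p = d}"
    using assms by (auto simp: irreducibles_def)
  then show ?thesis using False by (simp add: N'_def N_irr_def)
qed

text \<open>The factor of an irreducible depends only on its degree, so grouping by degree turns the
  product into powers.\<close>

lemma ann_fps_irreducibles:
  fixes T :: "'a::{finite,field} itself"
  shows "ann_fps T (\<Prod>(irreducibles T m)) = (\<Prod>d\<in>{1..m}. Fd (real (card (UNIV :: 'a set))) d ^ N' T d)"
proof -
  let ?F = "Fd (real (card (UNIV :: 'a set)))"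
  have deg: "degree ` irreducibles T m \<subseteq> {1..m}"
  proof
    fix d assume "d \<in> degree ` irreducibles T m"
    then obtain f where f: "f \<in> irreducibles T m" "d = degree f" by blast
    have "f \<noteq> 0" "\<not> is_unit f" using irreduciblesD[OF f(1)] irreducible_not_unit by auto
    then have "degree f \<noteq> 0" using is_unit_iff_degree by blast
    then show "d \<in> {1..m}" using f by (simp add: irreducibles_def)
  qed
  have "ann_fps T (\<Prod>(irreducibles T m)) = (\<Prod>f\<in>irreducibles T m. ?F (degree f))"
    by (rule ann_fps_prod[OF finite_irreducibles irreduciblesD])
  also have "\<dots> = (\<Prod>d\<in>{1..m}. \<Prod>f\<in>{f \<in> irreducibles T m. degree f = d}. ?F (degree f))"
    by (rule prod.group[OF finite_irreducibles _ deg, symmetric]) simp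
  also have "\<dots> = (\<Prod>d\<in>{1..m}. ?F d ^ N' T d)"
  proof (rule prod.cong[OF refl])
    fix d assume d: "d \<in> {1..m}"
    have "(\<Prod>f\<in>{f \<in> irreducibles T m. degree f = d}. ?F (degree f)) = (\<Prod>f\<in>{f \<in> irreducibles T m. degree f = d}. ?F d)"
      by (rule prod.cong) auto
    then show "(\<Prod>f\<in>{f \<in> irreducibles T m. degree f = d}. ?F (degree f)) = ?F d ^ N' T d"
      using card_irreducibles_degree[OF d, of T] by simp
  qed
  finally show ?thesis .
qed

text \<open>The infinite product is read as the limit of its partial products in the topology of
  formal power series; coefficient \<open>n\<close> is already final for every
  \<open>m > n\<close>.\<close>

theorem theorem5p9:
  fixes T :: "'a::{finite,field} itself"
  shows "(\<lambda>m. EA (real (card (UNIV :: 'a set))) * (\<Prod>d\<in>{1..m}. Fd (real (card (UNIV :: 'a set))) d ^ N' T d))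
            \<longlonglongrightarrow> SS_A T
       \<and> SS_A T = (EA (real (card (UNIV :: 'a set))) / EB (real (card (UNIV :: 'a set)))) * SS_GL T"
proof -
  let ?EA = "EA (real (card (UNIV :: 'a set)))" and ?EB = "EB (real (card (UNIV :: 'a set)))"
  let ?G = "\<lambda>m. ann_fps T (\<Prod>(irreducibles T m))"
  have A: "SS_A T $ n = (?EA * ?G m) $ n" if "n < m" for n m
    using ss_A_eq[OF that, of T] by (simp add: SS_A_def)
  have GL: "SS_GL T $ n = (?EB * ?G m) $ n" if "n < m" for n m
    using ss_GL_eq[of n m T] that by (simp add: SS_GL_def)
  have lim: "(\<lambda>m. ?EA * ?G m) \<longlonglongrightarrow> SS_A T"
  proof (rule tendsto_fpsI)
    fix n
    show "\<forall>\<^sub>F m in sequentially. (?EA * ?G m) $ n = SS_A T $ n"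
      using eventually_gt_at_top[of n] by eventually_elim (simp only: A)
  qed
  \<comment> \<open>Neither side needs the limit: coefficient \<open>n\<close> involves only
    coefficients up to \<open>n\<close>, for which the single truncation \<open>?G (Suc n)\<close>
    serves both series.\<close>
  have eq: "?EB * SS_A T = ?EA * SS_GL T"
  proof (rule fps_ext)
    fix n
    have "(?EB * SS_A T) $ n = (?EB * (?EA * ?G (Suc n))) $ n"
      unfolding fps_mult_nth[of ?EB] by (intro sum.cong refl arg_cong2[where f = "(*)"] A) auto
    also have "\<dots> = (?EA * (?EB * ?G (Suc n))) $ n" by (simp only: mult.left_commute)
    also have "\<dots> = (?EA * SS_GL T) $ n"
      unfolding fps_mult_nth[of ?EA] by (intro sum.cong refl arg_cong2[where f = "(*)"] GL[symmetric]) auto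
    finally show "(?EB * SS_A T) $ n = (?EA * SS_GL T) $ n" .
  qed
  \<comment> \<open>The constant term is \<open>1\<close>, so \<open>?EB\<close> is a unit and the
    quotient of power series is multiplication by its inverse.\<close>
  have EB0: "?EB $ 0 \<noteq> 0" by (simp add: EB_def qpoch_def)
  have "SS_A T = inverse ?EB * ?EB * SS_A T" unfolding inverse_mult_eq_1[OF EB0] by simp
  also have "\<dots> = inverse ?EB * (?EA * SS_GL T)" unfolding eq[symmetric] by (rule mult.assoc)
  also have "\<dots> = ?EA * inverse ?EB * SS_GL T" by (simp only: mult_ac)
  also have "\<dots> = ?EA / ?EB * SS_GL T" unfolding fps_divide_unit[OF EB0] ..
  finally have "SS_A T = ?EA / ?EB * SS_GL T" .
  then show ?thesis using lim unfolding ann_fps_irreducibles by blast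
qed

end
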